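(* Let $\mathcal{A}^*$ be a Poincaré DGCA over $\mathbb{K}$ admitting a Hodge homotopy. The Harrison cohomology class of $\mu_3$ is independent of the Hodge homotopy used to define it: if $d^-$ and $d'^-$ are two Hodge homotopies for $\mathcal{A}^*$, with associated ternary operations $\mu_3$ and $\mu_3'$ on $H^*(\mathcal{A})$, then $[\mu_3]=[\mu_3']$ in $\mathrm{HHarr}^{3,-1}(H^*(\mathcal{A}),H^*(\mathcal{A}))$. Hence there is a well-defined class $[\mu_3]\in\mathrm{HHarr}^{3,-1}(H^*(\mathcal{A}),H^*(\mathcal{A}))$ depending only on the Poincaré DGCA $\mathcal{A}^*$ and not on the choice of a Hodge homotopy.
   Context: $\mathbb{K}$ is a field of characteristic zero. A DGCA is a unital differential graded commutative algebra with differential $d$ of degree $+1$. A Poincaré DGCA of degree $n$ is a DGCA $(\mathcal{A}^*=\bigoplus_{k=0}^n\mathcal{A}^k,d)$ with finite-dimensional cohomology $H^*(\mathcal{A})$ and a linear functional (fundamental class) $\int: H^n(\mathcal{A})\to\mathbb{K}$ such that the pairing on $H^*(\mathcal{A})$ given on homogeneous elements by $\langle a,b\rangle=\int a\cdot b$ if $\deg a+\deg b=n$ and $0$ otherwise is non-degenerate. It induces a pairing on $\mathcal{A}^*$: $\langle\alpha,\beta\rangle=\int[\alpha\cdot\beta]$ if $\deg\alpha+\deg\beta=n$, and $0$ otherwise. A Hodge homotopy is a linear operator $d^-:\mathcal{A}^*\to\mathcal{A}^{*-1}$ with $d^-d^-=0$, $d^-dd^-=d^-$, $dd^-d=d$,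 $\langle \mathrm{Im}(d^-),\mathrm{Im}(d^-)\rangle=0$ and $\langle\mathrm{Im}(\pi_{\mathcal{H}}),\mathrm{Im}(d^-)\rangle=0$, where $\pi_{\mathcal{H}}:=\mathrm{id}_{\mathcal{A}^*}-(dd^-+d^-d)$ (a projection). The harmonic subspace is $\mathcal{H}^*:=\mathrm{Im}(\pi_{\mathcal{H}})$; it consists of closed elements and $\mathcal{H}^*\to H^*(\mathcal{A})$, $\alpha\mapsto[\alpha]$, is an isomorphism, with inverse denoted $\iota:H^*(\mathcal{A})\to\mathcal{H}^*\subseteq\mathcal{A}^*$. Harrison cohomology: for a graded commutative algebra $B$, $\mathrm{CHoch}^{p,q}(B,B)$ is the space of linear maps $f:B^{\otimes p}\to B$ of degree $q$, with differential $\mathrm{CHoch}^{p,q}\to\mathrm{CHoch}^{p+1,q}$ $$(d_{\mathrm{Hoch}}f)(a_1,\dots,a_{p+1})=(-1)^{q\deg a_1}a_1f(a_2,\dots,a_{p+1})+\sum_{i=1}^p(-1)^if(a_1,\dots,a_ia_{i+1},\dots,a_{p+1})+(-1)^{p+1}f(a_1,\dots,a_p)a_{p+1}.$$ $\mathrm{CHarr}^{p,q}(B,B)$ is the subcomplex of cochains vanishing on signed shuffles (for $0<i<p$, the sum over $(i,p-i)$-shuffles of $f$ applied to the shuffled arguments, with sign the product of the sign of the permutation and the Koszul sign, is zero); $\mathrm{HHarr}^{p,q}(B,B)$ is its cohomology. The operation $\mu_3$ associated with a Hodge homotopy $d^-$ (with its $\pi_{\mathcal{H}}$ and $\iota$)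 is $$\mu_3(a,b,c)=\big[\pi_{\mathcal{H}}\big(d^-(\iota(a)\cdot\iota(b))\cdot\iota(c)-(-1)^{\deg a}\iota(a)\cdot d^-(\iota(b)\cdot\iota(c))\big)\big].$$ It is the ternary operation of the minimal unital $C_\infty$-structure on $H^*(\mathcal{A})$, with binary operation the cohomology product, obtained from $\mathcal{A}^*$ by homotopy transfer along $d^-$ followed by the identification $\mathcal{H}^*\cong H^*(\mathcal{A})$; it is a Harrison cocycle of bidegree $(3,-1)$. *)

theory Defs
  imports
    "HOL-Algebra.Module"
    "HOL-Algebra.QuotRing"
    "HOL-Combinatorics.Permutations"
    "HOL-Library.FuncSet"
begin

section \<open>Signs\<close>

text \<open>The integer \<open>(-1)\<^sup>m\<close> for \<open>m \<in> \<int>\<close>. It acts on abelian groups through \<^const>\<open>add_pow\<close>,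
  written \<open>[k] \<cdot> x\<close>.\<close>

definition neg1_pow :: "int \<Rightarrow> int" where
  "neg1_pow m = (if even m then 1 else - 1)"


section \<open>Graded commutative algebras\<close>

text \<open>Gradings are internal and indexed by \<open>\<int>\<close>: \<open>homog B k\<close> is the subspace of homogeneous
  elements of degree \<open>k\<close> (including \<open>0\<close>).\<close>

record ('k, 'a) graded_algebra = "('k, 'a) module" +
  homog :: "int \<Rightarrow> 'a set"

definition linear_on ::
    "('k, 'm) ring_scheme \<Rightarrow> ('k, 'a, 'n) module_scheme \<Rightarrow> 'a set \<Rightarrow>
     ('k, 'b, 'o) module_scheme \<Rightarrow> ('a \<Rightarrow> 'b) \<Rightarrow> bool" where
  "linear_on K V S W f \<longleftrightarrow>
     f \<in> S \<rightarrow> carrier W \<and>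
     (\<forall>x\<in>S. \<forall>y\<in>S. f (x \<oplus>\<^bsub>V\<^esub> y) = f x \<oplus>\<^bsub>W\<^esub> f y) \<and>
     (\<forall>r\<in>carrier K. \<forall>x\<in>S. f (r \<odot>\<^bsub>V\<^esub> x) = r \<odot>\<^bsub>W\<^esub> f x)"

definition is_decomposition :: "('k, 'a, 'm) graded_algebra_scheme \<Rightarrow> 'a \<Rightarrow> (int \<Rightarrow> 'a) \<Rightarrow> bool" where
  "is_decomposition B x c \<longleftrightarrow>
     (\<forall>k. c k \<in> homog B k) \<and> finite {k. c k \<noteq> \<zero>\<^bsub>B\<^esub>} \<and>
     x = (\<Oplus>\<^bsub>B\<^esub>k\<in>{k. c k \<noteq> \<zero>\<^bsub>B\<^esub>}. c k)"

definition homog_part :: "('k, 'a, 'm) graded_algebra_scheme \<Rightarrow> int \<Rightarrow> 'a \<Rightarrow> 'a" where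
  "homog_part B k x = (THE c. is_decomposition B x c) k"

text \<open>The linear extension of \<open>x \<mapsto> (-1)\<^bsup>q deg x\<^esup> x\<close> from homogeneous to arbitrary elements.\<close>

definition twist :: "('k, 'a, 'm) graded_algebra_scheme \<Rightarrow> int \<Rightarrow> 'a \<Rightarrow> 'a" where
  "twist B q x =
     (\<Oplus>\<^bsub>B\<^esub>k\<in>{k. homog_part B k x \<noteq> \<zero>\<^bsub>B\<^esub>}. [neg1_pow (q * k)] \<cdot>\<^bsub>B\<^esub> homog_part B k x)"

locale graded_comm_algebra = field K + module K B + ring B
  for K :: "('k, 'm) ring_scheme" (structure)
    and B :: "('k, 'a, 'n) graded_algebra_scheme" (structure) +
  assumes char_zero: "\<And>m :: nat. m > 0 \<Longrightarrow> [m] \<cdot>\<^bsub>K\<^esub> \<one>\<^bsub>K\<^esub> \<noteq> \<zero>\<^bsub>K\<^esub>"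
    and smult_mult_left: "\<And>r x y. \<lbrakk>r \<in> carrier K; x \<in> carrier B; y \<in> carrier B\<rbrakk> \<Longrightarrow>
          (r \<odot>\<^bsub>B\<^esub> x) \<otimes>\<^bsub>B\<^esub> y = r \<odot>\<^bsub>B\<^esub> (x \<otimes>\<^bsub>B\<^esub> y)"
    and smult_mult_right: "\<And>r x y. \<lbrakk>r \<in> carrier K; x \<in> carrier B; y \<in> carrier B\<rbrakk> \<Longrightarrow>
          x \<otimes>\<^bsub>B\<^esub> (r \<odot>\<^bsub>B\<^esub> y) = r \<odot>\<^bsub>B\<^esub> (x \<otimes>\<^bsub>B\<^esub> y)"
    and homog_submodule: "\<And>k. submodule (homog B k) K B"
    and direct_sum: "\<And>x. x \<in> carrier B \<Longrightarrow> \<exists>!c. is_decomposition B x c"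
    and one_homog: "\<one>\<^bsub>B\<^esub> \<in> homog B 0"
    and mult_homog: "\<And>i j x y. \<lbrakk>x \<in> homog B i; y \<in> homog B j\<rbrakk> \<Longrightarrow> x \<otimes>\<^bsub>B\<^esub> y \<in> homog B (i + j)"
    and graded_comm: "\<And>i j x y. \<lbrakk>x \<in> homog B i; y \<in> homog B j\<rbrakk> \<Longrightarrow>
          x \<otimes>\<^bsub>B\<^esub> y = [neg1_pow (i * j)] \<cdot>\<^bsub>B\<^esub> (y \<otimes>\<^bsub>B\<^esub> x)"


section \<open>Differential graded commutative algebras and their cohomology\<close>

locale dgca = graded_comm_algebra K A
  for K :: "('k, 'm) ring_scheme" (structure)
    and A :: "('k, 'a, 'n) graded_algebra_scheme" (structure)
    and d :: "'a \<Rightarrow> 'a" +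
  assumes d_linear: "linear_on K A (carrier A) A d"
    and d_homog: "\<And>k x. x \<in> homog A k \<Longrightarrow> d x \<in> homog A (k + 1)"
    and d_squared: "\<And>x. x \<in> carrier A \<Longrightarrow> d (d x) = \<zero>\<^bsub>A\<^esub>"
    and leibniz: "\<And>k x y. \<lbrakk>x \<in> homog A k; y \<in> carrier A\<rbrakk> \<Longrightarrow>
          d (x \<otimes>\<^bsub>A\<^esub> y) = (d x \<otimes>\<^bsub>A\<^esub> y) \<oplus>\<^bsub>A\<^esub> [neg1_pow k] \<cdot>\<^bsub>A\<^esub> (x \<otimes>\<^bsub>A\<^esub> d y)"

definition cocycles :: "('k, 'a, 'm) graded_algebra_scheme \<Rightarrow> ('a \<Rightarrow> 'a) \<Rightarrow> 'a set" where
  "cocycles A d = {x \<in> carrier A. d x = \<zero>\<^bsub>A\<^esub>}"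

definition coboundaries :: "('k, 'a, 'm) graded_algebra_scheme \<Rightarrow> ('a \<Rightarrow> 'a) \<Rightarrow> 'a set" where
  "coboundaries A d = d ` carrier A"

definition cohom_class :: "('k, 'a, 'm) graded_algebra_scheme \<Rightarrow> ('a \<Rightarrow> 'a) \<Rightarrow> 'a \<Rightarrow> 'a set" where
  "cohom_class A d x = coboundaries A d +>\<^bsub>A\<^esub> x"

definition cohomology ::
    "('k, 'a, 'm) graded_algebra_scheme \<Rightarrow> ('a \<Rightarrow> 'a) \<Rightarrow> ('k, 'a set) graded_algebra" where
  "cohomology A d =
     (let Q = (A\<lparr>carrier := cocycles A d\<rparr>) Quot (coboundaries A d) in
      \<lparr>carrier = carrier Q, monoid.mult = monoid.mult Q, one = one Q, zero = zero Q, add = add Q,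
       smult = (\<lambda>r X. \<Union>x\<in>X. cohom_class A d (r \<odot>\<^bsub>A\<^esub> x)),
       homog = (\<lambda>k. cohom_class A d ` (cocycles A d \<inter> homog A k))\<rparr>)"


section \<open>Poincare algebras and Hodge homotopies\<close>

definition finite_dimensional ::
    "('k, 'm) ring_scheme \<Rightarrow> ('k, 'a, 'n) module_scheme \<Rightarrow> bool" where
  "finite_dimensional K V \<longleftrightarrow>
     (\<exists>S. finite S \<and> S \<subseteq> carrier V \<and>
        (\<forall>x\<in>carrier V. \<exists>c\<in>S \<rightarrow> carrier K. x = (\<Oplus>\<^bsub>V\<^esub>s\<in>S. c s \<odot>\<^bsub>V\<^esub> s)))"

text \<open>The bilinear extension of the pairing which on homogeneous elements is
  \<open>\<phi> (x \<otimes> y)\<close> if \<open>deg x + deg y = n\<close> and \<open>0\<close> otherwise, for \<open>B\<close> concentrated in degrees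
  \<open>0, \<dots>, n\<close>. The functional \<open>\<phi>\<close> only has to be meaningful in degree \<open>n\<close>.\<close>

definition top_pairing ::
    "('k, 'm) ring_scheme \<Rightarrow> ('k, 'a, 'n) graded_algebra_scheme \<Rightarrow> nat \<Rightarrow> ('a \<Rightarrow> 'k) \<Rightarrow>
     'a \<Rightarrow> 'a \<Rightarrow> 'k" where
  "top_pairing K B n \<phi> x y =
     (\<Oplus>\<^bsub>K\<^esub>k\<in>{0..int n}. \<phi> (homog_part B k x \<otimes>\<^bsub>B\<^esub> homog_part B (int n - k) y))"

definition nondegenerate_pairing ::
    "('k, 'm) ring_scheme \<Rightarrow> ('k, 'a, 'n) module_scheme \<Rightarrow> ('a \<Rightarrow> 'a \<Rightarrow> 'k) \<Rightarrow> bool" where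
  "nondegenerate_pairing K V b \<longleftrightarrow>
     (\<forall>x\<in>carrier V. (\<forall>y\<in>carrier V. b x y = \<zero>\<^bsub>K\<^esub>) \<longrightarrow> x = \<zero>\<^bsub>V\<^esub>) \<and>
     (\<forall>y\<in>carrier V. (\<forall>x\<in>carrier V. b x y = \<zero>\<^bsub>K\<^esub>) \<longrightarrow> y = \<zero>\<^bsub>V\<^esub>)"

locale poincare_dgca = dgca K A d
  for K :: "('k, 'm) ring_scheme" (structure)
    and A :: "('k, 'a, 'n) graded_algebra_scheme" (structure)
    and d :: "'a \<Rightarrow> 'a"
    and n :: nat
    and fc :: "'a set \<Rightarrow> 'k" +
  assumes bounded: "\<And>k. k \<notin> {0..int n} \<Longrightarrow> homog A k = {\<zero>\<^bsub>A\<^esub>}"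
    and cohomology_finite_dim: "finite_dimensional K (cohomology A d)"
    and fc_closed: "\<And>X. X \<in> homog (cohomology A d) (int n) \<Longrightarrow> fc X \<in> carrier K"
    and fc_add: "\<And>X Y. \<lbrakk>X \<in> homog (cohomology A d) (int n); Y \<in> homog (cohomology A d) (int n)\<rbrakk> \<Longrightarrow>
          fc (X \<oplus>\<^bsub>cohomology A d\<^esub> Y) = fc X \<oplus>\<^bsub>K\<^esub> fc Y"
    and fc_smult: "\<And>r X. \<lbrakk>r \<in> carrier K; X \<in> homog (cohomology A d) (int n)\<rbrakk> \<Longrightarrow>
          fc (r \<odot>\<^bsub>cohomology A d\<^esub> X) = r \<otimes>\<^bsub>K\<^esub> fc X"
    and nondegenerate: "nondegenerate_pairing K (cohomology A d)
          (top_pairing K (cohomology A d) n fc)"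

text \<open>The induced pairing on cochains; products of total degree \<open>n\<close> are closed because
  there is nothing in degree \<open>n + 1\<close>.\<close>

definition cochain_pairing ::
    "('k, 'm) ring_scheme \<Rightarrow> ('k, 'a, 'n) graded_algebra_scheme \<Rightarrow> ('a \<Rightarrow> 'a) \<Rightarrow> nat \<Rightarrow>
     ('a set \<Rightarrow> 'k) \<Rightarrow> 'a \<Rightarrow> 'a \<Rightarrow> 'k" where
  "cochain_pairing K A d n fc = top_pairing K A n (\<lambda>x. fc (cohom_class A d x))"

definition harm_proj ::
    "('k, 'a, 'n) graded_algebra_scheme \<Rightarrow> ('a \<Rightarrow> 'a) \<Rightarrow> ('a \<Rightarrow> 'a) \<Rightarrow> 'a \<Rightarrow> 'a" where
  "harm_proj A d dm x = x \<ominus>\<^bsub>A\<^esub> (d (dm x) \<oplus>\<^bsub>A\<^esub> dm (d x))"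

definition hodge_homotopy ::
    "('k, 'm) ring_scheme \<Rightarrow> ('k, 'a, 'n) graded_algebra_scheme \<Rightarrow> ('a \<Rightarrow> 'a) \<Rightarrow> nat \<Rightarrow>
     ('a set \<Rightarrow> 'k) \<Rightarrow> ('a \<Rightarrow> 'a) \<Rightarrow> bool" where
  "hodge_homotopy K A d n fc dm \<longleftrightarrow>
     linear_on K A (carrier A) A dm \<and>
     (\<forall>k. \<forall>x\<in>homog A k. dm x \<in> homog A (k - 1)) \<and>
     (\<forall>x\<in>carrier A. dm (dm x) = \<zero>\<^bsub>A\<^esub>) \<and>
     (\<forall>x\<in>carrier A. dm (d (dm x)) = dm x) \<and>
     (\<forall>x\<in>carrier A. d (dm (d x)) = d x) \<and>
     (\<forall>x\<in>dm ` carrier A. \<forall>y\<in>dm ` carrier A. cochain_pairing K A d n fc x y = \<zero>\<^bsub>K\<^esub>) \<and>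
     (\<forall>x\<in>harm_proj A d dm ` carrier A. \<forall>y\<in>dm ` carrier A.
        cochain_pairing K A d n fc x y = \<zero>\<^bsub>K\<^esub>)"

definition harmonic ::
    "('k, 'a, 'n) graded_algebra_scheme \<Rightarrow> ('a \<Rightarrow> 'a) \<Rightarrow> ('a \<Rightarrow> 'a) \<Rightarrow> 'a set" where
  "harmonic A d dm = harm_proj A d dm ` carrier A"

definition harm_rep ::
    "('k, 'a, 'n) graded_algebra_scheme \<Rightarrow> ('a \<Rightarrow> 'a) \<Rightarrow> ('a \<Rightarrow> 'a) \<Rightarrow> 'a set \<Rightarrow> 'a" where
  "harm_rep A d dm = the_inv_into (harmonic A d dm) (cohom_class A d)"


section \<open>The Harrison complex\<close>

definition tuples :: "('k, 'a, 'n) graded_algebra_scheme \<Rightarrow> nat \<Rightarrow> 'a list set" where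
  "tuples B p = {as. set as \<subseteq> carrier B \<and> length as = p}"

definition homog_tuple ::
    "('k, 'a, 'n) graded_algebra_scheme \<Rightarrow> int list \<Rightarrow> 'a list \<Rightarrow> bool" where
  "homog_tuple B ks as \<longleftrightarrow> list_all2 (\<lambda>k a. a \<in> homog B k) ks as"

definition multilinear ::
    "('k, 'm) ring_scheme \<Rightarrow> ('k, 'a, 'n) graded_algebra_scheme \<Rightarrow> nat \<Rightarrow>
     ('a list \<Rightarrow> 'a) \<Rightarrow> bool" where
  "multilinear K B p f \<longleftrightarrow>
     (\<forall>as\<in>tuples B p. \<forall>i<p. linear_on K B (carrier B) B (\<lambda>x. f (as[i := x])))"

text \<open>A linear map \<open>B\<^bsup>\<otimes>p\<^esup> \<rightarrow> B\<close> is encoded as a multilinear map on \<open>p\<close>-tuples, extensional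
  outside of \<^term>\<open>tuples B p\<close> so that equal cochains are equal as functions.\<close>

definition CHoch ::
    "('k, 'm) ring_scheme \<Rightarrow> ('k, 'a, 'n) graded_algebra_scheme \<Rightarrow> nat \<Rightarrow> int \<Rightarrow>
     ('a list \<Rightarrow> 'a) set" where
  "CHoch K B p q =
     {f \<in> tuples B p \<rightarrow>\<^sub>E carrier B.
        multilinear K B p f \<and>
        (\<forall>as\<in>tuples B p. \<forall>ks. homog_tuple B ks as \<longrightarrow> f as \<in> homog B (sum_list ks + q))}"

text \<open>In the \<open>i\<close>-th summand, the product \<open>a\<^sub>i a\<^sub>i\<^sub>+\<^sub>1\<close> of the 1-based formula is
  \<open>as ! (i - 1) \<otimes> as ! i\<close>.\<close>

definition d_Hoch ::
    "('k, 'a, 'n) graded_algebra_scheme \<Rightarrow> nat \<Rightarrow> int \<Rightarrow> ('a list \<Rightarrow> 'a) \<Rightarrow> 'a list \<Rightarrow> 'a" where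
  "d_Hoch B p q f = (\<lambda>as\<in>tuples B (p + 1).
     (twist B q (hd as) \<otimes>\<^bsub>B\<^esub> f (tl as))
     \<oplus>\<^bsub>B\<^esub> (\<Oplus>\<^bsub>B\<^esub>i\<in>{1..p}. [neg1_pow (int i)] \<cdot>\<^bsub>B\<^esub>
            f (take (i - 1) as @ [as ! (i - 1) \<otimes>\<^bsub>B\<^esub> as ! i] @ drop (i + 1) as))
     \<oplus>\<^bsub>B\<^esub> [neg1_pow (int p + 1)] \<cdot>\<^bsub>B\<^esub> (f (butlast as) \<otimes>\<^bsub>B\<^esub> last as))"

text \<open>A shuffle \<open>\<sigma>\<close> moves the argument in position \<open>j\<close> to position \<open>\<sigma> j\<close> (positions are 0-based),
  keeping the order within the first \<open>i\<close> and within the last \<open>p - i\<close> arguments.\<close>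

definition shuffle_perms :: "nat \<Rightarrow> nat \<Rightarrow> (nat \<Rightarrow> nat) set" where
  "shuffle_perms i p =
     {\<sigma>. \<sigma> permutes {..<p} \<and> strict_mono_on {..<i} \<sigma> \<and> strict_mono_on {i..<p} \<sigma>}"

definition koszul_sign :: "int list \<Rightarrow> (nat \<Rightarrow> nat) \<Rightarrow> int" where
  "koszul_sign ks \<sigma> =
     (\<Prod>(j, k)\<in>{(j, k). j < k \<and> k < length ks \<and> \<sigma> k < \<sigma> j}. neg1_pow (ks ! j * ks ! k))"

definition CHarr ::
    "('k, 'm) ring_scheme \<Rightarrow> ('k, 'a, 'n) graded_algebra_scheme \<Rightarrow> nat \<Rightarrow> int \<Rightarrow>
     ('a list \<Rightarrow> 'a) set" where
  "CHarr K B p q =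
     {f \<in> CHoch K B p q.
        \<forall>i. 0 < i \<and> i < p \<longrightarrow>
          (\<forall>as\<in>tuples B p. \<forall>ks. homog_tuple B ks as \<longrightarrow>
             (\<Oplus>\<^bsub>B\<^esub>\<sigma>\<in>shuffle_perms i p.
                [(sign \<sigma> * koszul_sign ks \<sigma>)] \<cdot>\<^bsub>B\<^esub> f (permute_list (inv_into UNIV \<sigma>) as)) = \<zero>\<^bsub>B\<^esub>)}"

definition zero_cochain :: "('k, 'a, 'n) graded_algebra_scheme \<Rightarrow> nat \<Rightarrow> 'a list \<Rightarrow> 'a" where
  "zero_cochain B p = (\<lambda>as\<in>tuples B p. \<zero>\<^bsub>B\<^esub>)"

definition ZHarr ::
    "('k, 'm) ring_scheme \<Rightarrow> ('k, 'a, 'n) graded_algebra_scheme \<Rightarrow> nat \<Rightarrow> int \<Rightarrow>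
     ('a list \<Rightarrow> 'a) set" where
  "ZHarr K B p q = {f \<in> CHarr K B p q. d_Hoch B p q f = zero_cochain B (p + 1)}"

definition BHarr ::
    "('k, 'm) ring_scheme \<Rightarrow> ('k, 'a, 'n) graded_algebra_scheme \<Rightarrow> nat \<Rightarrow> int \<Rightarrow>
     ('a list \<Rightarrow> 'a) set" where
  "BHarr K B p q =
     (if p = 0 then {zero_cochain B 0} else d_Hoch B (p - 1) q ` CHarr K B (p - 1) q)"

definition ZHarr_group ::
    "('k, 'm) ring_scheme \<Rightarrow> ('k, 'a, 'n) graded_algebra_scheme \<Rightarrow> nat \<Rightarrow> int \<Rightarrow>
     ('a list \<Rightarrow> 'a) monoid" where
  "ZHarr_group K B p q =
     \<lparr>carrier = ZHarr K B p q,
      monoid.mult = (\<lambda>f g. \<lambda>as\<in>tuples B p. f as \<oplus>\<^bsub>B\<^esub> g as),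
      one = zero_cochain B p\<rparr>"

text \<open>Only the additive group underlying Harrison cohomology is recorded; the group operation is
  the addition of cochains although it is written multiplicatively.\<close>

definition HHarr ::
    "('k, 'm) ring_scheme \<Rightarrow> ('k, 'a, 'n) graded_algebra_scheme \<Rightarrow> nat \<Rightarrow> int \<Rightarrow>
     ('a list \<Rightarrow> 'a) set monoid" where
  "HHarr K B p q = ZHarr_group K B p q Mod BHarr K B p q"

definition harr_class ::
    "('k, 'm) ring_scheme \<Rightarrow> ('k, 'a, 'n) graded_algebra_scheme \<Rightarrow> nat \<Rightarrow> int \<Rightarrow>
     ('a list \<Rightarrow> 'a) \<Rightarrow> ('a list \<Rightarrow> 'a) set" where
  "harr_class K B p q f = BHarr K B p q #>\<^bsub>ZHarr_group K B p q\<^esub> f"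


section \<open>The ternary operation of a Hodge homotopy\<close>

text \<open>The sign \<open>(-1)\<^bsup>deg a\<^esup>\<close> is extended linearly to inhomogeneous \<open>a\<close> by applying \<^const>\<open>twist\<close>
  in cohomology.\<close>

definition mu3 ::
    "('k, 'a, 'n) graded_algebra_scheme \<Rightarrow> ('a \<Rightarrow> 'a) \<Rightarrow> ('a \<Rightarrow> 'a) \<Rightarrow> 'a set list \<Rightarrow> 'a set" where
  "mu3 A d dm = (\<lambda>as\<in>tuples (cohomology A d) 3.
     let \<iota> = harm_rep A d dm; a = as ! 0; b = as ! 1; c = as ! 2 in
     cohom_class A d (harm_proj A d dm
       ((dm (\<iota> a \<otimes>\<^bsub>A\<^esub> \<iota> b) \<otimes>\<^bsub>A\<^esub> \<iota> c)
        \<ominus>\<^bsub>A\<^esub> (\<iota> (twist (cohomology A d) 1 a) \<otimes>\<^bsub>A\<^esub> dm (\<iota> b \<otimes>\<^bsub>A\<^esub> \<iota> c)))))"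

end

theory Submission
  imports Defs
begin

text \<open>The harmonic section \<open>\<iota>\<close> is multiplicative up to the homotopy \<open>G X Y = h (\<iota> X \<otimes> \<iota> Y)\<close>, that is,
  \<open>d (G X Y) = \<iota> X \<otimes> \<iota> Y - \<iota> (X \<otimes> Y)\<close>, and modulo coboundaries the harmonic projection disappears from
  the triple product:
  \<open>\<mu>\<^sub>3 X Y Z = [G X Y \<otimes> \<iota> Z - (-1)\<^sup>|\<^sup>X\<^sup>| \<iota> X \<otimes> G Y Z - G X (Y \<otimes> Z) + G (X \<otimes> Y) Z]\<close>.
  For any such pair \<open>(\<iota>, G)\<close> this expression is a Hochschild cocycle: its Hochschild differential is the
  class of the exact element \<open>\<plusminus> d (G X Y \<otimes> G Z W)\<close>. Given a second homotopy \<open>h'\<close>, put \<open>t X = h' (\<iota> X)\<close>, so that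
  \<open>\<iota>' = \<iota> - d t\<close>. The pair \<open>(\<iota>, G)\<close> can be transported along \<open>t\<close> to a pair \<open>(\<iota>', G\<^sub>1)\<close> with the same triple
  product, and replacing \<open>G\<^sub>1\<close> by \<open>G'\<close> changes the triple product by the Hochschild coboundary of
  \<open>f = [G' - G\<^sub>1]\<close>. The cochain \<open>f\<close> is graded symmetric because the antisymmetric part of \<open>G' - G\<^sub>1\<close> is
  \<open>\<plusminus> d (t X \<otimes> t Y)\<close>.\<close>

section \<open>Graded algebras and signs\<close>

text \<open>Passing from one homotopy to another changes two things at once: the harmonic section
  and the primitives attached to its products. The intermediate pair separates the two changes. Its
  second member is asymmetric in its arguments and need not be \<open>h\<close> applied to a product
  for any contraction \<open>h\<close>, so the argument is run for arbitrary pairs and not for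
  contractions only. The Harrison condition on \<open>f\<close> is delicate for the same reason:
  graded symmetry may fail for the underlying cochains and holds for their classes. The other
  obstacle is signs. Written through the parity operator \<open>twist\<close>, every formula extends
  to inhomogeneous elements. Once section values at twisted arguments are treated as letters of
  their own, the key identities become sign-free identities in an arbitrary ring. Degrees return
  only where they are unavoidable, in the shuffle relations.\<close>

lemma neg1_pow_uminus [simp]: "neg1_pow (- m) = neg1_pow m"
  by (simp add: neg1_pow_def)

section \<open>Linear and additive maps\<close>

lemma linear_onI:
  assumes "\<And>x. x \<in> S \<Longrightarrow> f x \<in> carrier W"
    and "\<And>x y. \<lbrakk>x \<in> S; y \<in> S\<rbrakk> \<Longrightarrow> f (x \<oplus>\<^bsub>V\<^esub> y) = f x \<oplus>\<^bsub>W\<^esub> f y"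
    and "\<And>r x. \<lbrakk>r \<in> carrier K; x \<in> S\<rbrakk> \<Longrightarrow> f (r \<odot>\<^bsub>V\<^esub> x) = r \<odot>\<^bsub>W\<^esub> f x"
  shows "linear_on K V S W f"
  using assms by (auto simp: linear_on_def)

lemma linear_onD:
  assumes "linear_on K V S W f"
  shows "x \<in> S \<Longrightarrow> f x \<in> carrier W"
    and "\<lbrakk>x \<in> S; y \<in> S\<rbrakk> \<Longrightarrow> f (x \<oplus>\<^bsub>V\<^esub> y) = f x \<oplus>\<^bsub>W\<^esub> f y"
    and "\<lbrakk>r \<in> carrier K; x \<in> S\<rbrakk> \<Longrightarrow> f (r \<odot>\<^bsub>V\<^esub> x) = r \<odot>\<^bsub>W\<^esub> f x"
  using assms by (auto simp: linear_on_def)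

lemma linear_on_cong:
  assumes "linear_on K V (carrier V) W f" "\<And>x. x \<in> carrier V \<Longrightarrow> f x = g x" "module K V"
  shows "linear_on K V (carrier V) W g"
proof -
  interpret module K V by fact
  show ?thesis
    using assms(1) by (auto simp: linear_on_def assms(2) Pi_iff)
qed

lemma linear_on_compose:
  assumes "linear_on K V S W f" "linear_on K W S' U g" "\<And>x. x \<in> S \<Longrightarrow> f x \<in> S'"
  shows "linear_on K V S U (\<lambda>x. g (f x))"
  using assms by (auto simp: linear_on_def Pi_iff)

lemma additive_zero:
  assumes "abelian_group V" "abelian_group W" "f \<in> carrier V \<rightarrow> carrier W"
    and "\<And>x y. \<lbrakk>x \<in> carrier V; y \<in> carrier V\<rbrakk> \<Longrightarrow> f (x \<oplus>\<^bsub>V\<^esub> y) = f x \<oplus>\<^bsub>W\<^esub> f y"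
  shows "f \<zero>\<^bsub>V\<^esub> = \<zero>\<^bsub>W\<^esub>"
proof -
  interpret V: abelian_group V by fact
  interpret W: abelian_group W by fact
  have "f \<zero>\<^bsub>V\<^esub> \<oplus>\<^bsub>W\<^esub> f \<zero>\<^bsub>V\<^esub> = f \<zero>\<^bsub>V\<^esub>"
    using assms(4)[of "\<zero>\<^bsub>V\<^esub>" "\<zero>\<^bsub>V\<^esub>"] by simp
  then show ?thesis
    using assms(3) by (metis V.zero_closed W.add.l_cancel_one Pi_mem)
qed

lemma additive_minus:
  assumes "abelian_group V" "abelian_group W" "f \<in> carrier V \<rightarrow> carrier W"
    and "\<And>x y. \<lbrakk>x \<in> carrier V; y \<in> carrier V\<rbrakk> \<Longrightarrow> f (x \<oplus>\<^bsub>V\<^esub> y) = f x \<oplus>\<^bsub>W\<^esub> f y"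
    and "x \<in> carrier V"
  shows "f (\<ominus>\<^bsub>V\<^esub> x) = \<ominus>\<^bsub>W\<^esub> f x"
proof -
  interpret V: abelian_group V by fact
  interpret W: abelian_group W by fact
  have "f (\<ominus>\<^bsub>V\<^esub> x) \<oplus>\<^bsub>W\<^esub> f x = \<zero>\<^bsub>W\<^esub>"
    using assms(4)[of "\<ominus>\<^bsub>V\<^esub> x" x] additive_zero[OF assms(1-4)] assms(5) by (simp add: V.l_neg)
  then show ?thesis
    using assms(3,5) by (metis V.a_inv_closed W.minus_equality Pi_mem)
qed

lemma linear_on_additive:
  assumes "linear_on K V (carrier V) W f" "abelian_group V" "abelian_group W"
  shows "f \<zero>\<^bsub>V\<^esub> = \<zero>\<^bsub>W\<^esub>"
    and "x \<in> carrier V \<Longrightarrow> f (\<ominus>\<^bsub>V\<^esub> x) = \<ominus>\<^bsub>W\<^esub> f x"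
    and "\<lbrakk>x \<in> carrier V; y \<in> carrier V\<rbrakk> \<Longrightarrow> f (x \<ominus>\<^bsub>V\<^esub> y) = f x \<ominus>\<^bsub>W\<^esub> f y"
proof -
  note f = linear_onD[OF assms(1)]
  show "f \<zero>\<^bsub>V\<^esub> = \<zero>\<^bsub>W\<^esub>"
    using assms(2,3) f by (intro additive_zero) auto
  show 1: "f (\<ominus>\<^bsub>V\<^esub> x) = \<ominus>\<^bsub>W\<^esub> f x" if "x \<in> carrier V" for x
    using assms(2,3) f that by (intro additive_minus) auto
  show "f (x \<ominus>\<^bsub>V\<^esub> y) = f x \<ominus>\<^bsub>W\<^esub> f y" if "x \<in> carrier V" "y \<in> carrier V"
    using that f 1 abelian_group.a_inv_closed[OF assms(2)] by (simp add: a_minus_def)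
qed

section \<open>Normal forms for signs and differences\<close>

context abelian_group begin

lemma add_pow_neg1_pow:
  assumes "x \<in> carrier G"
  shows "[neg1_pow m] \<cdot> x = (if even m then x else \<ominus> x)"
  using assms by (simp add: neg1_pow_def add_pow_int_ge add_pow_int_lt)

lemma diff_diff:
  assumes "a \<in> carrier G" "b \<in> carrier G" "c \<in> carrier G"
  shows "a \<oplus> (b \<ominus> c) = (a \<oplus> b) \<ominus> c" and "(a \<ominus> b) \<oplus> c = (a \<oplus> c) \<ominus> b"
    and "a \<ominus> (b \<ominus> c) = (a \<oplus> c) \<ominus> b" and "(a \<ominus> b) \<ominus> c = a \<ominus> (b \<oplus> c)"
  using assms by (simp_all add: a_minus_def minus_add a_ac)

lemma diff_uminus:
  assumes "a \<in> carrier G" "b \<in> carrier G"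
  shows "\<ominus> (a \<ominus> b) = b \<ominus> a" and "a \<ominus> (\<ominus> b) = a \<oplus> b" and "a \<oplus> (\<ominus> b) = a \<ominus> b"
    and "(\<ominus> a) \<oplus> b = b \<ominus> a" and "(\<ominus> a) \<ominus> b = \<ominus> (a \<oplus> b)"
  using assms by (simp_all add: a_minus_def minus_add a_ac)

lemma diff_eq_iff:
  assumes "a \<in> carrier G" "b \<in> carrier G" "c \<in> carrier G"
  shows "a \<ominus> b = c \<longleftrightarrow> a = b \<oplus> c" and "c = a \<ominus> b \<longleftrightarrow> b \<oplus> c = a"
proof -
  show "a \<ominus> b = c \<longleftrightarrow> a = b \<oplus> c"
    using assms by (metis add.inv_solve_right' a_minus_def a_comm)
  then show "c = a \<ominus> b \<longleftrightarrow> b \<oplus> c = a" by metis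
qed

lemma uminus_eq_iff:
  assumes "a \<in> carrier G" "c \<in> carrier G"
  shows "\<ominus> a = c \<longleftrightarrow> a \<oplus> c = \<zero>" and "c = \<ominus> a \<longleftrightarrow> a \<oplus> c = \<zero>"
proof -
  show "\<ominus> a = c \<longleftrightarrow> a \<oplus> c = \<zero>"
    using assms by (metis a_comm minus_equality r_neg)
  then show "c = \<ominus> a \<longleftrightarrow> a \<oplus> c = \<zero>" by metis
qed

end

context ring begin

lemma diff_distr:
  assumes "a \<in> carrier R" "b \<in> carrier R" "c \<in> carrier R"
  shows "a \<otimes> (b \<ominus> c) = a \<otimes> b \<ominus> a \<otimes> c" and "(a \<ominus> b) \<otimes> c = a \<otimes> c \<ominus> b \<otimes> c"
  using assms by (simp_all add: a_minus_def l_distr r_distr l_minus r_minus)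

text \<open>Subtractions are moved outwards and then across the equality sign, so that both sides become
  sums of monomials and no cancellation is ever needed.\<close>

lemmas ring_normalize = diff_diff diff_uminus diff_distr diff_eq_iff uminus_eq_iff l_distr r_distr l_minus r_minus minus_minus
  m_assoc a_ac

end

section \<open>Homogeneous elements and components\<close>

context graded_comm_algebra begin

lemma homog_closed: "x \<in> homog B k \<Longrightarrow> x \<in> carrier B"
  using submoduleE(1)[OF homog_submodule] by blast

lemma homog_zero: "\<zero>\<^bsub>B\<^esub> \<in> homog B k"
  using submodule.axioms(1)[OF homog_submodule] subgroup.one_closed by fastforce

lemma homog_add: "\<lbrakk>x \<in> homog B k; y \<in> homog B k\<rbrakk> \<Longrightarrow> x \<oplus>\<^bsub>B\<^esub> y \<in> homog B k"
  by (rule submoduleE(5)[OF homog_submodule])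

lemma homog_uminus: "x \<in> homog B k \<Longrightarrow> \<ominus>\<^bsub>B\<^esub> x \<in> homog B k"
  by (rule submoduleE(3)[OF homog_submodule])

lemma homog_diff: "\<lbrakk>x \<in> homog B k; y \<in> homog B k\<rbrakk> \<Longrightarrow> x \<ominus>\<^bsub>B\<^esub> y \<in> homog B k"
  by (simp add: a_minus_def homog_add homog_uminus)

lemma homog_smult: "\<lbrakk>r \<in> carrier K; x \<in> homog B k\<rbrakk> \<Longrightarrow> r \<odot>\<^bsub>B\<^esub> x \<in> homog B k"
  by (rule submoduleE(4)[OF homog_submodule])

lemma homog_sign: "x \<in> homog B k \<Longrightarrow> [neg1_pow m] \<cdot>\<^bsub>B\<^esub> x \<in> homog B k"
  by (simp add: M.add_pow_neg1_pow homog_closed homog_uminus)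

text \<open>Enlarging the support to a finite superset adds only zero terms. The index set is left
  free because the exact support is awkward to know, for instance for the sum of two
  elements.\<close>

lemma is_decompositionI:
  assumes "\<And>k. c k \<in> homog B k" "finite S" "\<And>k. k \<notin> S \<Longrightarrow> c k = \<zero>\<^bsub>B\<^esub>"
    and "x = (\<Oplus>\<^bsub>B\<^esub>k\<in>S. c k)"
  shows "is_decomposition B x c"
proof -
  have *: "{k. c k \<noteq> \<zero>\<^bsub>B\<^esub>} \<subseteq> S" using assms(3) by auto
  have "(\<Oplus>\<^bsub>B\<^esub>k\<in>{k. c k \<noteq> \<zero>\<^bsub>B\<^esub>}. c k) = (\<Oplus>\<^bsub>B\<^esub>k\<in>S. c k)"
    using assms * by (intro M.add.finprod_mono_neutral_cong_left) (auto intro: homog_closed)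
  then show ?thesis
    using assms finite_subset[OF *] by (simp add: is_decomposition_def)
qed

lemma homog_part_decomposition:
  "x \<in> carrier B \<Longrightarrow> is_decomposition B x (\<lambda>k. homog_part B k x)"
  using theI'[OF direct_sum] by (simp add: homog_part_def)

lemma homog_part_eqI:
  assumes "x \<in> carrier B" "is_decomposition B x c"
  shows "homog_part B k x = c k"
proof -
  have "(THE c. is_decomposition B x c) = c"
    by (rule the1_equality) (use direct_sum[OF assms(1)] assms(2) in simp_all)
  then show ?thesis by (simp add: homog_part_def)
qed

lemma homog_part_homog: "x \<in> carrier B \<Longrightarrow> homog_part B k x \<in> homog B k"
  using homog_part_decomposition by (simp add: is_decomposition_def)

lemma homog_part_closed: "x \<in> carrier B \<Longrightarrow> homog_part B k x \<in> carrier B"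
  using homog_part_homog homog_closed by blast

lemma finite_homog_parts: "x \<in> carrier B \<Longrightarrow> finite {k. homog_part B k x \<noteq> \<zero>\<^bsub>B\<^esub>}"
  using homog_part_decomposition by (simp add: is_decomposition_def)

lemma finsum_homog_part:
  assumes "x \<in> carrier B" "finite S" "\<And>k. k \<notin> S \<Longrightarrow> homog_part B k x = \<zero>\<^bsub>B\<^esub>"
  shows "(\<Oplus>\<^bsub>B\<^esub>k\<in>S. homog_part B k x) = x"
proof -
  have "(\<Oplus>\<^bsub>B\<^esub>k\<in>{k. homog_part B k x \<noteq> \<zero>\<^bsub>B\<^esub>}. homog_part B k x) = (\<Oplus>\<^bsub>B\<^esub>k\<in>S. homog_part B k x)"
    using assms by (intro M.add.finprod_mono_neutral_cong_left) (auto intro: homog_part_closed)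
  then show ?thesis
    using homog_part_decomposition[OF assms(1)] by (simp add: is_decomposition_def)
qed

text \<open>Every element is the finite sum of its components, so a property closed under addition
  need only be checked on homogeneous elements. This is how the sign rules below pass to
  inhomogeneous arguments.\<close>

lemma homog_induct [consumes 1, case_names homog add]:
  assumes "x \<in> carrier B"
    and homog: "\<And>k x. x \<in> homog B k \<Longrightarrow> P x"
    and add: "\<And>x y. \<lbrakk>x \<in> carrier B; y \<in> carrier B; P x; P y\<rbrakk> \<Longrightarrow> P (x \<oplus>\<^bsub>B\<^esub> y)"
  shows "P x"
proof -
  have "P (\<Oplus>\<^bsub>B\<^esub>k\<in>S. homog_part B k x)" if "finite S" for S
    using that
  proof (induction S)
    case empty
    show ?case using homog[OF homog_zero] by simp
  next
    case (insert k S)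
    then show ?case
      using homog_part_closed[OF assms(1)]
      by (auto simp: Pi_iff intro!: add homog[OF homog_part_homog[OF assms(1)]] M.finsum_closed)
  qed
  from this[OF finite_homog_parts[OF assms(1)]] show ?thesis
    by (subst (asm) finsum_homog_part) (simp_all add: finite_homog_parts assms(1))
qed

lemma homog_part_of_homog:
  assumes "x \<in> homog B j"
  shows "homog_part B k x = (if k = j then x else \<zero>\<^bsub>B\<^esub>)"
  using assms
  by (intro homog_part_eqI is_decompositionI[where S = "{j}"])
     (auto simp: homog_closed homog_zero)

lemma homog_part_add:
  assumes "x \<in> carrier B" "y \<in> carrier B"
  shows "homog_part B k (x \<oplus>\<^bsub>B\<^esub> y) = homog_part B k x \<oplus>\<^bsub>B\<^esub> homog_part B k y"
proof (intro homog_part_eqI is_decompositionI)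
  let ?S = "{k. homog_part B k x \<noteq> \<zero>\<^bsub>B\<^esub>} \<union> {k. homog_part B k y \<noteq> \<zero>\<^bsub>B\<^esub>}"
  show S: "finite ?S" using assms by (simp add: finite_homog_parts)
  have "x \<oplus>\<^bsub>B\<^esub> y = (\<Oplus>\<^bsub>B\<^esub>k\<in>?S. homog_part B k x) \<oplus>\<^bsub>B\<^esub> (\<Oplus>\<^bsub>B\<^esub>k\<in>?S. homog_part B k y)"
    using assms S by (subst (1 2) finsum_homog_part) auto
  also have "\<dots> = (\<Oplus>\<^bsub>B\<^esub>k\<in>?S. homog_part B k x \<oplus>\<^bsub>B\<^esub> homog_part B k y)"
    using assms by (intro M.finsum_addf[symmetric]) (auto simp: homog_part_closed)
  finally show "x \<oplus>\<^bsub>B\<^esub> y = (\<Oplus>\<^bsub>B\<^esub>k\<in>?S. homog_part B k x \<oplus>\<^bsub>B\<^esub> homog_part B k y)" .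
qed (use assms in \<open>auto simp: homog_add homog_part_homog\<close>)

text \<open>Both sides are additive in \<open>x\<close>, which reduces the claim to homogeneous
  \<open>x\<close>. With \<open>f = d\<close> it makes cocycles and coboundaries graded
  subspaces.\<close>

lemma homog_part_graded_map:
  assumes f: "f \<in> carrier B \<rightarrow> carrier B"
    "\<And>x y. \<lbrakk>x \<in> carrier B; y \<in> carrier B\<rbrakk> \<Longrightarrow> f (x \<oplus>\<^bsub>B\<^esub> y) = f x \<oplus>\<^bsub>B\<^esub> f y"
    and deg: "\<And>k x. x \<in> homog B k \<Longrightarrow> f x \<in> homog B (k + j)"
    and "x \<in> carrier B"
  shows "homog_part B (k + j) (f x) = f (homog_part B k x)"
  using \<open>x \<in> carrier B\<close>
proof (induction x rule: homog_induct)
  case (homog i x)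
  have "f \<zero>\<^bsub>B\<^esub> = \<zero>\<^bsub>B\<^esub>"
    using additive_zero[of B B f] M.abelian_group_axioms f by blast
  then show ?case
    using homog deg[OF homog] by (simp add: homog_part_of_homog)
next
  case (add x y)
  then show ?case using f by (simp add: homog_part_add homog_part_closed Pi_iff)
qed

section \<open>The parity operator\<close>

lemma twist_eq_finsum:
  assumes "x \<in> carrier B" "finite S" "\<And>k. k \<notin> S \<Longrightarrow> homog_part B k x = \<zero>\<^bsub>B\<^esub>"
  shows "twist B q x = (\<Oplus>\<^bsub>B\<^esub>k\<in>S. [neg1_pow (q * k)] \<cdot>\<^bsub>B\<^esub> homog_part B k x)"
  unfolding twist_def using assms
  by (intro M.add.finprod_mono_neutral_cong_left)
     (auto simp: M.add_pow_neg1_pow homog_part_closed)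

lemma twist_of_homog:
  assumes "x \<in> homog B k"
  shows "twist B q x = [neg1_pow (q * k)] \<cdot>\<^bsub>B\<^esub> x"
  using assms homog_closed[OF assms]
  by (subst twist_eq_finsum[where S = "{k}"]) (auto simp: homog_part_of_homog M.add_pow_neg1_pow)

lemma twist_homog: "x \<in> homog B k \<Longrightarrow> twist B q x \<in> homog B k"
  by (simp add: twist_of_homog homog_sign)

lemma twist_closed [simp]: "x \<in> carrier B \<Longrightarrow> twist B q x \<in> carrier B"
  unfolding twist_def by (rule M.finsum_closed) (simp add: M.add_pow_neg1_pow homog_part_closed)

lemma twist_add:
  assumes "x \<in> carrier B" "y \<in> carrier B"
  shows "twist B q (x \<oplus>\<^bsub>B\<^esub> y) = twist B q x \<oplus>\<^bsub>B\<^esub> twist B q y"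
proof -
  let ?S = "{k. homog_part B k x \<noteq> \<zero>\<^bsub>B\<^esub>} \<union> {k. homog_part B k y \<noteq> \<zero>\<^bsub>B\<^esub>}"
  have S: "finite ?S" using assms by (simp add: finite_homog_parts)
  have "twist B q (x \<oplus>\<^bsub>B\<^esub> y)
      = (\<Oplus>\<^bsub>B\<^esub>k\<in>?S. [neg1_pow (q * k)] \<cdot>\<^bsub>B\<^esub> (homog_part B k x \<oplus>\<^bsub>B\<^esub> homog_part B k y))"
    using assms S by (subst twist_eq_finsum[where S = ?S]) (auto simp: homog_part_add)
  also have "\<dots> = (\<Oplus>\<^bsub>B\<^esub>k\<in>?S. ([neg1_pow (q * k)] \<cdot>\<^bsub>B\<^esub> homog_part B k x)
      \<oplus>\<^bsub>B\<^esub> ([neg1_pow (q * k)] \<cdot>\<^bsub>B\<^esub> homog_part B k y))"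
    using assms by (intro M.finsum_cong') (auto simp: M.add_pow_neg1_pow homog_part_closed M.minus_add)
  also have "\<dots> = (\<Oplus>\<^bsub>B\<^esub>k\<in>?S. [neg1_pow (q * k)] \<cdot>\<^bsub>B\<^esub> homog_part B k x)
      \<oplus>\<^bsub>B\<^esub> (\<Oplus>\<^bsub>B\<^esub>k\<in>?S. [neg1_pow (q * k)] \<cdot>\<^bsub>B\<^esub> homog_part B k y)"
    using assms by (intro M.finsum_addf) (auto simp: M.add_pow_neg1_pow homog_part_closed)
  also have "(\<Oplus>\<^bsub>B\<^esub>k\<in>?S. [neg1_pow (q * k)] \<cdot>\<^bsub>B\<^esub> homog_part B k x) = twist B q x"
    using assms S by (intro twist_eq_finsum[symmetric]) auto
  also have "(\<Oplus>\<^bsub>B\<^esub>k\<in>?S. [neg1_pow (q * k)] \<cdot>\<^bsub>B\<^esub> homog_part B k y) = twist B q y"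
    using assms S by (intro twist_eq_finsum[symmetric]) auto
  finally show ?thesis .
qed

lemma twist_smult:
  assumes "r \<in> carrier K" "x \<in> carrier B"
  shows "twist B q (r \<odot>\<^bsub>B\<^esub> x) = r \<odot>\<^bsub>B\<^esub> twist B q x"
  using assms(2)
proof (induction x rule: homog_induct)
  case (homog k x)
  then show ?case
    using assms(1)
    by (simp add: twist_of_homog[OF homog_smult] twist_of_homog M.add_pow_neg1_pow homog_closed smult_r_minus)
qed (simp_all add: assms(1) smult_r_distr twist_add)

lemma linear_on_twist: "linear_on K B (carrier B) B (twist B q)"
  by (intro linear_onI) (simp_all add: twist_add twist_smult)

lemmas twist_additive = linear_on_additive[OF linear_on_twist M.abelian_group_axioms M.abelian_group_axioms]

text \<open>The sign (-1)^(q k) turns sums of degrees k into products of signs, so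
  \<open>twist\<close> is an algebra endomorphism.\<close>

lemma twist_mult:
  assumes "x \<in> carrier B" "y \<in> carrier B"
  shows "twist B q (x \<otimes>\<^bsub>B\<^esub> y) = twist B q x \<otimes>\<^bsub>B\<^esub> twist B q y"
  using assms(1)
proof (induction x rule: homog_induct)
  case (homog i x)
  note x = homog
  show ?case
    using assms(2)
  proof (induction y rule: homog_induct)
    case (homog j y)
    have "x \<in> carrier B" "y \<in> carrier B" using x homog by (auto intro: homog_closed)
    then show ?case
      using x homog
      by (simp add: twist_of_homog[OF mult_homog] twist_of_homog M.add_pow_neg1_pow l_minus r_minus
          distrib_left)
  next
    case (add y z)
    then show ?case using homog_closed[OF x] by (simp add: r_distr twist_add)
  qed
next
  case (add x z)
  then show ?case using assms(2) by (simp add: l_distr twist_add)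
qed

lemma twist_twist:
  assumes "x \<in> carrier B"
  shows "twist B q (twist B q x) = x"
  using assms
proof (induction x rule: homog_induct)
  case (homog k x)
  then show ?case
    by (simp add: twist_of_homog[OF homog_uminus] twist_of_homog M.add_pow_neg1_pow homog_closed)
qed (simp add: twist_add)

lemma twist_uminus_exponent: "twist B (- q) x = twist B q x"
  by (simp add: twist_def)

text \<open>Shifting the degree by an odd number flips the parity sign. The lemma is applied to the
  differential (\<open>j = 1\<close>) and to the homotopy (\<open>j = -1\<close>).\<close>

lemma graded_map_twist_odd:
  assumes f: "linear_on K B (carrier B) B f"
    and deg: "\<And>k x. x \<in> homog B k \<Longrightarrow> f x \<in> homog B (k + j)" and "odd j"
    and "x \<in> carrier B"
  shows "f (twist B 1 x) = \<ominus>\<^bsub>B\<^esub> twist B 1 (f x)"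
  using \<open>x \<in> carrier B\<close>
proof (induction x rule: homog_induct)
  case (homog k x)
  note f' = linear_on_additive[OF f M.abelian_group_axioms M.abelian_group_axioms]
  show ?case
    using homog deg[OF homog] homog_closed[OF homog] homog_closed[OF deg[OF homog]] \<open>odd j\<close>
    by (simp add: twist_of_homog M.add_pow_neg1_pow f')
next
  case (add x y)
  then show ?case by (simp add: twist_add linear_onD[OF f] M.minus_add)
qed

end

section \<open>The cohomology algebra\<close>

context dgca begin

lemmas d_closed [simp] = linear_onD(1)[OF d_linear]
  and d_add = linear_onD(2)[OF d_linear]
  and d_smult = linear_onD(3)[OF d_linear]

lemmas d_additive = linear_on_additive[OF d_linear M.abelian_group_axioms M.abelian_group_axioms]

lemma d_twist: "x \<in> carrier A \<Longrightarrow> d (twist A 1 x) = \<ominus>\<^bsub>A\<^esub> twist A 1 (d x)"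
  by (rule graded_map_twist_odd[OF d_linear, where j = 1]) (simp_all add: d_homog)

text \<open>The parity operator absorbs the sign (-1)^deg x, so the rule makes sense for every
  \<open>x\<close>. Most later computations with \<open>d\<close> use this form.\<close>

lemma leibniz_twist:
  assumes "x \<in> carrier A" "y \<in> carrier A"
  shows "d (x \<otimes>\<^bsub>A\<^esub> y) = d x \<otimes>\<^bsub>A\<^esub> y \<oplus>\<^bsub>A\<^esub> twist A 1 x \<otimes>\<^bsub>A\<^esub> d y"
  using assms(1)
proof (induction x rule: homog_induct)
  case (homog k x)
  then show ?case
    using assms(2) homog_closed[OF homog]
    by (simp add: leibniz twist_of_homog M.add_pow_neg1_pow l_minus)
next
  case (add x z)
  then show ?case
    using assms(2) by (simp add: l_distr twist_add d_add M.a_ac)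
qed

section \<open>Cocycles and coboundaries\<close>

lemma cocycles_closed: "x \<in> cocycles A d \<Longrightarrow> x \<in> carrier A"
  by (simp add: cocycles_def)

lemma d_cocycle: "x \<in> cocycles A d \<Longrightarrow> d x = \<zero>\<^bsub>A\<^esub>"
  by (simp add: cocycles_def)

lemma cocycles_zero: "\<zero>\<^bsub>A\<^esub> \<in> cocycles A d"
  and cocycles_add: "\<lbrakk>x \<in> cocycles A d; y \<in> cocycles A d\<rbrakk> \<Longrightarrow> x \<oplus>\<^bsub>A\<^esub> y \<in> cocycles A d"
  and cocycles_uminus: "x \<in> cocycles A d \<Longrightarrow> \<ominus>\<^bsub>A\<^esub> x \<in> cocycles A d"
  and cocycles_diff: "\<lbrakk>x \<in> cocycles A d; y \<in> cocycles A d\<rbrakk> \<Longrightarrow> x \<ominus>\<^bsub>A\<^esub> y \<in> cocycles A d"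
  and cocycles_smult: "\<lbrakk>r \<in> carrier K; x \<in> cocycles A d\<rbrakk> \<Longrightarrow> r \<odot>\<^bsub>A\<^esub> x \<in> cocycles A d"
  and cocycles_mult: "\<lbrakk>x \<in> cocycles A d; y \<in> cocycles A d\<rbrakk> \<Longrightarrow> x \<otimes>\<^bsub>A\<^esub> y \<in> cocycles A d"
  and cocycles_d: "x \<in> carrier A \<Longrightarrow> d x \<in> cocycles A d"
  and cocycles_twist: "x \<in> cocycles A d \<Longrightarrow> twist A 1 x \<in> cocycles A d"
  by (simp_all add: cocycles_def d_additive d_add d_smult d_squared leibniz_twist d_twist
      twist_additive M.minus_eq)

lemma cocycles_one: "\<one>\<^bsub>A\<^esub> \<in> cocycles A d"
proof -
  \<comment> \<open>Leibniz rule for 1 = 1 * 1; the unit has degree 0, so the sign is +.\<close>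
  have "d \<one>\<^bsub>A\<^esub> = d \<one>\<^bsub>A\<^esub> \<oplus>\<^bsub>A\<^esub> d \<one>\<^bsub>A\<^esub>"
    using leibniz_twist[of "\<one>\<^bsub>A\<^esub>" "\<one>\<^bsub>A\<^esub>"] twist_of_homog[OF one_homog, of 1]
    by (simp add: M.add_pow_neg1_pow)
  then show ?thesis by (simp add: cocycles_def)
qed

lemma coboundaries_abelian_subgroup: "abelian_subgroup (coboundaries A d) A"
proof (intro abelian_subgroupI3 additive_subgroup.intro M.abelian_group_axioms subgroup.intro)
  show "coboundaries A d \<subseteq> carrier (add_monoid A)"
    by (auto simp: coboundaries_def)
  show "x \<otimes>\<^bsub>add_monoid A\<^esub> y \<in> coboundaries A d"
    if "x \<in> coboundaries A d" "y \<in> coboundaries A d" for x y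
    using that by (auto simp: coboundaries_def d_add[symmetric] intro!: imageI)
  show "\<one>\<^bsub>add_monoid A\<^esub> \<in> coboundaries A d"
    using d_additive(1) by (auto simp: coboundaries_def intro!: image_eqI[of _ _ "\<zero>\<^bsub>A\<^esub>"])
  show "inv\<^bsub>add_monoid A\<^esub> x \<in> coboundaries A d" if "x \<in> coboundaries A d" for x
    using that
    by (auto simp: coboundaries_def a_inv_def[symmetric] d_additive(2)[symmetric] intro!: imageI)
qed

interpretation cob: abelian_subgroup "coboundaries A d" A
  by (rule coboundaries_abelian_subgroup)

lemma coboundary: "x \<in> carrier A \<Longrightarrow> d x \<in> coboundaries A d"
  by (simp add: coboundaries_def)

text \<open>For closed \<open>x\<close> one has
  \<open>d (twist A 1 x \<otimes> w) = x \<otimes> d w\<close>, because twisting twice is the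
  identity. So coboundaries absorb multiplication by cocycles on both sides, which makes the product
  on cohomology well defined.\<close>

lemma coboundary_mult:
  assumes "x \<in> cocycles A d" "b \<in> coboundaries A d"
  shows "x \<otimes>\<^bsub>A\<^esub> b \<in> coboundaries A d" and "b \<otimes>\<^bsub>A\<^esub> x \<in> coboundaries A d"
proof -
  obtain w where w: "w \<in> carrier A" "b = d w" using assms(2) by (auto simp: coboundaries_def)
  have x: "x \<in> carrier A" "d x = \<zero>\<^bsub>A\<^esub>" using assms(1) by (simp_all add: cocycles_def)
  have "d (twist A 1 x \<otimes>\<^bsub>A\<^esub> w) = x \<otimes>\<^bsub>A\<^esub> b" "d (w \<otimes>\<^bsub>A\<^esub> x) = b \<otimes>\<^bsub>A\<^esub> x"
    using x w by (simp_all add: leibniz_twist d_twist twist_twist twist_additive)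
  then show "x \<otimes>\<^bsub>A\<^esub> b \<in> coboundaries A d" "b \<otimes>\<^bsub>A\<^esub> x \<in> coboundaries A d"
    using x w by (metis coboundary m_closed twist_closed)+
qed

lemma coboundary_smult:
  "\<lbrakk>r \<in> carrier K; b \<in> coboundaries A d\<rbrakk> \<Longrightarrow> r \<odot>\<^bsub>A\<^esub> b \<in> coboundaries A d"
  by (auto simp: coboundaries_def d_smult[symmetric])

lemma cohom_class_eq_iff:
  assumes "x \<in> carrier A" "y \<in> carrier A"
  shows "cohom_class A d x = cohom_class A d y \<longleftrightarrow> x \<ominus>\<^bsub>A\<^esub> y \<in> coboundaries A d"
proof -
  have "x \<ominus>\<^bsub>A\<^esub> y \<in> coboundaries A d \<longleftrightarrow> x \<in> cohom_class A d y"
    using cob.a_rcos_module_minus[OF ring_axioms assms(2,1)] by (simp add: cohom_class_def)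
  also have "\<dots> \<longleftrightarrow> cohom_class A d x = cohom_class A d y"
    unfolding cohom_class_def using assms cob.a_rcos_self cob.a_subgroup
    by (metis M.a_repr_independence)
  finally show ?thesis by simp
qed

text \<open>Equality of classes is certified by an explicit primitive \<open>w\<close>; later proofs
  name the primitive instead of arguing inside cosets.\<close>

lemma cohom_class_eqI:
  assumes "w \<in> carrier A" "y \<in> carrier A" "x = y \<oplus>\<^bsub>A\<^esub> d w"
  shows "cohom_class A d x = cohom_class A d y"
proof -
  have "x \<ominus>\<^bsub>A\<^esub> y = d w" using assms by (simp add: M.diff_eq_iff)
  then show ?thesis using assms by (simp add: cohom_class_eq_iff coboundary)
qed

lemma cohom_class_mem:
  assumes "x \<in> carrier A" "y \<in> cohom_class A d x"
  shows "y \<in> carrier A" and "cohom_class A d y = cohom_class A d x"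
proof -
  show y: "y \<in> carrier A"
    using assms cob.a_subset M.a_r_coset_subset_G unfolding cohom_class_def by blast
  show "cohom_class A d y = cohom_class A d x"
    using assms y cob.a_subgroup unfolding cohom_class_def by (metis M.a_repr_independence)
qed

lemma cohom_class_self: "x \<in> carrier A \<Longrightarrow> x \<in> cohom_class A d x"
  unfolding cohom_class_def by (rule cob.a_rcos_self)

section \<open>Cohomology as a quotient algebra\<close>

lemma cohom_class_Union:
  assumes "x \<in> carrier A" "\<And>y. y \<in> cohom_class A d x \<Longrightarrow> F y = F x"
  shows "(\<Union>y\<in>cohom_class A d x. F y) = F x"
  using assms cohom_class_self by blast

lemma carrier_cohomology: "carrier (cohomology A d) = cohom_class A d ` cocycles A d"
  by (auto simp: cohomology_def FactRing_def A_RCOSETS_def RCOSETS_def cohom_class_def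
      a_r_coset_def r_coset_def)

lemma cohom_class_closed [simp]:
  "x \<in> cocycles A d \<Longrightarrow> cohom_class A d x \<in> carrier (cohomology A d)"
  by (simp add: carrier_cohomology)

lemma cohomology_cases [consumes 1]:
  assumes "X \<in> carrier (cohomology A d)"
  obtains x where "x \<in> cocycles A d" "X = cohom_class A d x"
  using assms by (auto simp: carrier_cohomology)

lemma homog_cohomology:
  "homog (cohomology A d) k = cohom_class A d ` (cocycles A d \<inter> homog A k)"
  by (simp add: cohomology_def Let_def)

lemma cohomology_zero: "\<zero>\<^bsub>cohomology A d\<^esub> = cohom_class A d \<zero>\<^bsub>A\<^esub>"
  using cob.a_subset by (simp add: cohomology_def FactRing_def cohom_class_def)

lemma cohomology_one: "\<one>\<^bsub>cohomology A d\<^esub> = cohom_class A d \<one>\<^bsub>A\<^esub>"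
  by (simp add: cohomology_def FactRing_def cohom_class_def a_r_coset_def r_coset_def)

lemma cohom_class_add:
  assumes "x \<in> carrier A" "y \<in> carrier A"
  shows "cohom_class A d (x \<oplus>\<^bsub>A\<^esub> y) = cohom_class A d x \<oplus>\<^bsub>cohomology A d\<^esub> cohom_class A d y"
proof -
  have "cohom_class A d x \<oplus>\<^bsub>cohomology A d\<^esub> cohom_class A d y
      = cohom_class A d x <+>\<^bsub>A\<^esub> cohom_class A d y"
    by (simp add: cohomology_def FactRing_def set_add_def set_mult_def)
  then show ?thesis
    using cob.a_rcos_sum[OF assms] by (simp add: cohom_class_def)
qed

text \<open>The product in the quotient is a union over all pairs of representatives. The identity
  \<open>x' y' - x y = (x' - x) y' + x (y' - y)\<close> shows that every pair yields the same class,
  so the union collapses.\<close>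

lemma cohom_class_mult:
  assumes "x \<in> cocycles A d" "y \<in> cocycles A d"
  shows "cohom_class A d (x \<otimes>\<^bsub>A\<^esub> y) = cohom_class A d x \<otimes>\<^bsub>cohomology A d\<^esub> cohom_class A d y"
proof -
  have xy: "x \<in> carrier A" "y \<in> carrier A" using assms by (simp_all add: cocycles_closed)
  have *: "cohom_class A d (x' \<otimes>\<^bsub>A\<^esub> y') = cohom_class A d (x \<otimes>\<^bsub>A\<^esub> y)"
    if "x' \<in> cohom_class A d x" "y' \<in> cohom_class A d y" for x' y'
  proof -
    note x' = cohom_class_mem[OF xy(1) that(1)] and y' = cohom_class_mem[OF xy(2) that(2)]
    have b: "x' \<ominus>\<^bsub>A\<^esub> x \<in> coboundaries A d" "y' \<ominus>\<^bsub>A\<^esub> y \<in> coboundaries A d"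
      using x' y' xy by (simp_all add: cohom_class_eq_iff)
    \<comment> \<open>Every representative of a closed class is closed; this is what lets
      \<open>coboundary_mult\<close> be applied with \<open>y'\<close> as the closed factor.\<close>
    have "d y' = \<zero>\<^bsub>A\<^esub>"
    proof -
      obtain w where "w \<in> carrier A" "y' \<ominus>\<^bsub>A\<^esub> y = d w" using b(2) by (auto simp: coboundaries_def)
      then have "d (y' \<ominus>\<^bsub>A\<^esub> y) = \<zero>\<^bsub>A\<^esub>" by (simp add: d_squared)
      then show ?thesis
        using y'(1) xy d_cocycle[OF assms(2)] d_additive(3)[of y' y] by (simp add: M.diff_eq_iff)
    qed
    then have "y' \<in> cocycles A d" using y' by (simp add: cocycles_def)
    then have "(x' \<ominus>\<^bsub>A\<^esub> x) \<otimes>\<^bsub>A\<^esub> y' \<oplus>\<^bsub>A\<^esub> x \<otimes>\<^bsub>A\<^esub> (y' \<ominus>\<^bsub>A\<^esub> y) \<in> coboundaries A d"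
      using b assms(1) by (intro cob.a_closed coboundary_mult)
    also have "(x' \<ominus>\<^bsub>A\<^esub> x) \<otimes>\<^bsub>A\<^esub> y' \<oplus>\<^bsub>A\<^esub> x \<otimes>\<^bsub>A\<^esub> (y' \<ominus>\<^bsub>A\<^esub> y) = x' \<otimes>\<^bsub>A\<^esub> y' \<ominus>\<^bsub>A\<^esub> x \<otimes>\<^bsub>A\<^esub> y"
      using xy x'(1) y'(1) by (simp add: ring_normalize)
    finally show ?thesis
      using xy x' y' by (simp add: cohom_class_eq_iff)
  qed
  have "cohom_class A d x \<otimes>\<^bsub>cohomology A d\<^esub> cohom_class A d y
      = (\<Union>x'\<in>cohom_class A d x. \<Union>y'\<in>cohom_class A d y. cohom_class A d (x' \<otimes>\<^bsub>A\<^esub> y'))"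
    by (simp add: cohomology_def FactRing_def rcoset_mult_def cohom_class_def a_r_coset_def r_coset_def)
  also have "\<dots> = (\<Union>x'\<in>cohom_class A d x. \<Union>y'\<in>cohom_class A d y. cohom_class A d (x \<otimes>\<^bsub>A\<^esub> y))"
    using * by (intro SUP_cong) auto
  also have "\<dots> = cohom_class A d (x \<otimes>\<^bsub>A\<^esub> y)"
    using cohom_class_self xy by blast
  finally show ?thesis by simp
qed

text \<open>The scalar action is defined as a union of classes over all representatives; it
  collapses because scalar multiples of coboundaries are coboundaries.\<close>

lemma cohom_class_smult:
  assumes "r \<in> carrier K" "x \<in> carrier A"
  shows "cohom_class A d (r \<odot>\<^bsub>A\<^esub> x) = r \<odot>\<^bsub>cohomology A d\<^esub> cohom_class A d x"
proof -
  have "cohom_class A d (r \<odot>\<^bsub>A\<^esub> y) = cohom_class A d (r \<odot>\<^bsub>A\<^esub> x)" if "y \<in> cohom_class A d x" for y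
  proof -
    note y = cohom_class_mem[OF assms(2) that]
    have "r \<odot>\<^bsub>A\<^esub> (y \<ominus>\<^bsub>A\<^esub> x) \<in> coboundaries A d"
      using y assms by (intro coboundary_smult) (simp_all add: cohom_class_eq_iff)
    then show ?thesis
      using y assms by (simp add: cohom_class_eq_iff a_minus_def smult_r_distr smult_r_minus)
  qed
  then have "(\<Union>y\<in>cohom_class A d x. cohom_class A d (r \<odot>\<^bsub>A\<^esub> y)) = cohom_class A d (r \<odot>\<^bsub>A\<^esub> x)"
    by (rule cohom_class_Union[OF assms(2)])
  then show ?thesis by (simp add: cohomology_def Let_def)
qed

lemma ring_cohomology: "ring (cohomology A d)"
proof (rule ringI)
  show "abelian_group (cohomology A d)"
  proof (rule abelian_groupI)
    show "\<exists>y\<in>carrier (cohomology A d). y \<oplus>\<^bsub>cohomology A d\<^esub> X = \<zero>\<^bsub>cohomology A d\<^esub>"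
      if X: "X \<in> carrier (cohomology A d)" for X
      using X
    proof (cases rule: cohomology_cases)
      case (1 x)
      then have "cohom_class A d (\<ominus>\<^bsub>A\<^esub> x) \<oplus>\<^bsub>cohomology A d\<^esub> X = \<zero>\<^bsub>cohomology A d\<^esub>"
        by (simp add: cohom_class_add[symmetric] cocycles_closed cohomology_zero M.l_neg)
      then show ?thesis using 1 cocycles_uminus cohom_class_closed by blast
    qed
  qed (auto elim!: cohomology_cases
      simp: cohom_class_add[symmetric] cocycles_closed cocycles_add cocycles_zero cohomology_zero M.a_ac)
  show "monoid (cohomology A d)"
    by (rule monoidI)
      (auto elim!: cohomology_cases simp: cohom_class_mult[symmetric] cocycles_closed cocycles_mult
        cocycles_one cohomology_one m_assoc)
qed (auto elim!: cohomology_cases simp: cohom_class_mult[symmetric] cohom_class_add[symmetric]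
    cocycles_closed cocycles_mult cocycles_add l_distr r_distr)

lemma module_cohomology: "module K (cohomology A d)"
proof (rule moduleI)
  show "cring K" by (rule module.axioms(1)[OF module_axioms])
  show "abelian_group (cohomology A d)" by (rule ring.is_abelian_group[OF ring_cohomology])
qed (auto elim!: cohomology_cases simp: cohom_class_smult[symmetric] cohom_class_add[symmetric]
    cocycles_closed cocycles_smult cocycles_add smult_l_distr smult_r_distr smult_assoc1)

section \<open>The grading on cohomology\<close>

lemma homog_part_cocycle:
  assumes "x \<in> cocycles A d"
  shows "homog_part A k x \<in> cocycles A d \<inter> homog A k"
proof -
  have x: "x \<in> carrier A" "d x = \<zero>\<^bsub>A\<^esub>" using assms by (simp_all add: cocycles_def)
  have "d (homog_part A k x) = homog_part A (k + 1) (d x)"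
    using x d_homog by (intro homog_part_graded_map[symmetric]) (auto simp: d_add)
  then show ?thesis
    using x homog_part_of_homog[OF homog_zero, of "k + 1" "k + 1"]
    by (simp add: cocycles_def homog_part_closed homog_part_homog)
qed

lemma homog_part_coboundary:
  assumes "b \<in> coboundaries A d"
  shows "homog_part A k b \<in> coboundaries A d"
proof -
  obtain w where w: "w \<in> carrier A" "b = d w" using assms by (auto simp: coboundaries_def)
  have "homog_part A (k - 1 + 1) (d w) = d (homog_part A (k - 1) w)"
    using w d_homog by (intro homog_part_graded_map) (auto simp: d_add)
  then show ?thesis using w by (simp add: coboundary homog_part_closed)
qed

lemma cohom_class_finsum:
  assumes "g \<in> S \<rightarrow> cocycles A d"
  shows "cohom_class A d (\<Oplus>\<^bsub>A\<^esub>k\<in>S. g k) = (\<Oplus>\<^bsub>cohomology A d\<^esub>k\<in>S. cohom_class A d (g k))"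
    and "(\<Oplus>\<^bsub>A\<^esub>k\<in>S. g k) \<in> cocycles A d"
proof -
  interpret coh: ring "cohomology A d" by (rule ring_cohomology)
  have "cohom_class A d (\<Oplus>\<^bsub>A\<^esub>k\<in>S. g k) = (\<Oplus>\<^bsub>cohomology A d\<^esub>k\<in>S. cohom_class A d (g k))
      \<and> (\<Oplus>\<^bsub>A\<^esub>k\<in>S. g k) \<in> cocycles A d"
    using assms
  proof (induction S rule: infinite_finite_induct)
    case (insert k S)
    then show ?case
      by (simp add: cohom_class_add Pi_iff cocycles_closed cocycles_add)
  qed (simp_all add: cocycles_zero cohomology_zero)
  then show "cohom_class A d (\<Oplus>\<^bsub>A\<^esub>k\<in>S. g k) = (\<Oplus>\<^bsub>cohomology A d\<^esub>k\<in>S. cohom_class A d (g k))"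
    and "(\<Oplus>\<^bsub>A\<^esub>k\<in>S. g k) \<in> cocycles A d" by simp_all
qed

lemma is_decomposition_cohomology:
  assumes "x \<in> cocycles A d"
  shows "is_decomposition (cohomology A d) (cohom_class A d x) (\<lambda>k. cohom_class A d (homog_part A k x))"
proof -
  interpret coh: ring "cohomology A d" by (rule ring_cohomology)
  have x: "x \<in> carrier A" using assms by (rule cocycles_closed)
  let ?S = "{k. homog_part A k x \<noteq> \<zero>\<^bsub>A\<^esub>}"
  let ?c = "\<lambda>k. cohom_class A d (homog_part A k x)"
  \<comment> \<open>A nonzero component may be exact, so the classes can have smaller support than
    the components.\<close>
  have *: "{k. ?c k \<noteq> \<zero>\<^bsub>cohomology A d\<^esub>} \<subseteq> ?S" by (auto simp: cohomology_zero)
  have "(\<Oplus>\<^bsub>cohomology A d\<^esub>k\<in>{k. ?c k \<noteq> \<zero>\<^bsub>cohomology A d\<^esub>}. ?c k) = (\<Oplus>\<^bsub>cohomology A d\<^esub>k\<in>?S. ?c k)"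
    using * homog_part_cocycle[OF assms] finite_homog_parts[OF x]
    by (intro coh.add.finprod_mono_neutral_cong_left) auto
  also have "\<dots> = cohom_class A d (\<Oplus>\<^bsub>A\<^esub>k\<in>?S. homog_part A k x)"
    using homog_part_cocycle[OF assms] by (intro cohom_class_finsum(1)[symmetric]) auto
  also have "(\<Oplus>\<^bsub>A\<^esub>k\<in>?S. homog_part A k x) = x"
    using x by (intro finsum_homog_part) (auto intro: finite_homog_parts)
  finally show ?thesis
    using homog_part_cocycle[OF assms] finite_subset[OF * finite_homog_parts[OF x]]
    by (simp add: is_decomposition_def homog_cohomology)
qed

text \<open>Homogeneous cocycles representing the \<open>c k\<close> add up to a cocycle
  cohomologous to \<open>x\<close>. The difference is a coboundary, and its components are again
  coboundaries, so the components of both cocycles have the same classes.\<close>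

lemma is_decomposition_cohomology_unique:
  assumes "x \<in> cocycles A d" "is_decomposition (cohomology A d) (cohom_class A d x) c"
  shows "c k = cohom_class A d (homog_part A k x)"
proof -
  \<comment> \<open>The last clause selects the zero representative for a zero class; this gives
    \<open>y\<close> finite support, so that it is a decomposition in \<open>A\<close>.\<close>
  have "\<forall>k. \<exists>y. y \<in> cocycles A d \<inter> homog A k \<and> c k = cohom_class A d y
      \<and> (c k = \<zero>\<^bsub>cohomology A d\<^esub> \<longrightarrow> y = \<zero>\<^bsub>A\<^esub>)"
  proof
    fix k
    have "c k \<in> cohom_class A d ` (cocycles A d \<inter> homog A k)"
      using assms(2) by (simp add: is_decomposition_def homog_cohomology)
    then show "\<exists>y. y \<in> cocycles A d \<inter> homog A k \<and> c k = cohom_class A d y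
      \<and> (c k = \<zero>\<^bsub>cohomology A d\<^esub> \<longrightarrow> y = \<zero>\<^bsub>A\<^esub>)"
      using cocycles_zero homog_zero cohomology_zero
      by (cases "c k = \<zero>\<^bsub>cohomology A d\<^esub>") auto
  qed
  then obtain y where y: "y k \<in> cocycles A d \<inter> homog A k" "c k = cohom_class A d (y k)"
    "c k = \<zero>\<^bsub>cohomology A d\<^esub> \<longrightarrow> y k = \<zero>\<^bsub>A\<^esub>" for k
    by metis
  let ?S = "{k. c k \<noteq> \<zero>\<^bsub>cohomology A d\<^esub>}"
  have S: "finite ?S" using assms(2) by (simp add: is_decomposition_def)
  define z where "z = (\<Oplus>\<^bsub>A\<^esub>k\<in>?S. y k)"
  have z: "cohom_class A d z = (\<Oplus>\<^bsub>cohomology A d\<^esub>k\<in>?S. cohom_class A d (y k))" "z \<in> cocycles A d"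
    unfolding z_def using y(1) by (auto intro!: cohom_class_finsum)
  then have "cohom_class A d z = cohom_class A d x"
    using assms(2) y(2) by (simp add: is_decomposition_def)
  then have b: "x \<ominus>\<^bsub>A\<^esub> z \<in> coboundaries A d"
    using z(2) assms(1) by (simp add: cohom_class_eq_iff[symmetric] cocycles_closed)
  have "is_decomposition A z y"
    using y S by (intro is_decompositionI[where S = ?S]) (auto simp: z_def)
  then have yk: "y k = homog_part A k z"
    using homog_part_eqI z(2) cocycles_closed by metis
  have "homog_part A k x = homog_part A k (z \<oplus>\<^bsub>A\<^esub> (x \<ominus>\<^bsub>A\<^esub> z))"
    using z(2) assms(1) by (simp add: cocycles_closed M.minus_eq M.a_ac M.r_neg)
  also have "\<dots> = homog_part A k z \<oplus>\<^bsub>A\<^esub> homog_part A k (x \<ominus>\<^bsub>A\<^esub> z)"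
    using z(2) assms(1) by (intro homog_part_add) (simp_all add: cocycles_closed)
  finally have "homog_part A k x = y k \<oplus>\<^bsub>A\<^esub> homog_part A k (x \<ominus>\<^bsub>A\<^esub> z)" by (simp add: yk)
  moreover obtain w where "w \<in> carrier A" "homog_part A k (x \<ominus>\<^bsub>A\<^esub> z) = d w"
    using homog_part_coboundary[OF b, of k] by (auto simp: coboundaries_def)
  moreover have "y k \<in> carrier A" using y(1) cocycles_closed by blast
  ultimately show ?thesis using y(2) cohom_class_eqI[of w "y k" "homog_part A k x"] by simp
qed

text \<open>Makes the calculus of components, of \<open>twist\<close> and of low-degree cochains
  available for the cohomology, under the prefix \<open>coh\<close>.\<close>

sublocale coh: graded_comm_algebra K "cohomology A d"
proof (intro graded_comm_algebra.intro graded_comm_algebra_axioms.intro)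
  interpret coh: module K "cohomology A d" by (rule module_cohomology)
  show "field K" by (rule field_axioms)
  show "module K (cohomology A d)" by (rule module_cohomology)
  show "ring (cohomology A d)" by (rule ring_cohomology)
  show "[m] \<cdot>\<^bsub>K\<^esub> \<one>\<^bsub>K\<^esub> \<noteq> \<zero>\<^bsub>K\<^esub>" if "m > 0" for m :: nat using that by (rule char_zero)
  show "\<one>\<^bsub>cohomology A d\<^esub> \<in> homog (cohomology A d) 0"
    using cocycles_one one_homog by (simp add: homog_cohomology cohomology_one)
  show "r \<odot>\<^bsub>cohomology A d\<^esub> X \<otimes>\<^bsub>cohomology A d\<^esub> Y = r \<odot>\<^bsub>cohomology A d\<^esub> (X \<otimes>\<^bsub>cohomology A d\<^esub> Y)"
    and "X \<otimes>\<^bsub>cohomology A d\<^esub> (r \<odot>\<^bsub>cohomology A d\<^esub> Y) = r \<odot>\<^bsub>cohomology A d\<^esub> (X \<otimes>\<^bsub>cohomology A d\<^esub> Y)"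
    if "r \<in> carrier K" "X \<in> carrier (cohomology A d)" "Y \<in> carrier (cohomology A d)" for r X Y
    using that
    by (auto elim!: cohomology_cases simp: cohom_class_mult[symmetric] cohom_class_smult[symmetric]
        cocycles_closed cocycles_mult cocycles_smult smult_mult_left smult_mult_right)
  show "X \<otimes>\<^bsub>cohomology A d\<^esub> Y \<in> homog (cohomology A d) (i + j)"
    if "X \<in> homog (cohomology A d) i" "Y \<in> homog (cohomology A d) j" for i j X Y
    using that by (auto simp: homog_cohomology cohom_class_mult[symmetric] cocycles_mult mult_homog)
  show "\<exists>!c. is_decomposition (cohomology A d) X c" if "X \<in> carrier (cohomology A d)" for X
    using that
  proof (cases rule: cohomology_cases)
    case (1 x)
    then show ?thesis
      using is_decomposition_cohomology is_decomposition_cohomology_unique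
      by (intro ex1I[of _ "\<lambda>k. cohom_class A d (homog_part A k x)"]) auto
  qed
  have uminus: "\<ominus>\<^bsub>cohomology A d\<^esub> cohom_class A d x = cohom_class A d (\<ominus>\<^bsub>A\<^esub> x)"
    if "x \<in> cocycles A d" for x
    using that
    by (intro coh.minus_equality)
       (auto simp: cohom_class_add[symmetric] cocycles_closed cocycles_uminus cohomology_zero M.l_neg)
  show "X \<otimes>\<^bsub>cohomology A d\<^esub> Y = [neg1_pow (i * j)] \<cdot>\<^bsub>cohomology A d\<^esub> (Y \<otimes>\<^bsub>cohomology A d\<^esub> X)"
    if "X \<in> homog (cohomology A d) i" "Y \<in> homog (cohomology A d) j" for i j X Y
  proof -
    from that obtain x y where xy: "x \<in> cocycles A d" "x \<in> homog A i" "X = cohom_class A d x"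
      "y \<in> cocycles A d" "y \<in> homog A j" "Y = cohom_class A d y"
      by (auto simp: homog_cohomology)
    then show ?thesis
      using graded_comm[of x i y j]
      by (simp add: cohom_class_mult[symmetric] coh.add_pow_neg1_pow M.add_pow_neg1_pow
          cocycles_closed cocycles_mult uminus)
  qed
  show "submodule (homog (cohomology A d) k) K (cohomology A d)" for k
    using cohomology_zero cocycles_zero homog_zero
    by (intro coh.submoduleI)
       (auto simp: homog_cohomology uminus cohom_class_add[symmetric] cohom_class_smult[symmetric]
          cocycles_closed cocycles_add cocycles_smult cocycles_uminus homog_add homog_smult homog_uminus)
qed

lemma cohom_class_uminus:
  assumes "x \<in> cocycles A d"
  shows "cohom_class A d (\<ominus>\<^bsub>A\<^esub> x) = \<ominus>\<^bsub>cohomology A d\<^esub> cohom_class A d x"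
  using assms
  by (intro coh.M.minus_equality[symmetric])
     (auto simp: cohom_class_add[symmetric] cocycles_closed cocycles_uminus cohomology_zero M.l_neg)

lemma cohom_class_diff:
  assumes "x \<in> cocycles A d" "y \<in> cocycles A d"
  shows "cohom_class A d (x \<ominus>\<^bsub>A\<^esub> y) = cohom_class A d x \<ominus>\<^bsub>cohomology A d\<^esub> cohom_class A d y"
  using assms
  by (simp add: a_minus_def cohom_class_add cohom_class_uminus cocycles_closed)

lemma linear_on_cohom_class: "linear_on K A (cocycles A d) (cohomology A d) (cohom_class A d)"
  by (intro linear_onI) (simp_all add: cohom_class_add cohom_class_smult cocycles_closed)

text \<open>Taking classes respects homogeneous components, so the parity operator may be evaluated
  on a representative. This links the sign in \<open>mu3\<close>, which is taken in cohomology, with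
  signs of cochains.\<close>

lemma twist_cohom_class:
  assumes "x \<in> cocycles A d"
  shows "twist (cohomology A d) q (cohom_class A d x) = cohom_class A d (twist A q x)"
proof -
  have x: "x \<in> carrier A" using assms by (rule cocycles_closed)
  have part: "homog_part (cohomology A d) k (cohom_class A d x) = cohom_class A d (homog_part A k x)" for k
    using assms by (intro coh.homog_part_eqI is_decomposition_cohomology) auto
  let ?S = "{k. homog_part A k x \<noteq> \<zero>\<^bsub>A\<^esub>}"
  have S: "finite ?S" using x by (rule finite_homog_parts)
  have "twist (cohomology A d) q (cohom_class A d x)
      = (\<Oplus>\<^bsub>cohomology A d\<^esub>k\<in>?S. [neg1_pow (q * k)] \<cdot>\<^bsub>cohomology A d\<^esub> cohom_class A d (homog_part A k x))"
    using assms S by (subst coh.twist_eq_finsum[where S = ?S]) (auto simp: part cohomology_zero)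
  also have "\<dots> = (\<Oplus>\<^bsub>cohomology A d\<^esub>k\<in>?S. cohom_class A d ([neg1_pow (q * k)] \<cdot>\<^bsub>A\<^esub> homog_part A k x))"
    using homog_part_cocycle[OF assms]
    by (intro coh.M.finsum_cong')
       (auto simp: coh.M.add_pow_neg1_pow M.add_pow_neg1_pow cohom_class_uminus cocycles_closed
          cocycles_uminus)
  also have "\<dots> = cohom_class A d (\<Oplus>\<^bsub>A\<^esub>k\<in>?S. [neg1_pow (q * k)] \<cdot>\<^bsub>A\<^esub> homog_part A k x)"
    using homog_part_cocycle[OF assms]
    by (intro cohom_class_finsum(1)[symmetric])
       (auto simp: M.add_pow_neg1_pow cocycles_closed cocycles_uminus)
  also have "(\<Oplus>\<^bsub>A\<^esub>k\<in>?S. [neg1_pow (q * k)] \<cdot>\<^bsub>A\<^esub> homog_part A k x) = twist A q x"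
    using x S by (intro twist_eq_finsum[symmetric]) auto
  finally show ?thesis .
qed

end

section \<open>Low-degree Harrison cochains\<close>

lemma permutes_lessThan_3_eqI:
  assumes "\<sigma> permutes {..<3::nat}" "\<tau> permutes {..<3}" "\<sigma> 0 = \<tau> 0" "\<sigma> 1 = \<tau> 1" "\<sigma> 2 = \<tau> 2"
  shows "\<sigma> = \<tau>"
proof
  fix x :: nat
  consider "x = 0" | "x = 1" | "x = 2" | "x \<notin> {..<3}" by fastforce
  then show "\<sigma> x = \<tau> x"
    by cases (use assms in \<open>auto simp: permutes_def\<close>)
qed

text \<open>Both blocks are singletons, so monotonicity is vacuous and every permutation is a
  shuffle.\<close>

lemma shuffle_perms_1_2: "shuffle_perms 1 2 = {id, transpose 0 1}"
proof -
  have "{..<2::nat} = {0, 1}" by auto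
  then have "shuffle_perms 1 2 = {\<sigma>. \<sigma> permutes {0, 1::nat}}"
    by (auto simp: shuffle_perms_def strict_mono_on_def)
  also have "\<dots> = {id, transpose 0 1}"
    by (auto simp: permutes_doubleton_iff)
  finally show ?thesis .
qed

text \<open>The 3-cycle that moves the first argument behind the other two. Writing it with
  transpositions makes its sign and its inverse computable.\<close>

definition rot3 :: "nat \<Rightarrow> nat" where
  "rot3 = transpose 0 1 \<circ> transpose 0 2"

text \<open>The inverse cycle, which moves the last argument in front of the other two.\<close>

definition rot3' :: "nat \<Rightarrow> nat" where
  "rot3' = transpose 0 2 \<circ> transpose 0 1"

lemma rot3_simps [simp]:
  "rot3 0 = 2" "rot3 (Suc 0) = 0" "rot3 2 = Suc 0" "rot3' 0 = Suc 0" "rot3' (Suc 0) = 2" "rot3' 2 = 0"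
  by (simp_all add: rot3_def rot3'_def transpose_def)

lemma permutes_rot3: "rot3 permutes {..<3}" "rot3' permutes {..<3}"
  unfolding rot3_def rot3'_def by (intro permutes_compose permutes_swap_id; simp)+

lemma sign_rot3 [simp]: "sign rot3 = 1" "sign rot3' = 1"
  by (simp_all add: rot3_def rot3'_def sign_compose permutation_swap_id sign_swap_id)

lemma inv_rot3 [simp]: "inv_into UNIV rot3 = rot3'" "inv_into UNIV rot3' = rot3"
  by (simp_all add: rot3_def rot3'_def o_inv_distrib)

lemma permutes_lessThan_3_cases:
  assumes "\<sigma> permutes {..<3::nat}"
  shows "\<sigma> 0 < 3" "\<sigma> 1 < 3" "\<sigma> 2 < 3" "\<sigma> 0 \<noteq> \<sigma> 1" "\<sigma> 0 \<noteq> \<sigma> 2" "\<sigma> 1 \<noteq> \<sigma> 2"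
  using permutes_in_image[OF assms] permutes_inj[OF assms] by (auto simp: inj_eq)

text \<open>A shuffle of one argument with two is determined by the position
  \<open>\<sigma> 0\<close> that the single argument receives.\<close>

lemma shuffle_perms_1_3: "shuffle_perms 1 3 = {id, transpose 0 1, rot3}"
proof (intro equalityI subsetI)
  fix \<sigma> assume "\<sigma> \<in> shuffle_perms 1 3"
  then have \<sigma>: "\<sigma> permutes {..<3}" "strict_mono_on {1..<3} \<sigma>" by (auto simp: shuffle_perms_def)
  have lt: "\<sigma> 1 < \<sigma> 2" using \<sigma>(2) by (auto simp: strict_mono_on_def)
  note c = permutes_lessThan_3_cases[OF \<sigma>(1)]
  consider "\<sigma> 0 = 0" "\<sigma> 1 = 1" "\<sigma> 2 = 2" | "\<sigma> 0 = 1" "\<sigma> 1 = 0" "\<sigma> 2 = 2" | "\<sigma> 0 = 2" "\<sigma> 1 = 0" "\<sigma> 2 = 1"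
    using c lt by linarith
  then show "\<sigma> \<in> {id, transpose 0 1, rot3}"
  proof cases
    case 1
    then have "\<sigma> = id" using \<sigma>(1) by (intro permutes_lessThan_3_eqI permutes_id) auto
    then show ?thesis by simp
  next
    case 2
    then have "\<sigma> = transpose 0 1"
      using \<sigma>(1) by (intro permutes_lessThan_3_eqI permutes_swap_id) auto
    then show ?thesis by simp
  next
    case 3
    then have "\<sigma> = rot3" using \<sigma>(1) by (intro permutes_lessThan_3_eqI permutes_rot3) auto
    then show ?thesis by simp
  qed
next
  fix \<sigma> assume "\<sigma> \<in> {id, transpose 0 1, rot3}"
  moreover have "{1..<3::nat} = {1, 2}" by auto
  ultimately show "\<sigma> \<in> shuffle_perms 1 3"
    by (auto simp: shuffle_perms_def strict_mono_on_def permutes_id permutes_rot3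
        intro!: permutes_swap_id)
qed

text \<open>Here the single argument is the last one, and its position \<open>\<sigma> 2\<close>
  determines the shuffle.\<close>

lemma shuffle_perms_2_3: "shuffle_perms 2 3 = {id, transpose 1 2, rot3'}"
proof (intro equalityI subsetI)
  fix \<sigma> assume "\<sigma> \<in> shuffle_perms 2 3"
  then have \<sigma>: "\<sigma> permutes {..<3}" "strict_mono_on {..<2} \<sigma>" by (auto simp: shuffle_perms_def)
  have lt: "\<sigma> 0 < \<sigma> 1" using \<sigma>(2) by (auto simp: strict_mono_on_def)
  note c = permutes_lessThan_3_cases[OF \<sigma>(1)]
  consider "\<sigma> 0 = 0" "\<sigma> 1 = 1" "\<sigma> 2 = 2" | "\<sigma> 0 = 0" "\<sigma> 1 = 2" "\<sigma> 2 = 1" | "\<sigma> 0 = 1" "\<sigma> 1 = 2" "\<sigma> 2 = 0"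
    using c lt by linarith
  then show "\<sigma> \<in> {id, transpose 1 2, rot3'}"
  proof cases
    case 1
    then have "\<sigma> = id" using \<sigma>(1) by (intro permutes_lessThan_3_eqI permutes_id) auto
    then show ?thesis by simp
  next
    case 2
    then have "\<sigma> = transpose 1 2"
      using \<sigma>(1) by (intro permutes_lessThan_3_eqI permutes_swap_id) auto
    then show ?thesis by simp
  next
    case 3
    then have "\<sigma> = rot3'" using \<sigma>(1) by (intro permutes_lessThan_3_eqI permutes_rot3) auto
    then show ?thesis by simp
  qed
next
  fix \<sigma> assume "\<sigma> \<in> {id, transpose 1 2, rot3'}"
  moreover have "{..<2::nat} = {0, 1}" "{2..<3::nat} = {2}" by auto
  ultimately show "\<sigma> \<in> shuffle_perms 2 3"
    by (auto simp: shuffle_perms_def strict_mono_on_def permutes_id permutes_rot3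
        intro!: permutes_swap_id)
qed

lemma koszul_sign_id [simp]: "koszul_sign ks id = 1"
proof -
  have *: "{(j, k). j < k \<and> k < length ks \<and> id k < id j} = ({} :: (nat \<times> nat) set)" by auto
  show ?thesis unfolding koszul_sign_def * by simp
qed

lemma neg1_pow_add: "neg1_pow (m + k) = neg1_pow m * neg1_pow k"
  by (simp add: neg1_pow_def)

lemma less_3_cases: "k < Suc (Suc (Suc 0)) \<longleftrightarrow> k = 0 \<or> k = Suc 0 \<or> k = (2::nat)"
  by auto

text \<open>Only inversions contribute. A 3-cycle carries one argument past the two others, so its
  exponent is the degree of that argument times the sum of the other two degrees.\<close>

lemma koszul_sign_shuffles:
  "koszul_sign [i, j] (transpose 0 1) = neg1_pow (i * j)"
  "koszul_sign [i, j, k] (transpose 0 1) = neg1_pow (i * j)"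
  "koszul_sign [i, j, k] (transpose 1 2) = neg1_pow (j * k)"
  "koszul_sign [i, j, k] rot3 = neg1_pow (i * (j + k))"
  "koszul_sign [i, j, k] rot3' = neg1_pow ((i + j) * k)"
proof -
  have "{(a, b). a < b \<and> b < length [i, j] \<and> transpose 0 1 b < transpose 0 1 a} = {(0, 1 :: nat)}"
    by (auto simp: transpose_def less_2_cases_iff)
  then show "koszul_sign [i, j] (transpose 0 1) = neg1_pow (i * j)"
    by (simp add: koszul_sign_def)
  have "{(a, b). a < b \<and> b < length [i, j, k] \<and> transpose 0 1 b < transpose 0 1 a} = {(0, 1 :: nat)}"
    by (auto simp: transpose_def less_3_cases)
  then show "koszul_sign [i, j, k] (transpose 0 1) = neg1_pow (i * j)"
    by (simp add: koszul_sign_def)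
  have "{(a, b). a < b \<and> b < length [i, j, k] \<and> transpose 1 2 b < transpose 1 2 a} = {(1, 2 :: nat)}"
    by (auto simp: transpose_def less_3_cases)
  then show "koszul_sign [i, j, k] (transpose 1 2) = neg1_pow (j * k)"
    by (simp add: koszul_sign_def)
  have "{(a, b). a < b \<and> b < length [i, j, k] \<and> rot3 b < rot3 a} = {(0, 1 :: nat), (0, 2)}"
    by (auto simp: less_3_cases less_2_cases_iff)
  then show "koszul_sign [i, j, k] rot3 = neg1_pow (i * (j + k))"
    by (simp add: koszul_sign_def neg1_pow_add distrib_left)
  have "{(a, b). a < b \<and> b < length [i, j, k] \<and> rot3' b < rot3' a} = {(0, 2 :: nat), (1, 2)}"
    by (auto simp: less_3_cases less_2_cases_iff)
  then show "koszul_sign [i, j, k] rot3' = neg1_pow ((i + j) * k)"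
    by (simp add: koszul_sign_def neg1_pow_add distrib_right)
qed

text \<open>\<open>CHarr\<close> permutes lists by the inverse of the shuffle, so the line with
  \<open>rot3'\<close> serves the shuffle \<open>rot3\<close>, and conversely.\<close>

lemma permute_list_shuffles:
  "permute_list (transpose 0 1) [a, b] = [b, a]"
  "permute_list (transpose 0 1) [a, b, c] = [b, a, c]"
  "permute_list (transpose 1 2) [a, b, c] = [a, c, b]"
  "permute_list rot3' [a, b, c] = [b, c, a]"
  "permute_list rot3 [a, b, c] = [c, a, b]"
  by (simp_all add: permute_list_def upt_rec transpose_def numeral_2_eq_2[symmetric])

lemma tuples_iff [simp]:
  "[a, b] \<in> tuples B 2 \<longleftrightarrow> a \<in> carrier B \<and> b \<in> carrier B"
  "[a, b, c] \<in> tuples B 3 \<longleftrightarrow> a \<in> carrier B \<and> b \<in> carrier B \<and> c \<in> carrier B"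
  "[a, b, c, e] \<in> tuples B 4 \<longleftrightarrow> a \<in> carrier B \<and> b \<in> carrier B \<and> c \<in> carrier B \<and> e \<in> carrier B"
  by (auto simp: tuples_def)

lemma tuples_2_cases:
  assumes "as \<in> tuples B 2"
  obtains a b where "as = [a, b]" "a \<in> carrier B" "b \<in> carrier B"
  using assms by (auto simp: tuples_def numeral_2_eq_2 length_Suc_conv)

lemma tuples_3_cases:
  assumes "as \<in> tuples B 3"
  obtains a b c where "as = [a, b, c]" "a \<in> carrier B" "b \<in> carrier B" "c \<in> carrier B"
  using assms by (auto simp: tuples_def numeral_3_eq_3 length_Suc_conv)

lemma tuples_4_cases:
  assumes "as \<in> tuples B 4"
  obtains a b c e where "as = [a, b, c, e]"
    "a \<in> carrier B" "b \<in> carrier B" "c \<in> carrier B" "e \<in> carrier B"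
proof -
  have "length as = Suc (Suc (Suc (Suc 0)))" using assms by (simp add: tuples_def)
  then show ?thesis using assms that by (auto simp: tuples_def length_Suc_conv)
qed

lemma homog_tuple_2_cases:
  assumes "homog_tuple B ks [a, b]"
  obtains i j where "ks = [i, j]" "a \<in> homog B i" "b \<in> homog B j"
  using assms by (auto simp: homog_tuple_def list_all2_Cons2)

lemma homog_tuple_3_cases:
  assumes "homog_tuple B ks [a, b, c]"
  obtains i j k where "ks = [i, j, k]" "a \<in> homog B i" "b \<in> homog B j" "c \<in> homog B k"
  using assms by (auto simp: homog_tuple_def list_all2_Cons2)

section \<open>Cochains in two and three arguments\<close>

context graded_comm_algebra begin

text \<open>Bridge from operations with separate arguments to the list encoding of cochains.\<close>

lemma CHoch_2I:
  assumes "\<And>b. b \<in> carrier B \<Longrightarrow> linear_on K B (carrier B) B (\<lambda>a. F a b)"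
    and "\<And>a. a \<in> carrier B \<Longrightarrow> linear_on K B (carrier B) B (F a)"
    and "\<And>i j a b. \<lbrakk>a \<in> homog B i; b \<in> homog B j\<rbrakk> \<Longrightarrow> F a b \<in> homog B (i + j + q)"
  shows "(\<lambda>as\<in>tuples B 2. F (as ! 0) (as ! 1)) \<in> CHoch K B 2 q"
proof -
  let ?f = "\<lambda>as\<in>tuples B 2. F (as ! 0) (as ! 1)"
  have "multilinear K B 2 ?f"
    unfolding multilinear_def
  proof (intro ballI allI impI)
    fix as i assume "as \<in> tuples B 2" "i < (2 :: nat)"
    then have i: "i = 0 \<or> i = 1" by auto
    from \<open>as \<in> tuples B 2\<close> obtain a b where as: "as = [a, b]" "a \<in> carrier B" "b \<in> carrier B"
      by (rule tuples_2_cases)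
    from i show "linear_on K B (carrier B) B (\<lambda>x. ?f (as[i := x]))"
      by (elim disjE; intro linear_on_cong[OF _ _ module_axioms, OF assms(1)[OF as(3)]]
        linear_on_cong[OF _ _ module_axioms, OF assms(2)[OF as(2)]])
        (simp_all add: as)
  qed
  moreover have "?f as \<in> homog B (sum_list ks + q)" if "as \<in> tuples B 2" "homog_tuple B ks as" for as ks
    using that assms(3) by (auto elim!: tuples_2_cases homog_tuple_2_cases)
  moreover have "?f \<in> tuples B 2 \<rightarrow>\<^sub>E carrier B"
    using linear_onD(1)[OF assms(2)] by (auto elim!: tuples_2_cases)
  ultimately show ?thesis by (simp add: CHoch_def)
qed

lemma CHoch_3I:
  assumes "\<And>b c. \<lbrakk>b \<in> carrier B; c \<in> carrier B\<rbrakk> \<Longrightarrow> linear_on K B (carrier B) B (\<lambda>a. F a b c)"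
    and "\<And>a c. \<lbrakk>a \<in> carrier B; c \<in> carrier B\<rbrakk> \<Longrightarrow> linear_on K B (carrier B) B (\<lambda>b. F a b c)"
    and "\<And>a b. \<lbrakk>a \<in> carrier B; b \<in> carrier B\<rbrakk> \<Longrightarrow> linear_on K B (carrier B) B (F a b)"
    and "\<And>i j k a b c. \<lbrakk>a \<in> homog B i; b \<in> homog B j; c \<in> homog B k\<rbrakk> \<Longrightarrow>
      F a b c \<in> homog B (i + j + k + q)"
  shows "(\<lambda>as\<in>tuples B 3. F (as ! 0) (as ! 1) (as ! 2)) \<in> CHoch K B 3 q"
proof -
  let ?f = "\<lambda>as\<in>tuples B 3. F (as ! 0) (as ! 1) (as ! 2)"
  have "multilinear K B 3 ?f"
    unfolding multilinear_def
  proof (intro ballI allI impI)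
    fix as i assume "as \<in> tuples B 3" "i < (3 :: nat)"
    then have i: "i = 0 \<or> i = 1 \<or> i = 2" by auto
    from \<open>as \<in> tuples B 3\<close> obtain a b c
      where as: "as = [a, b, c]" "a \<in> carrier B" "b \<in> carrier B" "c \<in> carrier B"
      by (rule tuples_3_cases)
    from i show "linear_on K B (carrier B) B (\<lambda>x. ?f (as[i := x]))"
      by (elim disjE; intro linear_on_cong[OF _ _ module_axioms, OF assms(1)[OF as(3,4)]]
        linear_on_cong[OF _ _ module_axioms, OF assms(2)[OF as(2,4)]]
        linear_on_cong[OF _ _ module_axioms, OF assms(3)[OF as(2,3)]])
        (simp_all add: as)
  qed
  moreover have "?f as \<in> homog B (sum_list ks + q)" if "as \<in> tuples B 3" "homog_tuple B ks as" for as ks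
    using that assms(4) by (auto elim!: tuples_3_cases homog_tuple_3_cases simp: add.assoc)
  moreover have "?f \<in> tuples B 3 \<rightarrow>\<^sub>E carrier B"
    using linear_onD(1)[OF assms(3)] by (auto elim!: tuples_3_cases)
  ultimately show ?thesis by (simp add: CHoch_def)
qed

text \<open>The sign of an odd permutation turns a Koszul sign into its negative, which is no longer
  syntactically a value of \<open>neg1_pow\<close>.\<close>

lemma add_pow_uminus_neg1_pow:
  "x \<in> carrier B \<Longrightarrow> [(- neg1_pow m)] \<cdot>\<^bsub>B\<^esub> x = \<ominus>\<^bsub>B\<^esub> ([neg1_pow m] \<cdot>\<^bsub>B\<^esub> x)"
  using M.add_pow_neg1_pow[of x "m + 1"] M.add_pow_neg1_pow[of x m] by (auto simp: neg1_pow_def)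

text \<open>The only proper splitting of two arguments is 1 + 1, whose shuffles are the identity and
  a transposition of sign -1. Harrison 2-cochains are therefore the graded symmetric ones.\<close>

lemma CHarr_2I:
  assumes f: "f \<in> CHoch K B 2 q"
    and "\<And>i j a b. \<lbrakk>a \<in> homog B i; b \<in> homog B j\<rbrakk> \<Longrightarrow>
      f [a, b] \<ominus>\<^bsub>B\<^esub> [neg1_pow (i * j)] \<cdot>\<^bsub>B\<^esub> f [b, a] = \<zero>\<^bsub>B\<^esub>"
  shows "f \<in> CHarr K B 2 q"
proof -
  have f_closed: "f as \<in> carrier B" if "as \<in> tuples B 2" for as
    using f that by (auto simp: CHoch_def)
  have "(\<Oplus>\<^bsub>B\<^esub>\<sigma>\<in>shuffle_perms i 2. [(sign \<sigma> * koszul_sign ks \<sigma>)] \<cdot>\<^bsub>B\<^esub> f (permute_list (inv_into UNIV \<sigma>) as)) = \<zero>\<^bsub>B\<^esub>"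
    if "0 < i" "i < 2" "as \<in> tuples B 2" and ks: "homog_tuple B ks as" for i as ks
  proof -
    have i: "i = 1" using that by simp
    from that(3) obtain a b where as: "as = [a, b]" "a \<in> carrier B" "b \<in> carrier B"
      by (rule tuples_2_cases)
    obtain p r where ks: "ks = [p, r]" "a \<in> homog B p" "b \<in> homog B r"
      using ks unfolding as by (rule homog_tuple_2_cases)
    have "id \<noteq> transpose 0 (1 :: nat)" by (metis id_apply transpose_apply_first zero_neq_one)
    then show ?thesis
      using as assms(2)[OF ks(2,3)]
      by (simp add: i shuffle_perms_1_2 ks koszul_sign_shuffles permute_list_shuffles f_closed Pi_iff
          sign_swap_id add_pow_uminus_neg1_pow M.add_pow_neg1_pow M.minus_eq del: One_nat_def)
  qed
  then show ?thesis using f by (simp add: CHarr_def)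
qed

text \<open>One relation for each of the splittings 1 + 2 and 2 + 1. Transpositions have sign -1 and
  3-cycles sign +1, whence the pattern +, -, +.\<close>

lemma CHarr_3I:
  assumes f: "f \<in> CHoch K B 3 q"
    and "\<And>i j k a b c. \<lbrakk>a \<in> homog B i; b \<in> homog B j; c \<in> homog B k\<rbrakk> \<Longrightarrow>
      (f [a, b, c] \<ominus>\<^bsub>B\<^esub> [neg1_pow (i * j)] \<cdot>\<^bsub>B\<^esub> f [b, a, c])
        \<oplus>\<^bsub>B\<^esub> [neg1_pow (i * (j + k))] \<cdot>\<^bsub>B\<^esub> f [b, c, a] = \<zero>\<^bsub>B\<^esub>"
    and "\<And>i j k a b c. \<lbrakk>a \<in> homog B i; b \<in> homog B j; c \<in> homog B k\<rbrakk> \<Longrightarrow>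
      (f [a, b, c] \<ominus>\<^bsub>B\<^esub> [neg1_pow (j * k)] \<cdot>\<^bsub>B\<^esub> f [a, c, b])
        \<oplus>\<^bsub>B\<^esub> [neg1_pow ((i + j) * k)] \<cdot>\<^bsub>B\<^esub> f [c, a, b] = \<zero>\<^bsub>B\<^esub>"
  shows "f \<in> CHarr K B 3 q"
proof -
  have f_closed: "f as \<in> carrier B" if "as \<in> tuples B 3" for as
    using f that by (auto simp: CHoch_def)
  have "(\<Oplus>\<^bsub>B\<^esub>\<sigma>\<in>shuffle_perms i 3. [(sign \<sigma> * koszul_sign ks \<sigma>)] \<cdot>\<^bsub>B\<^esub> f (permute_list (inv_into UNIV \<sigma>) as)) = \<zero>\<^bsub>B\<^esub>"
    if "0 < i" "i < 3" "as \<in> tuples B 3" and ks: "homog_tuple B ks as" for i as ks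
  proof -
    from that(3) obtain a b c
      where as: "as = [a, b, c]" "a \<in> carrier B" "b \<in> carrier B" "c \<in> carrier B"
      by (rule tuples_3_cases)
    obtain p r s where ks: "ks = [p, r, s]" "a \<in> homog B p" "b \<in> homog B r" "c \<in> homog B s"
      using ks unfolding as by (rule homog_tuple_3_cases)
    have neq: "id \<noteq> transpose 0 (1 :: nat)" "id \<noteq> transpose 1 (2 :: nat)" "id \<noteq> rot3" "id \<noteq> rot3'"
      "transpose 0 1 \<noteq> rot3" "transpose 1 2 \<noteq> rot3'"
      by (auto simp: fun_eq_iff transpose_def intro: exI[of _ 0] exI[of _ 1])
    have "i = 1 \<or> i = 2" using that by auto
    then show ?thesis
    proof
      assume "i = 1"
      then show ?thesis
        using neq as assms(2)[OF ks(2-4)]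
        by ((simp add: shuffle_perms_1_3 ks koszul_sign_shuffles permute_list_shuffles f_closed Pi_iff
            sign_swap_id add_pow_uminus_neg1_pow M.add_pow_neg1_pow M.minus_eq M.a_assoc del: One_nat_def)+)
    next
      assume "i = 2"
      then show ?thesis
        using neq as assms(3)[OF ks(2-4)]
        by ((simp add: shuffle_perms_2_3 ks koszul_sign_shuffles permute_list_shuffles f_closed Pi_iff
            sign_swap_id add_pow_uminus_neg1_pow M.add_pow_neg1_pow M.minus_eq M.a_assoc del: One_nat_def)+)
    qed
  qed
  then show ?thesis using f by (simp add: CHarr_def)
qed

section \<open>The Hochschild differential on two and three arguments\<close>

lemma d_Hoch_2:
  assumes "f \<in> tuples B 2 \<rightarrow> carrier B" "a \<in> carrier B" "b \<in> carrier B" "c \<in> carrier B"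
  shows "d_Hoch B 2 q f [a, b, c] = ((twist B q a \<otimes>\<^bsub>B\<^esub> f [b, c]
    \<ominus>\<^bsub>B\<^esub> f [a \<otimes>\<^bsub>B\<^esub> b, c]) \<oplus>\<^bsub>B\<^esub> f [a, b \<otimes>\<^bsub>B\<^esub> c]) \<ominus>\<^bsub>B\<^esub> f [a, b] \<otimes>\<^bsub>B\<^esub> c"
proof -
  have f: "f [x, y] \<in> carrier B" if "x \<in> carrier B" "y \<in> carrier B" for x y
    using that assms(1) by (simp add: Pi_iff)
  have *: "{1..2::nat} = {1, 2}" by auto
  have t: "tuples B (2 + 1) = tuples B 3" by simp
  show ?thesis
    using assms(2-4)
    by (simp add: d_Hoch_def t * M.add_pow_neg1_pow f M.minus_eq M.a_assoc del: One_nat_def)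
qed

lemma d_Hoch_3:
  assumes "f \<in> tuples B 3 \<rightarrow> carrier B" "a \<in> carrier B" "b \<in> carrier B" "c \<in> carrier B" "e \<in> carrier B"
  shows "d_Hoch B 3 q f [a, b, c, e] = (((twist B q a \<otimes>\<^bsub>B\<^esub> f [b, c, e]
    \<ominus>\<^bsub>B\<^esub> f [a \<otimes>\<^bsub>B\<^esub> b, c, e]) \<oplus>\<^bsub>B\<^esub> f [a, b \<otimes>\<^bsub>B\<^esub> c, e]) \<ominus>\<^bsub>B\<^esub> f [a, b, c \<otimes>\<^bsub>B\<^esub> e])
    \<oplus>\<^bsub>B\<^esub> f [a, b, c] \<otimes>\<^bsub>B\<^esub> e"
proof -
  have f: "f [x, y, z] \<in> carrier B" if "x \<in> carrier B" "y \<in> carrier B" "z \<in> carrier B" for x y z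
    using that assms(1) by (simp add: Pi_iff)
  have *: "{1..3::nat} = {1, 2, 3}" by auto
  have t: "tuples B (3 + 1) = tuples B 4" by simp
  show ?thesis
    using assms(2-5)
    by (simp add: d_Hoch_def t * M.add_pow_neg1_pow f M.minus_eq M.a_assoc del: One_nat_def)
qed

section \<open>Sums of cochains and comparison of classes\<close>

lemma permute_list_tuples:
  assumes "as \<in> tuples B p" "\<sigma> permutes {..<p}"
  shows "permute_list \<sigma> as \<in> tuples B p"
  using assms by (auto simp: tuples_def)

lemma CHarr_add:
  assumes f: "f \<in> CHarr K B p q" and g: "g \<in> CHarr K B p q"
  shows "(\<lambda>as\<in>tuples B p. f as \<oplus>\<^bsub>B\<^esub> g as) \<in> CHarr K B p q"
proof -
  let ?h = "\<lambda>as\<in>tuples B p. f as \<oplus>\<^bsub>B\<^esub> g as"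
  have cl: "f as \<in> carrier B" "g as \<in> carrier B" if "as \<in> tuples B p" for as
    using f g that by (auto simp: CHarr_def CHoch_def)
  have upd: "as[i := x] \<in> tuples B p" if "as \<in> tuples B p" "x \<in> carrier B" for as i x
    using that set_update_subset_insert[of as i x] by (auto simp: tuples_def)
  have "multilinear K B p ?h"
    unfolding multilinear_def
  proof (intro ballI allI impI linear_onI)
    fix as i assume as: "as \<in> tuples B p" "i < p"
    have "linear_on K B (carrier B) B (\<lambda>x. f (as[i := x]))" "linear_on K B (carrier B) B (\<lambda>x. g (as[i := x]))"
      using f g as by (auto simp: CHarr_def CHoch_def multilinear_def)
    note lin = linear_onD[OF this(1)] linear_onD[OF this(2)]
    show "?h (as[i := x]) \<in> carrier B" if "x \<in> carrier B" for x
      using that as by (simp add: upd cl)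
    show "?h (as[i := x \<oplus>\<^bsub>B\<^esub> y]) = ?h (as[i := x]) \<oplus>\<^bsub>B\<^esub> ?h (as[i := y])"
      if "x \<in> carrier B" "y \<in> carrier B" for x y
      using that as by (simp add: upd cl lin M.a_ac)
    show "?h (as[i := r \<odot>\<^bsub>B\<^esub> x]) = r \<odot>\<^bsub>B\<^esub> ?h (as[i := x])" if "r \<in> carrier K" "x \<in> carrier B" for r x
      using that as by (simp add: upd cl lin smult_r_distr)
  qed
  moreover have "?h as \<in> homog B (sum_list ks + q)" if "as \<in> tuples B p" "homog_tuple B ks as" for as ks
    using that f g by (auto simp: CHarr_def CHoch_def intro: homog_add)
  ultimately have "?h \<in> CHoch K B p q"
    using cl by (auto simp: CHoch_def)
  moreover have "(\<Oplus>\<^bsub>B\<^esub>\<sigma>\<in>shuffle_perms i p. [(sign \<sigma> * koszul_sign ks \<sigma>)] \<cdot>\<^bsub>B\<^esub> ?h (permute_list (inv_into UNIV \<sigma>) as)) = \<zero>\<^bsub>B\<^esub>"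
    if i: "0 < i" "i < p" and as: "as \<in> tuples B p" "homog_tuple B ks as" for i as ks
  proof -
    have perm: "permute_list (inv_into UNIV \<sigma>) as \<in> tuples B p" if "\<sigma> \<in> shuffle_perms i p" for \<sigma>
      using that as by (auto simp: shuffle_perms_def intro!: permute_list_tuples permutes_inv)
    have "(\<Oplus>\<^bsub>B\<^esub>\<sigma>\<in>shuffle_perms i p. [(sign \<sigma> * koszul_sign ks \<sigma>)] \<cdot>\<^bsub>B\<^esub> ?h (permute_list (inv_into UNIV \<sigma>) as))
      = (\<Oplus>\<^bsub>B\<^esub>\<sigma>\<in>shuffle_perms i p. [(sign \<sigma> * koszul_sign ks \<sigma>)] \<cdot>\<^bsub>B\<^esub> f (permute_list (inv_into UNIV \<sigma>) as)
          \<oplus>\<^bsub>B\<^esub> [(sign \<sigma> * koszul_sign ks \<sigma>)] \<cdot>\<^bsub>B\<^esub> g (permute_list (inv_into UNIV \<sigma>) as))"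
      by (intro M.finsum_cong') (simp_all add: perm cl M.add.int_pow_distrib)
    also have "\<dots> = (\<Oplus>\<^bsub>B\<^esub>\<sigma>\<in>shuffle_perms i p. [(sign \<sigma> * koszul_sign ks \<sigma>)] \<cdot>\<^bsub>B\<^esub> f (permute_list (inv_into UNIV \<sigma>) as))
      \<oplus>\<^bsub>B\<^esub> (\<Oplus>\<^bsub>B\<^esub>\<sigma>\<in>shuffle_perms i p. [(sign \<sigma> * koszul_sign ks \<sigma>)] \<cdot>\<^bsub>B\<^esub> g (permute_list (inv_into UNIV \<sigma>) as))"
      by (intro M.finsum_addf) (simp_all add: perm cl)
    also have "\<dots> = \<zero>\<^bsub>B\<^esub>" using f g i as by (simp add: CHarr_def)
    finally show ?thesis .
  qed
  ultimately show ?thesis by (simp add: CHarr_def)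
qed

lemma d_Hoch_2_add:
  assumes f: "f \<in> CHoch K B 2 q" and g: "g \<in> CHoch K B 2 q" and as: "as \<in> tuples B 3"
  shows "d_Hoch B 2 q (\<lambda>as\<in>tuples B 2. f as \<oplus>\<^bsub>B\<^esub> g as) as = d_Hoch B 2 q f as \<oplus>\<^bsub>B\<^esub> d_Hoch B 2 q g as"
proof -
  have fg: "f \<in> tuples B 2 \<rightarrow> carrier B" "g \<in> tuples B 2 \<rightarrow> carrier B"
    using f g by (auto simp: CHoch_def)
  have cl: "f [a, b] \<in> carrier B" "g [a, b] \<in> carrier B" if "a \<in> carrier B" "b \<in> carrier B" for a b
    using fg that by (simp_all add: Pi_iff)
  have h: "(\<lambda>as\<in>tuples B 2. f as \<oplus>\<^bsub>B\<^esub> g as) \<in> tuples B 2 \<rightarrow> carrier B"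
    using fg by (auto simp: Pi_iff)
  show ?thesis
    using as
    by (cases rule: tuples_3_cases)
       (simp add: d_Hoch_2[OF fg(1)] d_Hoch_2[OF fg(2)] d_Hoch_2[OF h] cl ring_normalize)
qed

text \<open>Elements of a class are sums \<open>d g + m\<close>. If \<open>m = m' + d f\<close>,
  then \<open>d g + m = d (g + f) + m'\<close>, and \<open>g + f\<close> is again a Harrison
  cochain. One inclusion is enough, because the two homotopies can be exchanged later.\<close>

lemma harr_class_3_subset:
  assumes f: "f \<in> CHarr K B 2 q"
    and m': "\<And>as. as \<in> tuples B 3 \<Longrightarrow> m' as \<in> carrier B"
    and "\<And>as. as \<in> tuples B 3 \<Longrightarrow> m as = m' as \<oplus>\<^bsub>B\<^esub> d_Hoch B 2 q f as"
  shows "harr_class K B 3 q m \<subseteq> harr_class K B 3 q m'"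
proof
  fix X assume "X \<in> harr_class K B 3 q m"
  then obtain g where g: "g \<in> CHarr K B 2 q" "X = (\<lambda>as\<in>tuples B 3. d_Hoch B 2 q g as \<oplus>\<^bsub>B\<^esub> m as)"
    by (auto simp: harr_class_def BHarr_def r_coset_def ZHarr_group_def)
  have fg: "f \<in> CHoch K B 2 q" "g \<in> CHoch K B 2 q" using f g by (auto simp: CHarr_def)
  then have "f \<in> tuples B 2 \<rightarrow> carrier B" "g \<in> tuples B 2 \<rightarrow> carrier B" by (auto simp: CHoch_def)
  then have cl: "d_Hoch B 2 q f as \<in> carrier B" "d_Hoch B 2 q g as \<in> carrier B"
    if "as \<in> tuples B 3" for as
    using that by (auto elim!: tuples_3_cases simp: d_Hoch_2 Pi_iff)
  define h where "h = (\<lambda>as\<in>tuples B 2. g as \<oplus>\<^bsub>B\<^esub> f as)"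
  have "X = (\<lambda>as\<in>tuples B 3. d_Hoch B 2 q h as \<oplus>\<^bsub>B\<^esub> m' as)"
    unfolding g(2) h_def using assms(3) m' cl fg
    by (intro restrict_ext) (simp add: d_Hoch_2_add M.a_ac)
  moreover have "h \<in> CHarr K B 2 q"
    unfolding h_def using f g by (intro CHarr_add)
  ultimately show "X \<in> harr_class K B 3 q m'"
    by (auto simp: harr_class_def BHarr_def r_coset_def ZHarr_group_def)
qed

end

section \<open>Triple products from a homotopy-multiplicative section\<close>

text \<open>The cocycle condition with all signs stripped off. The letters \<open>x\<close>,
  \<open>y\<close>, \<open>xy\<close> stand for section values at twisted arguments,
  \<open>z\<close>, \<open>w\<close>, \<open>zw\<close> for section values at untwisted ones, and
  \<open>ga\<close> to \<open>gj\<close> for values of \<open>G\<close>. Of the latter only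
  \<open>gb\<close> and \<open>gj\<close> survive.\<close>

lemma (in ring) massey_cocycle_identity:
  assumes "x \<in> carrier R" "y \<in> carrier R" "xy \<in> carrier R" "z \<in> carrier R" "w \<in> carrier R"
    "zw \<in> carrier R" "ga \<in> carrier R" "gb \<in> carrier R" "gc \<in> carrier R" "gd \<in> carrier R"
    "ge \<in> carrier R" "gf \<in> carrier R" "gg \<in> carrier R" "gh \<in> carrier R" "gi \<in> carrier R"
    "gj \<in> carrier R"
  shows "(((x \<otimes> (ga \<otimes> w \<ominus> y \<otimes> gb \<ominus> gc \<oplus> gd) \<ominus> (ge \<otimes> w \<ominus> xy \<otimes> gb \<ominus> gf \<oplus> gg))
     \<oplus> (gh \<otimes> w \<ominus> x \<otimes> gd \<ominus> gi \<oplus> gg)) \<ominus> (gj \<otimes> zw \<ominus> x \<otimes> gc \<ominus> gi \<oplus> gf))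
     \<oplus> (gj \<otimes> z \<ominus> x \<otimes> ga \<ominus> gh \<oplus> ge) \<otimes> w
   = gj \<otimes> (z \<otimes> w \<ominus> zw) \<ominus> (x \<otimes> y \<ominus> xy) \<otimes> gb"
  by (simp only: ring_normalize a_closed m_closed minus_closed a_inv_closed assms)

text \<open>The effect of transporting \<open>G\<close> along \<open>t\<close>, in independent
  letters. Primes mark the new section at twisted arguments; \<open>dtx\<close> and
  \<open>dtz\<close> are differentials of values of \<open>t\<close>. The two added brackets are the
  expansions of two exact elements.\<close>

lemma (in ring) massey_change_identity:
  assumes "dtx \<in> carrier R" "y \<in> carrier R" "z \<in> carrier R" "dtz \<in> carrier R"
    "yz \<in> carrier R"
    "gxy \<in> carrier R" "gyz \<in> carrier R" "gx_yz \<in> carrier R" "gxy_z \<in> carrier R"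
    "x' \<in> carrier R" "ty \<in> carrier R" "tx \<in> carrier R" "tz \<in> carrier R" "txy \<in> carrier R"
    "tyz \<in> carrier R" "txyz \<in> carrier R" "y' \<in> carrier R" "x'y' \<in> carrier R"
  shows "(gxy \<ominus> tx \<otimes> y \<ominus> x' \<otimes> ty \<oplus> txy) \<otimes> (z \<ominus> dtz)
      \<ominus> x' \<otimes> (gyz \<ominus> ty \<otimes> z \<ominus> y' \<otimes> tz \<oplus> tyz)
      \<ominus> (gx_yz \<ominus> tx \<otimes> yz \<ominus> x' \<otimes> tyz \<oplus> txyz)
      \<oplus> (gxy_z \<ominus> txy \<otimes> z \<ominus> x'y' \<otimes> tz \<oplus> txyz)
    = (gxy \<otimes> z \<ominus> (x' \<oplus> dtx) \<otimes> gyz \<ominus> gx_yz \<oplus> gxy_z)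
      \<oplus> ((dtx \<otimes> gyz \<ominus> tx \<otimes> (y \<otimes> z \<ominus> yz))
      \<oplus> ((x' \<otimes> y' \<ominus> x'y') \<otimes> tz \<ominus> (gxy \<ominus> tx \<otimes> y \<ominus> x' \<otimes> ty \<oplus> txy) \<otimes> dtz))"
  by (simp only: ring_normalize a_closed m_closed minus_closed a_inv_closed assms)

text \<open>For a fixed section the triple product is linear in \<open>G\<close>, so the differences
  of values of \<open>G\<close> assemble into a Hochschild differential.\<close>

lemma (in ring) massey_homotopy_identity:
  assumes "x \<in> carrier R" "z \<in> carrier R" "ga \<in> carrier R" "gb \<in> carrier R" "gc \<in> carrier R"
    "gd \<in> carrier R" "ga' \<in> carrier R" "gb' \<in> carrier R" "gc' \<in> carrier R" "gd' \<in> carrier R"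
  shows "(((ga' \<otimes> z \<ominus> x \<otimes> gb') \<ominus> gc') \<oplus> gd')
      \<oplus> (((x \<otimes> (gb' \<ominus> gb) \<ominus> (gd' \<ominus> gd)) \<oplus> (gc' \<ominus> gc)) \<ominus> (ga' \<ominus> ga) \<otimes> z)
    = ((ga \<otimes> z \<ominus> x \<otimes> gb) \<ominus> gc) \<oplus> gd"
  by (simp only: ring_normalize a_closed m_closed minus_closed a_inv_closed assms)

text \<open>A section of the class map with primitives for its failure to be multiplicative. The
  condition on degrees enters through parity, as \<open>s_twist\<close>, which is the form that the
  sign calculus consumes. Pairs need not come from a contraction, so that the transported pair is an
  instance.\<close>

locale cup_homotopy = dgca K A d
  for K :: "('k, 'm) ring_scheme" (structure)
    and A :: "('k, 'a, 'n) graded_algebra_scheme" (structure)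
    and d :: "'a \<Rightarrow> 'a"
    and s :: "'a set \<Rightarrow> 'a"
    and G :: "'a set \<Rightarrow> 'a set \<Rightarrow> 'a" +
  assumes s_cocycle: "X \<in> carrier (cohomology A d) \<Longrightarrow> s X \<in> cocycles A d"
    and s_class: "X \<in> carrier (cohomology A d) \<Longrightarrow> cohom_class A d (s X) = X"
    and s_twist: "X \<in> carrier (cohomology A d) \<Longrightarrow> s (twist (cohomology A d) 1 X) = twist A 1 (s X)"
    and G_closed: "\<lbrakk>X \<in> carrier (cohomology A d); Y \<in> carrier (cohomology A d)\<rbrakk> \<Longrightarrow> G X Y \<in> carrier A"
    and d_G: "\<lbrakk>X \<in> carrier (cohomology A d); Y \<in> carrier (cohomology A d)\<rbrakk> \<Longrightarrow>
      d (G X Y) = s X \<otimes>\<^bsub>A\<^esub> s Y \<ominus>\<^bsub>A\<^esub> s (X \<otimes>\<^bsub>cohomology A d\<^esub> Y)"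

text \<open>The first two terms are the familiar expression of a Massey triple product, which is
  considered when the neighbouring products vanish. The last two terms correct it to a closed
  element for all arguments.\<close>

definition massey :: "('k, 'a, 'n) graded_algebra_scheme \<Rightarrow> ('a \<Rightarrow> 'a) \<Rightarrow> ('a set \<Rightarrow> 'a) \<Rightarrow>
    ('a set \<Rightarrow> 'a set \<Rightarrow> 'a) \<Rightarrow> 'a set \<Rightarrow> 'a set \<Rightarrow> 'a set \<Rightarrow> 'a" where
  "massey A d s G X Y Z =
     (((G X Y \<otimes>\<^bsub>A\<^esub> s Z) \<ominus>\<^bsub>A\<^esub> (s (twist (cohomology A d) 1 X) \<otimes>\<^bsub>A\<^esub> G Y Z))
       \<ominus>\<^bsub>A\<^esub> G X (Y \<otimes>\<^bsub>cohomology A d\<^esub> Z)) \<oplus>\<^bsub>A\<^esub> G (X \<otimes>\<^bsub>cohomology A d\<^esub> Y) Z"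

context cup_homotopy begin

lemma s_closed: "X \<in> carrier (cohomology A d) \<Longrightarrow> s X \<in> carrier A"
  by (simp add: s_cocycle cocycles_closed)

lemma d_s: "X \<in> carrier (cohomology A d) \<Longrightarrow> d (s X) = \<zero>\<^bsub>A\<^esub>"
  by (simp add: s_cocycle d_cocycle)

lemma massey_cocycle:
  assumes [simp]: "X \<in> carrier (cohomology A d)" "Y \<in> carrier (cohomology A d)" "Z \<in> carrier (cohomology A d)"
  shows "massey A d s G X Y Z \<in> cocycles A d"
proof -
  \<comment> \<open>Since \<open>s\<close> commutes with the parity operator, the Leibniz sign
    cancels the twist in the second term.\<close>
  have "d (massey A d s G X Y Z) = 
    (((s X \<otimes>\<^bsub>A\<^esub> s Y \<ominus>\<^bsub>A\<^esub> s (X \<otimes>\<^bsub>cohomology A d\<^esub> Y)) \<otimes>\<^bsub>A\<^esub> s Z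
      \<ominus>\<^bsub>A\<^esub> s X \<otimes>\<^bsub>A\<^esub> (s Y \<otimes>\<^bsub>A\<^esub> s Z \<ominus>\<^bsub>A\<^esub> s (Y \<otimes>\<^bsub>cohomology A d\<^esub> Z)))
      \<ominus>\<^bsub>A\<^esub> (s X \<otimes>\<^bsub>A\<^esub> s (Y \<otimes>\<^bsub>cohomology A d\<^esub> Z) \<ominus>\<^bsub>A\<^esub> s (X \<otimes>\<^bsub>cohomology A d\<^esub> (Y \<otimes>\<^bsub>cohomology A d\<^esub> Z))))
      \<oplus>\<^bsub>A\<^esub> (s (X \<otimes>\<^bsub>cohomology A d\<^esub> Y) \<otimes>\<^bsub>A\<^esub> s Z \<ominus>\<^bsub>A\<^esub> s (X \<otimes>\<^bsub>cohomology A d\<^esub> Y \<otimes>\<^bsub>cohomology A d\<^esub> Z))"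
    by (simp add: massey_def d_add d_additive leibniz_twist d_G G_closed s_closed d_s s_twist
        d_twist twist_twist twist_additive)
  also have "\<dots> = \<zero>\<^bsub>A\<^esub>"
    by (simp add: coh.m_assoc s_closed ring_normalize)
  finally show ?thesis
    by (simp add: cocycles_def massey_def G_closed s_closed)
qed

lemma massey_Harrison_cocycle:
  assumes [simp]: "X \<in> carrier (cohomology A d)" "Y \<in> carrier (cohomology A d)"
    "Z \<in> carrier (cohomology A d)" "W \<in> carrier (cohomology A d)"
  defines "M \<equiv> \<lambda>X Y Z. cohom_class A d (massey A d s G X Y Z)"
  shows "(((twist (cohomology A d) 1 X \<otimes>\<^bsub>cohomology A d\<^esub> M Y Z W
    \<ominus>\<^bsub>cohomology A d\<^esub> M (X \<otimes>\<^bsub>cohomology A d\<^esub> Y) Z W)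
    \<oplus>\<^bsub>cohomology A d\<^esub> M X (Y \<otimes>\<^bsub>cohomology A d\<^esub> Z) W)
    \<ominus>\<^bsub>cohomology A d\<^esub> M X Y (Z \<otimes>\<^bsub>cohomology A d\<^esub> W))
    \<oplus>\<^bsub>cohomology A d\<^esub> M X Y Z \<otimes>\<^bsub>cohomology A d\<^esub> W = \<zero>\<^bsub>cohomology A d\<^esub>"
    (is "?L = _")
proof -
  let ?H = "cohomology A d" and ?m = "massey A d s G"
  let ?T = "twist (cohomology A d) 1"
  have T: "?T X = cohom_class A d (s (?T X))" "W = cohom_class A d (s W)"
    by (simp_all add: s_class)
  \<comment> \<open>The outer factors are represented by their section values, which moves the whole
    expression to the cochain level.\<close>
  have "?L = cohom_class A d
     ((((s (?T X) \<otimes>\<^bsub>A\<^esub> ?m Y Z W \<ominus>\<^bsub>A\<^esub> ?m (X \<otimes>\<^bsub>?H\<^esub> Y) Z W)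
       \<oplus>\<^bsub>A\<^esub> ?m X (Y \<otimes>\<^bsub>?H\<^esub> Z) W) \<ominus>\<^bsub>A\<^esub> ?m X Y (Z \<otimes>\<^bsub>?H\<^esub> W)) \<oplus>\<^bsub>A\<^esub> ?m X Y Z \<otimes>\<^bsub>A\<^esub> s W)"
    unfolding M_def
    by (simp add: cohom_class_add cohom_class_diff cohom_class_mult massey_cocycle s_cocycle
        cocycles_mult cocycles_add cocycles_diff cocycles_closed s_class)
  also have "(((s (?T X) \<otimes>\<^bsub>A\<^esub> ?m Y Z W \<ominus>\<^bsub>A\<^esub> ?m (X \<otimes>\<^bsub>?H\<^esub> Y) Z W)
       \<oplus>\<^bsub>A\<^esub> ?m X (Y \<otimes>\<^bsub>?H\<^esub> Z) W) \<ominus>\<^bsub>A\<^esub> ?m X Y (Z \<otimes>\<^bsub>?H\<^esub> W)) \<oplus>\<^bsub>A\<^esub> ?m X Y Z \<otimes>\<^bsub>A\<^esub> s W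
    = G X Y \<otimes>\<^bsub>A\<^esub> (s Z \<otimes>\<^bsub>A\<^esub> s W \<ominus>\<^bsub>A\<^esub> s (Z \<otimes>\<^bsub>?H\<^esub> W))
      \<ominus>\<^bsub>A\<^esub> (s (?T X) \<otimes>\<^bsub>A\<^esub> s (?T Y) \<ominus>\<^bsub>A\<^esub> s (?T X \<otimes>\<^bsub>?H\<^esub> ?T Y)) \<otimes>\<^bsub>A\<^esub> G Z W"
    unfolding massey_def
    \<comment> \<open>The instantiated letters are the values of \<open>G\<close> that cancel; they
      do not occur in the goal's right-hand side and cannot be found by matching.\<close>
    by (subst massey_cocycle_identity[symmetric, where
        ga = "G Y Z" and gc = "G Y (Z \<otimes>\<^bsub>?H\<^esub> W)" and gd = "G (Y \<otimes>\<^bsub>?H\<^esub> Z) W"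
        and ge = "G (X \<otimes>\<^bsub>?H\<^esub> Y) Z" and gf = "G (X \<otimes>\<^bsub>?H\<^esub> Y) (Z \<otimes>\<^bsub>?H\<^esub> W)"
        and gg = "G (X \<otimes>\<^bsub>?H\<^esub> Y \<otimes>\<^bsub>?H\<^esub> Z) W" and gh = "G X (Y \<otimes>\<^bsub>?H\<^esub> Z)"
        and gi = "G X (Y \<otimes>\<^bsub>?H\<^esub> Z \<otimes>\<^bsub>?H\<^esub> W)"])
      (simp_all add: G_closed s_closed coh.twist_mult coh.m_assoc)
  \<comment> \<open>Both factors are primitives: differentiating the right one gives the first term,
    differentiating the left one the second. The twist cancels the Leibniz sign in the former and,
    \<open>d\<close> being odd, produces the minus sign in the latter.\<close>
  also have "\<dots> = d (twist A 1 (G X Y) \<otimes>\<^bsub>A\<^esub> G Z W)"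
  proof -
    have "d (twist A 1 (G X Y) \<otimes>\<^bsub>A\<^esub> G Z W)
      = (\<ominus>\<^bsub>A\<^esub> (s (?T X) \<otimes>\<^bsub>A\<^esub> s (?T Y) \<ominus>\<^bsub>A\<^esub> s (?T X \<otimes>\<^bsub>?H\<^esub> ?T Y))) \<otimes>\<^bsub>A\<^esub> G Z W
        \<oplus>\<^bsub>A\<^esub> G X Y \<otimes>\<^bsub>A\<^esub> (s Z \<otimes>\<^bsub>A\<^esub> s W \<ominus>\<^bsub>A\<^esub> s (Z \<otimes>\<^bsub>?H\<^esub> W))"
      by (simp add: leibniz_twist d_twist d_G G_closed twist_twist twist_additive twist_mult s_twist
          coh.twist_mult[symmetric] s_closed)
    moreover have "(\<ominus>\<^bsub>A\<^esub> u) \<otimes>\<^bsub>A\<^esub> g \<oplus>\<^bsub>A\<^esub> v = v \<ominus>\<^bsub>A\<^esub> u \<otimes>\<^bsub>A\<^esub> g"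
      if "u \<in> carrier A" "g \<in> carrier A" "v \<in> carrier A" for u g v
      using that by (simp add: l_minus M.minus_eq M.a_comm)
    ultimately show ?thesis by (simp add: s_closed G_closed)
  qed
  also have "cohom_class A d \<dots> = cohom_class A d \<zero>\<^bsub>A\<^esub>"
    by (rule cohom_class_eqI[of "twist A 1 (G X Y) \<otimes>\<^bsub>A\<^esub> G Z W"]) (simp_all add: G_closed)
  finally show ?thesis by (simp add: cohomology_zero)
qed

text \<open>Both homotopies are primitives of the same elements, so their differences are closed and
  \<open>f\<close> takes values in cohomology. The correction term is its Hochschild
  differential.\<close>

lemma massey_change_homotopy:
  assumes "cup_homotopy K A d s G'"
    and [simp]: "X \<in> carrier (cohomology A d)" "Y \<in> carrier (cohomology A d)" "Z \<in> carrier (cohomology A d)"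
  defines "f \<equiv> \<lambda>X Y. cohom_class A d (G' X Y \<ominus>\<^bsub>A\<^esub> G X Y)"
  shows "cohom_class A d (massey A d s G X Y Z) = cohom_class A d (massey A d s G' X Y Z)
    \<oplus>\<^bsub>cohomology A d\<^esub> (((twist (cohomology A d) 1 X \<otimes>\<^bsub>cohomology A d\<^esub> f Y Z
      \<ominus>\<^bsub>cohomology A d\<^esub> f (X \<otimes>\<^bsub>cohomology A d\<^esub> Y) Z)
      \<oplus>\<^bsub>cohomology A d\<^esub> f X (Y \<otimes>\<^bsub>cohomology A d\<^esub> Z))
      \<ominus>\<^bsub>cohomology A d\<^esub> f X Y \<otimes>\<^bsub>cohomology A d\<^esub> Z)" (is "_ = ?R")
proof -
  interpret G': cup_homotopy K A d s G' by fact
  let ?H = "cohomology A d"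
  let ?T = "twist (cohomology A d) 1"
  have \<phi>: "G' X Y \<ominus>\<^bsub>A\<^esub> G X Y \<in> cocycles A d" if "X \<in> carrier ?H" "Y \<in> carrier ?H" for X Y
    using that by (simp add: cocycles_def G_closed G'.G_closed d_additive d_G G'.d_G s_closed M.diff_eq_iff)
  \<comment> \<open>Collects the classes into a single one, so that the ring identity can be applied
    under \<open>cohom_class\<close>.\<close>
  have hom: "cohom_class A d m \<oplus>\<^bsub>?H\<^esub> (((cohom_class A d x \<otimes>\<^bsub>?H\<^esub> cohom_class A d u \<ominus>\<^bsub>?H\<^esub> cohom_class A d v)
        \<oplus>\<^bsub>?H\<^esub> cohom_class A d w) \<ominus>\<^bsub>?H\<^esub> cohom_class A d r \<otimes>\<^bsub>?H\<^esub> cohom_class A d z)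
      = cohom_class A d (m \<oplus>\<^bsub>A\<^esub> (((x \<otimes>\<^bsub>A\<^esub> u \<ominus>\<^bsub>A\<^esub> v) \<oplus>\<^bsub>A\<^esub> w) \<ominus>\<^bsub>A\<^esub> r \<otimes>\<^bsub>A\<^esub> z))"
    if "{m, x, u, v, w, r, z} \<subseteq> cocycles A d" for m x u v w r z
    using that
    by (simp add: cohom_class_add cohom_class_diff cohom_class_mult cocycles_mult cocycles_add
        cocycles_diff cocycles_closed)
  have "?R = cohom_class A d (massey A d s G' X Y Z \<oplus>\<^bsub>A\<^esub>
    (((s (?T X) \<otimes>\<^bsub>A\<^esub> (G' Y Z \<ominus>\<^bsub>A\<^esub> G Y Z)
      \<ominus>\<^bsub>A\<^esub> (G' (X \<otimes>\<^bsub>?H\<^esub> Y) Z \<ominus>\<^bsub>A\<^esub> G (X \<otimes>\<^bsub>?H\<^esub> Y) Z))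
      \<oplus>\<^bsub>A\<^esub> (G' X (Y \<otimes>\<^bsub>?H\<^esub> Z) \<ominus>\<^bsub>A\<^esub> G X (Y \<otimes>\<^bsub>?H\<^esub> Z)))
      \<ominus>\<^bsub>A\<^esub> (G' X Y \<ominus>\<^bsub>A\<^esub> G X Y) \<otimes>\<^bsub>A\<^esub> s Z))"
    unfolding f_def
    by (subst hom[symmetric]) (simp_all add: \<phi> s_cocycle G'.massey_cocycle s_class)
  also have "massey A d s G' X Y Z \<oplus>\<^bsub>A\<^esub>
    (((s (?T X) \<otimes>\<^bsub>A\<^esub> (G' Y Z \<ominus>\<^bsub>A\<^esub> G Y Z)
      \<ominus>\<^bsub>A\<^esub> (G' (X \<otimes>\<^bsub>?H\<^esub> Y) Z \<ominus>\<^bsub>A\<^esub> G (X \<otimes>\<^bsub>?H\<^esub> Y) Z))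
      \<oplus>\<^bsub>A\<^esub> (G' X (Y \<otimes>\<^bsub>?H\<^esub> Z) \<ominus>\<^bsub>A\<^esub> G X (Y \<otimes>\<^bsub>?H\<^esub> Z)))
      \<ominus>\<^bsub>A\<^esub> (G' X Y \<ominus>\<^bsub>A\<^esub> G X Y) \<otimes>\<^bsub>A\<^esub> s Z) = massey A d s G X Y Z"
    unfolding massey_def
    by (rule massey_homotopy_identity) (simp_all add: s_closed G_closed G'.G_closed)
  finally show ?thesis by simp
qed

text \<open>The formula for \<open>G'\<close> comes from replacing the section one factor at a time:
  \<open>s X s Y - s' X s' Y = d (t X) s Y + s' X d (t Y)\<close>. The term
  \<open>t (X \<otimes> Y)\<close> accounts for the new section on the product. Using
  \<open>s\<close> in one factor and \<open>s'\<close> in the other is what makes \<open>G'\<close>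
  asymmetric.\<close>

lemma change_section:
  assumes t: "\<And>X. X \<in> carrier (cohomology A d) \<Longrightarrow> t X \<in> carrier A"
    and t_twist: "\<And>X. X \<in> carrier (cohomology A d) \<Longrightarrow>
      twist A 1 (t X) = \<ominus>\<^bsub>A\<^esub> t (twist (cohomology A d) 1 X)"
    and s': "\<And>X. X \<in> carrier (cohomology A d) \<Longrightarrow> s' X = s X \<ominus>\<^bsub>A\<^esub> d (t X)"
    and G': "\<And>X Y. \<lbrakk>X \<in> carrier (cohomology A d); Y \<in> carrier (cohomology A d)\<rbrakk> \<Longrightarrow>
      G' X Y = ((G X Y \<ominus>\<^bsub>A\<^esub> t X \<otimes>\<^bsub>A\<^esub> s Y) \<ominus>\<^bsub>A\<^esub> s' (twist (cohomology A d) 1 X) \<otimes>\<^bsub>A\<^esub> t Y)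
        \<oplus>\<^bsub>A\<^esub> t (X \<otimes>\<^bsub>cohomology A d\<^esub> Y)"
  shows "cup_homotopy K A d s' G'"
proof (intro cup_homotopy.intro cup_homotopy_axioms.intro dgca_axioms)
  let ?H = "cohomology A d"
  fix X assume X [simp]: "X \<in> carrier ?H"
  show "s' X \<in> cocycles A d"
    by (simp add: s' t s_cocycle cocycles_diff cocycles_d)
  have s'_closed: "s' X \<in> carrier A" by (simp add: s' t s_closed)
  have "s X = s' X \<oplus>\<^bsub>A\<^esub> d (t X)"
    unfolding s'[OF X] by (simp add: t s_closed M.minus_eq M.a_assoc M.l_neg)
  then have "cohom_class A d (s X) = cohom_class A d (s' X)"
    by (rule cohom_class_eqI[OF t[OF X] s'_closed])
  then show "cohom_class A d (s' X) = X"
    by (simp add: s_class)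
  have "t (twist ?H 1 X) = \<ominus>\<^bsub>A\<^esub> twist A 1 (t X)"
    by (simp add: t_twist t)
  then show twist: "s' (twist ?H 1 X) = twist A 1 (s' X)"
    by (simp add: s' t s_twist s_closed d_additive d_twist twist_additive)
  fix Y assume Y [simp]: "Y \<in> carrier ?H"
  show "G' X Y \<in> carrier A"
    by (simp add: G' s' t s_closed G_closed)
  show "d (G' X Y) = s' X \<otimes>\<^bsub>A\<^esub> s' Y \<ominus>\<^bsub>A\<^esub> s' (X \<otimes>\<^bsub>?H\<^esub> Y)"
  proof -
    have XY: "X \<otimes>\<^bsub>?H\<^esub> Y \<in> carrier ?H" by simp
    \<comment> \<open>The element \<open>s' X\<close> is closed, and the twist of its argument
      cancels the Leibniz sign.\<close>
    have "d (s' (twist ?H 1 X) \<otimes>\<^bsub>A\<^esub> t Y) = s' X \<otimes>\<^bsub>A\<^esub> d (t Y)"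
    proof -
      have "d (s' X) = d (s X) \<ominus>\<^bsub>A\<^esub> d (d (t X))" by (simp add: s' t s_closed d_additive(3))
      then have "d (s' X) = \<zero>\<^bsub>A\<^esub>" by (simp add: t d_s d_squared M.minus_eq)
      then show ?thesis
        by (simp add: twist leibniz_twist twist_twist d_twist t s'_closed twist_additive)
    qed
    moreover have "d (t X \<otimes>\<^bsub>A\<^esub> s Y) = d (t X) \<otimes>\<^bsub>A\<^esub> s Y"
      by (simp add: leibniz_twist t s_closed d_s)
    ultimately have "d (G' X Y) = ((s X \<otimes>\<^bsub>A\<^esub> s Y \<ominus>\<^bsub>A\<^esub> s (X \<otimes>\<^bsub>?H\<^esub> Y)) \<ominus>\<^bsub>A\<^esub> d (t X) \<otimes>\<^bsub>A\<^esub> s Y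
        \<ominus>\<^bsub>A\<^esub> s' X \<otimes>\<^bsub>A\<^esub> d (t Y)) \<oplus>\<^bsub>A\<^esub> d (t (X \<otimes>\<^bsub>?H\<^esub> Y))"
      by (simp add: G' d_add d_additive d_G t s_closed G_closed twist s'_closed)
    then show ?thesis
      by (simp only: s' X Y XY ring_normalize a_closed m_closed minus_closed a_inv_closed s_closed
          t d_closed)
  qed
qed

text \<open>The two triple products differ by \<open>d\<close> of
  \<open>t (twist X) \<otimes> G Y Z - twist (G' X Y) \<otimes> t Z\<close>. Each summand combines
  the change of section at an outer argument with a homotopy of the other two.\<close>

lemma massey_change_section:
  assumes t: "\<And>X. X \<in> carrier (cohomology A d) \<Longrightarrow> t X \<in> carrier A"
    and t_twist: "\<And>X. X \<in> carrier (cohomology A d) \<Longrightarrow>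
      twist A 1 (t X) = \<ominus>\<^bsub>A\<^esub> t (twist (cohomology A d) 1 X)"
    and s': "\<And>X. X \<in> carrier (cohomology A d) \<Longrightarrow> s' X = s X \<ominus>\<^bsub>A\<^esub> d (t X)"
    and G': "\<And>X Y. \<lbrakk>X \<in> carrier (cohomology A d); Y \<in> carrier (cohomology A d)\<rbrakk> \<Longrightarrow>
      G' X Y = ((G X Y \<ominus>\<^bsub>A\<^esub> t X \<otimes>\<^bsub>A\<^esub> s Y) \<ominus>\<^bsub>A\<^esub> s' (twist (cohomology A d) 1 X) \<otimes>\<^bsub>A\<^esub> t Y)
        \<oplus>\<^bsub>A\<^esub> t (X \<otimes>\<^bsub>cohomology A d\<^esub> Y)"
    and [simp]: "X \<in> carrier (cohomology A d)" "Y \<in> carrier (cohomology A d)" "Z \<in> carrier (cohomology A d)"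
  shows "cohom_class A d (massey A d s' G' X Y Z) = cohom_class A d (massey A d s G X Y Z)"
proof -
  interpret P: cup_homotopy K A d s' G'
    by (rule change_section[OF t t_twist s' G'])
  let ?H = "cohomology A d"
  let ?T = "twist (cohomology A d) 1"
  \<comment> \<open>The old section at the twisted argument is expressed by the new one, to match
    \<open>x' \<oplus> dtx\<close> in the ring identity.\<close>
  have s: "s (?T X) = s' (?T X) \<oplus>\<^bsub>A\<^esub> d (t (?T X))"
    by (subst s') (simp_all add: t s_closed M.minus_eq M.a_assoc M.l_neg)
  \<comment> \<open>The minus sign arises because \<open>t\<close> is odd: twisting
    \<open>t (?T X)\<close> gives \<open>- t X\<close>.\<close>
  have "d (t (?T X) \<otimes>\<^bsub>A\<^esub> G Y Z) = d (t (?T X)) \<otimes>\<^bsub>A\<^esub> G Y Z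
      \<ominus>\<^bsub>A\<^esub> t X \<otimes>\<^bsub>A\<^esub> (s Y \<otimes>\<^bsub>A\<^esub> s Z \<ominus>\<^bsub>A\<^esub> s (Y \<otimes>\<^bsub>?H\<^esub> Z))"
    by (simp add: leibniz_twist t G_closed t_twist coh.twist_twist d_G s_closed l_minus M.minus_eq)
  moreover have "d (twist A 1 (G' X Y) \<otimes>\<^bsub>A\<^esub> t Z) = G' X Y \<otimes>\<^bsub>A\<^esub> d (t Z)
      \<ominus>\<^bsub>A\<^esub> (s' (?T X) \<otimes>\<^bsub>A\<^esub> s' (?T Y) \<ominus>\<^bsub>A\<^esub> s' (?T X \<otimes>\<^bsub>?H\<^esub> ?T Y)) \<otimes>\<^bsub>A\<^esub> t Z"
  proof -
    have "d (twist A 1 (G' X Y) \<otimes>\<^bsub>A\<^esub> t Z)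
      = (\<ominus>\<^bsub>A\<^esub> (s' (?T X) \<otimes>\<^bsub>A\<^esub> s' (?T Y) \<ominus>\<^bsub>A\<^esub> s' (?T X \<otimes>\<^bsub>?H\<^esub> ?T Y))) \<otimes>\<^bsub>A\<^esub> t Z
        \<oplus>\<^bsub>A\<^esub> G' X Y \<otimes>\<^bsub>A\<^esub> d (t Z)"
      by (simp add: leibniz_twist d_twist P.d_G P.G_closed t twist_twist twist_additive twist_mult
          P.s_twist coh.twist_mult[symmetric] P.s_closed)
    moreover have "(\<ominus>\<^bsub>A\<^esub> u) \<otimes>\<^bsub>A\<^esub> g \<oplus>\<^bsub>A\<^esub> v = v \<ominus>\<^bsub>A\<^esub> u \<otimes>\<^bsub>A\<^esub> g"
      if "u \<in> carrier A" "g \<in> carrier A" "v \<in> carrier A" for u g v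
      using that by (simp add: l_minus M.minus_eq M.a_comm)
    ultimately show ?thesis by (simp add: P.s_closed P.G_closed t)
  qed
  ultimately have d: "d (t (?T X) \<otimes>\<^bsub>A\<^esub> G Y Z \<ominus>\<^bsub>A\<^esub> twist A 1 (G' X Y) \<otimes>\<^bsub>A\<^esub> t Z)
    = (d (t (?T X)) \<otimes>\<^bsub>A\<^esub> G Y Z \<ominus>\<^bsub>A\<^esub> t X \<otimes>\<^bsub>A\<^esub> (s Y \<otimes>\<^bsub>A\<^esub> s Z \<ominus>\<^bsub>A\<^esub> s (Y \<otimes>\<^bsub>?H\<^esub> Z)))
      \<oplus>\<^bsub>A\<^esub> ((s' (?T X) \<otimes>\<^bsub>A\<^esub> s' (?T Y) \<ominus>\<^bsub>A\<^esub> s' (?T X \<otimes>\<^bsub>?H\<^esub> ?T Y)) \<otimes>\<^bsub>A\<^esub> t Z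
        \<ominus>\<^bsub>A\<^esub> G' X Y \<otimes>\<^bsub>A\<^esub> d (t Z))"
    by (simp add: d_additive(3) t G_closed P.G_closed s_closed P.s_closed M.diff_diff)
  have "massey A d s' G' X Y Z = massey A d s G X Y Z \<oplus>\<^bsub>A\<^esub>
      d (t (?T X) \<otimes>\<^bsub>A\<^esub> G Y Z \<ominus>\<^bsub>A\<^esub> twist A 1 (G' X Y) \<otimes>\<^bsub>A\<^esub> t Z)"
    unfolding d unfolding massey_def s s'[OF assms(7)] G'[OF assms(5,6)] G'[OF assms(6,7)]
      G'[OF assms(5) coh.m_closed[OF assms(6,7)]] G'[OF coh.m_closed[OF assms(5,6)] assms(7)]
      coh.m_assoc[OF assms(5-7)] coh.twist_mult[OF assms(5,6)]
    by (rule massey_change_identity) (simp_all add: t s_closed G_closed P.s_closed)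
  then show ?thesis
    by (intro cohom_class_eqI[where w = "t (?T X) \<otimes>\<^bsub>A\<^esub> G Y Z \<ominus>\<^bsub>A\<^esub> twist A 1 (G' X Y) \<otimes>\<^bsub>A\<^esub> t Z"])
      (simp_all add: t G_closed P.G_closed massey_def s_closed)
qed

end

section \<open>Contractions\<close>

context graded_comm_algebra begin

section \<open>Linear maps built from sums and products\<close>

lemma linear_on_add:
  assumes "linear_on K V S B f" "linear_on K V S B g"
  shows "linear_on K V S B (\<lambda>x. f x \<oplus>\<^bsub>B\<^esub> g x)"
  using linear_onD[OF assms(1)] linear_onD[OF assms(2)]
  by (intro linear_onI) (simp_all add: M.a_ac smult_r_distr)

lemma linear_on_diff:
  assumes "linear_on K V S B f" "linear_on K V S B g"
  shows "linear_on K V S B (\<lambda>x. f x \<ominus>\<^bsub>B\<^esub> g x)"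
  using linear_onD[OF assms(1)] linear_onD[OF assms(2)]
  by (intro linear_onI) (simp_all add: M.minus_eq M.minus_add M.a_ac smult_r_distr smult_r_minus)

lemma linear_on_mult_right:
  assumes "linear_on K V S B f" "c \<in> carrier B"
  shows "linear_on K V S B (\<lambda>x. f x \<otimes>\<^bsub>B\<^esub> c)"
  using linear_onD[OF assms(1)] assms(2)
  by (intro linear_onI) (simp_all add: l_distr smult_mult_left)

lemma linear_on_mult_left:
  assumes "linear_on K V S B f" "c \<in> carrier B"
  shows "linear_on K V S B (\<lambda>x. c \<otimes>\<^bsub>B\<^esub> f x)"
  using linear_onD[OF assms(1)] assms(2)
  by (intro linear_onI) (simp_all add: r_distr smult_mult_right)

lemma linear_on_id: "linear_on K B (carrier B) B (\<lambda>x. x)"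
  by (intro linear_onI) auto

text \<open>The two shuffle relations for a Massey-type expression \<open>u r - (-1)\<^sup>i p v\<close>, where \<open>u\<close>, \<open>v\<close>, \<open>w\<close>
  are the values of a graded symmetric operation of degree \<open>-1\<close> on \<open>(p,q)\<close>, \<open>(q,r)\<close>, \<open>(p,r)\<close>.\<close>

lemma massey_shuffle_1:
  assumes "p \<in> homog B i" "q \<in> homog B j" "r \<in> homog B k"
    and "u \<in> homog B (i + j - 1)" "v \<in> homog B (j + k - 1)" "w \<in> homog B (i + k - 1)"
  shows "((u \<otimes>\<^bsub>B\<^esub> r \<ominus>\<^bsub>B\<^esub> ([neg1_pow i] \<cdot>\<^bsub>B\<^esub> p) \<otimes>\<^bsub>B\<^esub> v)
      \<ominus>\<^bsub>B\<^esub> [neg1_pow (i * j)] \<cdot>\<^bsub>B\<^esub> (([neg1_pow (i * j)] \<cdot>\<^bsub>B\<^esub> u) \<otimes>\<^bsub>B\<^esub> r \<ominus>\<^bsub>B\<^esub> ([neg1_pow j] \<cdot>\<^bsub>B\<^esub> q) \<otimes>\<^bsub>B\<^esub> w))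
      \<oplus>\<^bsub>B\<^esub> [neg1_pow (i * (j + k))] \<cdot>\<^bsub>B\<^esub>
        (v \<otimes>\<^bsub>B\<^esub> p \<ominus>\<^bsub>B\<^esub> ([neg1_pow j] \<cdot>\<^bsub>B\<^esub> q) \<otimes>\<^bsub>B\<^esub> ([neg1_pow (i * k)] \<cdot>\<^bsub>B\<^esub> w)) = \<zero>\<^bsub>B\<^esub>"
proof -
  note [simp] = assms[THEN homog_closed]
  have vp: "v \<otimes>\<^bsub>B\<^esub> p = [neg1_pow ((j + k - 1) * i)] \<cdot>\<^bsub>B\<^esub> (p \<otimes>\<^bsub>B\<^esub> v)"
    using assms by (intro graded_comm)
  show ?thesis
    unfolding vp
    by (cases "even i"; cases "even j"; cases "even k")
       (simp_all add: M.add_pow_neg1_pow ring_normalize)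
qed

lemma massey_shuffle_2:
  assumes "p \<in> homog B i" "q \<in> homog B j" "r \<in> homog B k"
    and "u \<in> homog B (i + j - 1)" "v \<in> homog B (j + k - 1)" "w \<in> homog B (i + k - 1)"
  shows "((u \<otimes>\<^bsub>B\<^esub> r \<ominus>\<^bsub>B\<^esub> ([neg1_pow i] \<cdot>\<^bsub>B\<^esub> p) \<otimes>\<^bsub>B\<^esub> v)
      \<ominus>\<^bsub>B\<^esub> [neg1_pow (j * k)] \<cdot>\<^bsub>B\<^esub> (w \<otimes>\<^bsub>B\<^esub> q \<ominus>\<^bsub>B\<^esub> ([neg1_pow i] \<cdot>\<^bsub>B\<^esub> p) \<otimes>\<^bsub>B\<^esub> ([neg1_pow (j * k)] \<cdot>\<^bsub>B\<^esub> v)))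
      \<oplus>\<^bsub>B\<^esub> [neg1_pow ((i + j) * k)] \<cdot>\<^bsub>B\<^esub>
        (([neg1_pow (i * k)] \<cdot>\<^bsub>B\<^esub> w) \<otimes>\<^bsub>B\<^esub> q \<ominus>\<^bsub>B\<^esub> ([neg1_pow k] \<cdot>\<^bsub>B\<^esub> r) \<otimes>\<^bsub>B\<^esub> u) = \<zero>\<^bsub>B\<^esub>"
proof -
  note [simp] = assms[THEN homog_closed]
  have ru: "r \<otimes>\<^bsub>B\<^esub> u = [neg1_pow (k * (i + j - 1))] \<cdot>\<^bsub>B\<^esub> (u \<otimes>\<^bsub>B\<^esub> r)"
    using assms by (intro graded_comm)
  show ?thesis
    by (cases "even i"; cases "even j"; cases "even k")
       (simp_all add: M.add_pow_neg1_pow ring_normalize ru)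
qed

end

text \<open>Contraction data as in homotopy transfer: the identities make \<open>d h + h d\<close>
  idempotent, and the complementary projection \<open>\<pi>\<close> has as its image a copy of the
  cohomology.\<close>

locale contraction = dgca K A d
  for K :: "('k, 'm) ring_scheme" (structure)
    and A :: "('k, 'a, 'n) graded_algebra_scheme" (structure)
    and d :: "'a \<Rightarrow> 'a"
    and h :: "'a \<Rightarrow> 'a" +
  assumes h_linear: "linear_on K A (carrier A) A h"
    and h_homog: "x \<in> homog A k \<Longrightarrow> h x \<in> homog A (k - 1)"
    and h_h: "x \<in> carrier A \<Longrightarrow> h (h x) = \<zero>\<^bsub>A\<^esub>"
    and h_d_h: "x \<in> carrier A \<Longrightarrow> h (d (h x)) = h x"
    and d_h_d: "x \<in> carrier A \<Longrightarrow> d (h (d x)) = d x"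
begin

lemmas h_closed [simp] = linear_onD(1)[OF h_linear]
  and h_add = linear_onD(2)[OF h_linear]

lemmas h_additive = linear_on_additive[OF h_linear M.abelian_group_axioms M.abelian_group_axioms]

lemma h_twist: "x \<in> carrier A \<Longrightarrow> h (twist A 1 x) = \<ominus>\<^bsub>A\<^esub> twist A 1 (h x)"
  by (rule graded_map_twist_odd[OF h_linear, where j = "-1"]) (simp_all add: h_homog)

section \<open>The harmonic projection\<close>

abbreviation "\<pi> \<equiv> harm_proj A d h"

lemma linear_on_\<pi>: "linear_on K A (carrier A) A \<pi>"
proof -
  have "linear_on K A (carrier A) A (\<lambda>x. x \<ominus>\<^bsub>A\<^esub> (d (h x) \<oplus>\<^bsub>A\<^esub> h (d x)))"
    by (intro linear_on_diff linear_on_add linear_on_id linear_on_compose[OF h_linear d_linear]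
        linear_on_compose[OF d_linear h_linear]) auto
  then show ?thesis by (simp add: harm_proj_def[abs_def])
qed

lemmas \<pi>_closed [simp] = linear_onD(1)[OF linear_on_\<pi>]
  and \<pi>_additive = linear_on_additive[OF linear_on_\<pi> M.abelian_group_axioms M.abelian_group_axioms]

lemma \<pi>_homog:
  assumes "x \<in> homog A k"
  shows "\<pi> x \<in> homog A k"
  using assms d_homog[OF h_homog[OF assms]] h_homog[OF d_homog[OF assms]]
  by (simp add: harm_proj_def homog_diff homog_add)

lemma \<pi>_cocycle: "x \<in> carrier A \<Longrightarrow> \<pi> x \<in> cocycles A d"
  by (simp add: cocycles_def harm_proj_def d_additive(3) d_add d_squared d_h_d M.diff_eq_iff)

lemma \<pi>_d: "x \<in> carrier A \<Longrightarrow> \<pi> (d x) = \<zero>\<^bsub>A\<^esub>"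
  by (simp add: harm_proj_def d_squared d_h_d h_additive(1) M.minus_eq M.r_neg)

lemma \<pi>_of_cocycle: "x \<in> cocycles A d \<Longrightarrow> \<pi> x = x \<ominus>\<^bsub>A\<^esub> d (h x)"
  by (simp add: harm_proj_def cocycles_def h_additive(1))

lemma \<pi>_\<pi>:
  assumes "x \<in> carrier A"
  shows "\<pi> (\<pi> x) = \<pi> x"
proof -
  \<comment> \<open>The homotopy kills harmonic elements, by \<open>h d h = h\<close> and
    \<open>h h = 0\<close>; with closedness this makes them fixed by \<open>\<pi>\<close>.\<close>
  have "h (\<pi> x) = h x \<ominus>\<^bsub>A\<^esub> (h (d (h x)) \<oplus>\<^bsub>A\<^esub> h (h (d x)))"
    using assms by (simp add: harm_proj_def h_additive(3) h_add)
  also have "\<dots> = \<zero>\<^bsub>A\<^esub>"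
    using assms by (simp add: h_d_h h_h M.minus_eq M.r_neg)
  finally show ?thesis
    using assms \<pi>_of_cocycle[OF \<pi>_cocycle[OF assms]] by (simp add: d_additive(1) M.minus_eq)
qed

lemma cohom_class_\<pi>:
  assumes "x \<in> cocycles A d"
  shows "cohom_class A d (\<pi> x) = cohom_class A d x"
proof -
  have x: "x \<in> carrier A" using assms by (rule cocycles_closed)
  have "x = \<pi> x \<oplus>\<^bsub>A\<^esub> d (h x)"
    using x by (simp add: \<pi>_of_cocycle[OF assms] M.minus_eq M.a_assoc M.l_neg)
  then show ?thesis
    using cohom_class_eqI[of "h x" "\<pi> x" x] x by simp
qed

lemma \<pi>_twist:
  assumes "x \<in> carrier A"
  shows "\<pi> (twist A 1 x) = twist A 1 (\<pi> x)"
  using assms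
  by (simp add: harm_proj_def h_twist d_twist d_additive(2) h_additive(2) twist_additive(3) twist_add)

text \<open>Exact elements are killed by \<open>\<pi>\<close>, so the projection sees only the
  class.\<close>

lemma \<pi>_eqI:
  assumes "x \<in> carrier A" "y \<in> carrier A" "cohom_class A d x = cohom_class A d y"
  shows "\<pi> x = \<pi> y"
proof -
  obtain w where w: "w \<in> carrier A" "x \<ominus>\<^bsub>A\<^esub> y = d w"
    using assms by (auto simp: cohom_class_eq_iff coboundaries_def)
  then have "\<pi> x \<ominus>\<^bsub>A\<^esub> \<pi> y = \<zero>\<^bsub>A\<^esub>"
    using assms \<pi>_additive(3)[of x y] by (simp add: \<pi>_d)
  then show ?thesis using assms by (simp add: M.diff_eq_iff)
qed

abbreviation "\<iota> \<equiv> harm_rep A d h"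

text \<open>A harmonic element is fixed by \<open>\<pi>\<close>, and \<open>\<pi>\<close> depends
  only on the class; so the class map is injective on harmonic elements. The inverse that defines
  \<open>harm_rep\<close> thereby becomes explicit on arbitrary representatives.\<close>

lemma harm_rep_cohom_class:
  assumes "x \<in> cocycles A d"
  shows "\<iota> (cohom_class A d x) = \<pi> x"
  unfolding harm_rep_def
proof (rule the_inv_into_f_eq)
  show "inj_on (cohom_class A d) (harmonic A d h)"
  proof (rule inj_onI)
    fix u v assume "u \<in> harmonic A d h" "v \<in> harmonic A d h"
      and eq: "cohom_class A d u = cohom_class A d v"
    then obtain x y where "x \<in> carrier A" "u = \<pi> x" "y \<in> carrier A" "v = \<pi> y"
      by (auto simp: harmonic_def)
    then show "u = v" using \<pi>_eqI[OF _ _ eq] by (simp add: \<pi>_\<pi>)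
  qed
  show "cohom_class A d (\<pi> x) = cohom_class A d x" by (rule cohom_class_\<pi>[OF assms])
  show "\<pi> x \<in> harmonic A d h" using assms by (simp add: harmonic_def cocycles_closed)
qed

lemma linear_on_\<iota>: "linear_on K (cohomology A d) (carrier (cohomology A d)) A \<iota>"
  by (intro linear_onI)
     (auto elim!: cohomology_cases
        simp: cohom_class_add[symmetric] cohom_class_smult[symmetric] harm_rep_cohom_class
          cocycles_closed cocycles_add cocycles_smult linear_onD[OF linear_on_\<pi>])

lemma \<iota>_homog: "X \<in> homog (cohomology A d) k \<Longrightarrow> \<iota> X \<in> homog A k"
  by (auto simp: homog_cohomology harm_rep_cohom_class \<pi>_homog)

text \<open>Despite its name this is not the cup product but the homotopy, of degree -1, that
  measures how far \<open>\<iota>\<close> is from respecting it.\<close>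

definition cup :: "'a set \<Rightarrow> 'a set \<Rightarrow> 'a" where
  "cup X Y = h (\<iota> X \<otimes>\<^bsub>A\<^esub> \<iota> Y)"

sublocale cup_homotopy K A d \<iota> cup
proof (intro cup_homotopy.intro cup_homotopy_axioms.intro dgca_axioms)
  let ?H = "cohomology A d"
  fix X assume "X \<in> carrier ?H"
  then obtain x where x: "x \<in> cocycles A d" "X = cohom_class A d x" by (rule cohomology_cases)
  show X: "\<iota> X \<in> cocycles A d" "cohom_class A d (\<iota> X) = X"
    using x by (simp_all add: harm_rep_cohom_class cohom_class_\<pi> \<pi>_cocycle cocycles_closed)
  show "\<iota> (twist ?H 1 X) = twist A 1 (\<iota> X)"
    using x by (simp add: twist_cohom_class harm_rep_cohom_class cocycles_twist \<pi>_twist cocycles_closed)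
  fix Y assume "Y \<in> carrier ?H"
  then obtain y where y: "y \<in> cocycles A d" "Y = cohom_class A d y" by (rule cohomology_cases)
  then have Y: "\<iota> Y \<in> cocycles A d" "cohom_class A d (\<iota> Y) = Y"
    by (simp_all add: harm_rep_cohom_class cohom_class_\<pi> \<pi>_cocycle cocycles_closed)
  show "cup X Y \<in> carrier A"
    using X Y by (simp add: cup_def cocycles_closed)
  have XY: "\<iota> X \<otimes>\<^bsub>A\<^esub> \<iota> Y \<in> cocycles A d" using X Y by (simp add: cocycles_mult)
  have "X \<otimes>\<^bsub>?H\<^esub> Y = cohom_class A d (\<iota> X \<otimes>\<^bsub>A\<^esub> \<iota> Y)"
    using X Y by (simp add: cohom_class_mult)
  \<comment> \<open>The harmonic representative of the product class is \<open>\<pi>\<close> of a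
    product of representatives, and on cocycles \<open>\<pi>\<close> equals
    \<open>id - d h\<close>.\<close>
  then have "\<iota> (X \<otimes>\<^bsub>?H\<^esub> Y) = \<iota> X \<otimes>\<^bsub>A\<^esub> \<iota> Y \<ominus>\<^bsub>A\<^esub> d (cup X Y)"
    using harm_rep_cohom_class[OF XY] by (simp add: \<pi>_of_cocycle[OF XY] cup_def)
  then show "d (cup X Y) = \<iota> X \<otimes>\<^bsub>A\<^esub> \<iota> Y \<ominus>\<^bsub>A\<^esub> \<iota> (X \<otimes>\<^bsub>?H\<^esub> Y)"
    using cocycles_closed[OF XY] by (simp add: cup_def M.diff_diff M.minus_eq M.minus_add M.r_neg2 M.a_comm)
qed

lemma cup_homog:
  "\<lbrakk>X \<in> homog (cohomology A d) i; Y \<in> homog (cohomology A d) j\<rbrakk> \<Longrightarrow> cup X Y \<in> homog A (i + j - 1)"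
  unfolding cup_def by (intro h_homog mult_homog \<iota>_homog)

lemma cup_commute:
  assumes "X \<in> homog (cohomology A d) i" "Y \<in> homog (cohomology A d) j"
  shows "cup Y X = [neg1_pow (i * j)] \<cdot>\<^bsub>A\<^esub> cup X Y"
proof -
  have XY: "\<iota> X \<otimes>\<^bsub>A\<^esub> \<iota> Y \<in> carrier A"
    using assms by (intro m_closed s_closed coh.homog_closed)
  have "cup Y X = h ([neg1_pow (j * i)] \<cdot>\<^bsub>A\<^esub> (\<iota> X \<otimes>\<^bsub>A\<^esub> \<iota> Y))"
    using graded_comm[OF \<iota>_homog \<iota>_homog, OF assms(2,1)] by (simp add: cup_def)
  then show ?thesis
    using XY by (simp add: cup_def M.add_pow_neg1_pow h_additive(2) mult.commute)
qed

lemma linear_on_cup: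
  assumes "Y \<in> carrier (cohomology A d)"
  shows "linear_on K (cohomology A d) (carrier (cohomology A d)) A (\<lambda>X. cup X Y)"
    and "linear_on K (cohomology A d) (carrier (cohomology A d)) A (cup Y)"
  unfolding cup_def[abs_def] using assms
  by (intro linear_on_compose[OF _ h_linear] linear_on_mult_right linear_on_mult_left linear_on_\<iota>;
      simp add: s_closed)+

section \<open>The ternary operation as a Harrison cocycle\<close>

definition pre_mu3 :: "'a set \<Rightarrow> 'a set \<Rightarrow> 'a set \<Rightarrow> 'a" where
  "pre_mu3 X Y Z = (cup X Y \<otimes>\<^bsub>A\<^esub> \<iota> Z) \<ominus>\<^bsub>A\<^esub> (\<iota> (twist (cohomology A d) 1 X) \<otimes>\<^bsub>A\<^esub> cup Y Z)"

lemma mu3_eq: "mu3 A d h = (\<lambda>as\<in>tuples (cohomology A d) 3.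
    cohom_class A d (\<pi> (pre_mu3 (as ! 0) (as ! 1) (as ! 2))))"
  by (simp add: mu3_def pre_mu3_def cup_def Let_def)

lemma linear_on_cohom_class_\<pi>:
  "linear_on K A (carrier A) (cohomology A d) (\<lambda>x. cohom_class A d (\<pi> x))"
  by (rule linear_on_compose[OF linear_on_\<pi> linear_on_cohom_class]) (rule \<pi>_cocycle)

lemma pre_mu3_closed:
  "\<lbrakk>X \<in> carrier (cohomology A d); Y \<in> carrier (cohomology A d); Z \<in> carrier (cohomology A d)\<rbrakk> \<Longrightarrow>
    pre_mu3 X Y Z \<in> carrier A"
  by (simp add: pre_mu3_def s_closed G_closed)

text \<open>Expand \<open>\<pi> = id - d h - h d\<close> on \<open>p = pre_mu3 X Y Z\<close>, which
  need not be closed. The part \<open>d h p\<close> is exact, and \<open>h d p\<close> equals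
  \<open>cup X (Y \<otimes> Z) - cup (X \<otimes> Y) Z\<close>, so subtracting it supplies the two
  correction terms of \<open>massey\<close>.\<close>

lemma cohom_class_\<pi>_pre_mu3:
  assumes [simp]: "X \<in> carrier (cohomology A d)" "Y \<in> carrier (cohomology A d)" "Z \<in> carrier (cohomology A d)"
  shows "cohom_class A d (\<pi> (pre_mu3 X Y Z)) = cohom_class A d (massey A d \<iota> cup X Y Z)"
proof -
  let ?H = "cohomology A d"
  have "d (pre_mu3 X Y Z) = (\<iota> X \<otimes>\<^bsub>A\<^esub> \<iota> Y \<ominus>\<^bsub>A\<^esub> \<iota> (X \<otimes>\<^bsub>?H\<^esub> Y)) \<otimes>\<^bsub>A\<^esub> \<iota> Z
      \<ominus>\<^bsub>A\<^esub> \<iota> X \<otimes>\<^bsub>A\<^esub> (\<iota> Y \<otimes>\<^bsub>A\<^esub> \<iota> Z \<ominus>\<^bsub>A\<^esub> \<iota> (Y \<otimes>\<^bsub>?H\<^esub> Z))"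
    by (simp add: pre_mu3_def d_additive leibniz_twist d_G G_closed s_closed d_s s_twist
        d_twist twist_twist twist_additive)
  \<comment> \<open>The threefold products cancel by associativity; what remains are products of two
    section values, on which \<open>h\<close> is \<open>cup\<close>.\<close>
  also have "\<dots> = \<iota> X \<otimes>\<^bsub>A\<^esub> \<iota> (Y \<otimes>\<^bsub>?H\<^esub> Z) \<ominus>\<^bsub>A\<^esub> \<iota> (X \<otimes>\<^bsub>?H\<^esub> Y) \<otimes>\<^bsub>A\<^esub> \<iota> Z"
    by (simp add: s_closed ring_normalize)
  finally have "h (d (pre_mu3 X Y Z)) = cup X (Y \<otimes>\<^bsub>?H\<^esub> Z) \<ominus>\<^bsub>A\<^esub> cup (X \<otimes>\<^bsub>?H\<^esub> Y) Z"
    by (simp add: cup_def h_additive(3) s_closed)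
  then have "massey A d \<iota> cup X Y Z = \<pi> (pre_mu3 X Y Z) \<oplus>\<^bsub>A\<^esub> d (h (pre_mu3 X Y Z))"
    unfolding harm_proj_def massey_def pre_mu3_def[symmetric]
    by (simp add: G_closed pre_mu3_closed ring_normalize)
  then show ?thesis
    using cohom_class_eqI[of "h (pre_mu3 X Y Z)" "\<pi> (pre_mu3 X Y Z)"] by (simp add: pre_mu3_closed)
qed

lemma mu3_CHoch: "mu3 A d h \<in> CHoch K (cohomology A d) 3 (-1)"
  unfolding mu3_eq
proof (rule coh.CHoch_3I)
  let ?H = "cohomology A d"
  show "linear_on K ?H (carrier ?H) ?H (\<lambda>X. cohom_class A d (\<pi> (pre_mu3 X Y Z)))"
    if "Y \<in> carrier ?H" "Z \<in> carrier ?H" for Y Z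
    using that unfolding pre_mu3_def
    by (intro linear_on_compose[OF _ linear_on_cohom_class_\<pi>] linear_on_diff linear_on_mult_right
        linear_on_cup linear_on_compose[OF coh.linear_on_twist linear_on_\<iota>])
       (simp_all add: s_closed G_closed)
  show "linear_on K ?H (carrier ?H) ?H (\<lambda>Y. cohom_class A d (\<pi> (pre_mu3 X Y Z)))"
    if "X \<in> carrier ?H" "Z \<in> carrier ?H" for X Z
    using that unfolding pre_mu3_def
    by (intro linear_on_compose[OF _ linear_on_cohom_class_\<pi>] linear_on_diff linear_on_mult_right
        linear_on_mult_left linear_on_cup)
       (simp_all add: s_closed G_closed)
  show "linear_on K ?H (carrier ?H) ?H (\<lambda>Z. cohom_class A d (\<pi> (pre_mu3 X Y Z)))"
    if "X \<in> carrier ?H" "Y \<in> carrier ?H" for X Y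
    using that unfolding pre_mu3_def
    by (intro linear_on_compose[OF _ linear_on_cohom_class_\<pi>] linear_on_diff linear_on_mult_left
        linear_on_\<iota> linear_on_cup)
       (simp_all add: s_closed G_closed)
  show "cohom_class A d (\<pi> (pre_mu3 X Y Z)) \<in> homog ?H (i + j + k + - 1)"
    if "X \<in> homog ?H i" "Y \<in> homog ?H j" "Z \<in> homog ?H k" for i j k X Y Z
  proof -
    have "cup X Y \<otimes>\<^bsub>A\<^esub> \<iota> Z \<in> homog A ((i + j - 1) + k)"
      using that by (intro mult_homog cup_homog \<iota>_homog)
    moreover have "\<iota> (twist ?H 1 X) \<otimes>\<^bsub>A\<^esub> cup Y Z \<in> homog A (i + (j + k - 1))"
      using that by (intro mult_homog cup_homog \<iota>_homog coh.twist_homog)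
    ultimately have "pre_mu3 X Y Z \<in> homog A (i + j + k - 1)"
      unfolding pre_mu3_def by (intro homog_diff) (simp_all add: algebra_simps)
    then show ?thesis
      using \<pi>_homog \<pi>_cocycle homog_closed by (simp add: homog_cohomology)
  qed
qed

text \<open>The shuffle relations hold for \<open>pre_mu3\<close> before classes are taken: the
  product of \<open>A\<close> is strictly graded commutative, and \<open>cup\<close> inherits this.
  By linearity, \<open>comb\<close> moves the signed sum inside the class of the projection.\<close>

lemma mu3_CHarr: "mu3 A d h \<in> CHarr K (cohomology A d) 3 (-1)"
proof (rule coh.CHarr_3I[OF mu3_CHoch])
  let ?H = "cohomology A d"
  let ?L = "\<lambda>x. cohom_class A d (\<pi> x)"
  note L = linear_on_additive[OF linear_on_cohom_class_\<pi> M.abelian_group_axioms coh.M.abelian_group_axioms]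
    linear_onD(1,2)[OF linear_on_cohom_class_\<pi>]
  have comb: "(?L x \<ominus>\<^bsub>?H\<^esub> [neg1_pow m] \<cdot>\<^bsub>?H\<^esub> ?L y) \<oplus>\<^bsub>?H\<^esub> [neg1_pow l] \<cdot>\<^bsub>?H\<^esub> ?L z
    = ?L ((x \<ominus>\<^bsub>A\<^esub> [neg1_pow m] \<cdot>\<^bsub>A\<^esub> y) \<oplus>\<^bsub>A\<^esub> [neg1_pow l] \<cdot>\<^bsub>A\<^esub> z)"
    if "x \<in> carrier A" "y \<in> carrier A" "z \<in> carrier A" for x y z l m
    using that by (simp add: M.add_pow_neg1_pow coh.M.add_pow_neg1_pow L)
  fix i j k X Y Z assume XYZ: "X \<in> homog ?H i" "Y \<in> homog ?H j" "Z \<in> homog ?H k"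
  note [simp] = XYZ[THEN coh.homog_closed]
  have tw: "\<iota> (twist ?H 1 X) = [neg1_pow i] \<cdot>\<^bsub>A\<^esub> \<iota> X" "\<iota> (twist ?H 1 Y) = [neg1_pow j] \<cdot>\<^bsub>A\<^esub> \<iota> Y"
    "\<iota> (twist ?H 1 Z) = [neg1_pow k] \<cdot>\<^bsub>A\<^esub> \<iota> Z"
    using XYZ by (simp_all add: s_twist twist_of_homog[OF \<iota>_homog])
  note hom = \<iota>_homog[OF XYZ(1)] \<iota>_homog[OF XYZ(2)] \<iota>_homog[OF XYZ(3)]
    cup_homog[OF XYZ(1,2)] cup_homog[OF XYZ(2,3)] cup_homog[OF XYZ(1,3)]
  note comm = cup_commute[OF XYZ(1,2)] cup_commute[OF XYZ(2,3)] cup_commute[OF XYZ(1,3)]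
  show "(mu3 A d h [X, Y, Z] \<ominus>\<^bsub>?H\<^esub> [neg1_pow (i * j)] \<cdot>\<^bsub>?H\<^esub> mu3 A d h [Y, X, Z])
    \<oplus>\<^bsub>?H\<^esub> [neg1_pow (i * (j + k))] \<cdot>\<^bsub>?H\<^esub> mu3 A d h [Y, Z, X] = \<zero>\<^bsub>?H\<^esub>"
    using massey_shuffle_1[OF hom] L(1)
    by (simp add: mu3_eq comb pre_mu3_closed) (simp add: pre_mu3_def tw comm)
  show "(mu3 A d h [X, Y, Z] \<ominus>\<^bsub>?H\<^esub> [neg1_pow (j * k)] \<cdot>\<^bsub>?H\<^esub> mu3 A d h [X, Z, Y])
    \<oplus>\<^bsub>?H\<^esub> [neg1_pow ((i + j) * k)] \<cdot>\<^bsub>?H\<^esub> mu3 A d h [Z, X, Y] = \<zero>\<^bsub>?H\<^esub>"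
    using massey_shuffle_2[OF hom] L(1)
    by (simp add: mu3_eq comb pre_mu3_closed) (simp add: pre_mu3_def tw comm)
qed

lemma mu3_massey:
  assumes "X \<in> carrier (cohomology A d)" "Y \<in> carrier (cohomology A d)" "Z \<in> carrier (cohomology A d)"
  shows "mu3 A d h [X, Y, Z] = cohom_class A d (massey A d \<iota> cup X Y Z)"
  using assms by (simp add: mu3_eq cohom_class_\<pi>_pre_mu3)

lemma mu3_ZHarr: "mu3 A d h \<in> ZHarr K (cohomology A d) 3 (-1)"
proof -
  let ?H = "cohomology A d"
  have f: "mu3 A d h \<in> tuples ?H 3 \<rightarrow> carrier ?H"
    using mu3_CHoch by (auto simp: CHoch_def)
  have "d_Hoch ?H 3 (-1) (mu3 A d h) as = \<zero>\<^bsub>?H\<^esub>" if "as \<in> tuples ?H 4" for as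
    using that
  proof (cases rule: tuples_4_cases)
    case (1 X Y Z W)
    then show ?thesis
      \<comment> \<open>The differential twists with exponent -1, the degree of the cochain, and the
        triple product with exponent 1; only the parity counts.\<close>
      using massey_Harrison_cocycle[of X Y Z W] coh.twist_uminus_exponent[of 1 X]
      by (simp add: coh.d_Hoch_3[OF f] mu3_massey)
  qed
  \<comment> \<open>Cochains are compared as functions, so the values off the tuples have to agree
    as well.\<close>
  moreover have "d_Hoch ?H 3 (-1) (mu3 A d h) \<in> extensional (tuples ?H 4)"
    by (simp add: d_Hoch_def)
  ultimately have "d_Hoch ?H 3 (-1) (mu3 A d h) = zero_cochain ?H 4"
    by (intro extensionalityI[of _ "tuples ?H 4"]) (simp_all add: zero_cochain_def)
  then show ?thesis using mu3_CHarr by (simp add: ZHarr_def)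
qed

end

section \<open>Independence of the contraction\<close>

text \<open>For \<open>t' = d t\<close> and \<open>u' = d u\<close> the right-hand side is \<open>d (- (-1)\<^sup>i t u)\<close>.\<close>

lemma (in graded_comm_algebra) shuffle_defect:
  assumes "p \<in> homog B i" "q \<in> homog B j" "t \<in> homog B (i - 1)" "u \<in> homog B (j - 1)"
    and "t' \<in> homog B i" "u' \<in> homog B j" "g \<in> carrier B" "g' \<in> carrier B" "v \<in> carrier B"
  shows "(g' \<ominus>\<^bsub>B\<^esub> (((g \<ominus>\<^bsub>B\<^esub> t \<otimes>\<^bsub>B\<^esub> q) \<ominus>\<^bsub>B\<^esub> ([neg1_pow i] \<cdot>\<^bsub>B\<^esub> (p \<ominus>\<^bsub>B\<^esub> t')) \<otimes>\<^bsub>B\<^esub> u) \<oplus>\<^bsub>B\<^esub> v))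
      \<ominus>\<^bsub>B\<^esub> [neg1_pow (i * j)] \<cdot>\<^bsub>B\<^esub> ([neg1_pow (i * j)] \<cdot>\<^bsub>B\<^esub> g'
        \<ominus>\<^bsub>B\<^esub> ((([neg1_pow (i * j)] \<cdot>\<^bsub>B\<^esub> g \<ominus>\<^bsub>B\<^esub> u \<otimes>\<^bsub>B\<^esub> p) \<ominus>\<^bsub>B\<^esub> ([neg1_pow j] \<cdot>\<^bsub>B\<^esub> (q \<ominus>\<^bsub>B\<^esub> u')) \<otimes>\<^bsub>B\<^esub> t)
          \<oplus>\<^bsub>B\<^esub> [neg1_pow (i * j)] \<cdot>\<^bsub>B\<^esub> v))
    = t \<otimes>\<^bsub>B\<^esub> u' \<ominus>\<^bsub>B\<^esub> [neg1_pow i] \<cdot>\<^bsub>B\<^esub> (t' \<otimes>\<^bsub>B\<^esub> u)"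
proof -
  note [simp] = assms(1-6)[THEN homog_closed] assms(7-9)
  have comm: "u \<otimes>\<^bsub>B\<^esub> p = [neg1_pow ((j - 1) * i)] \<cdot>\<^bsub>B\<^esub> (p \<otimes>\<^bsub>B\<^esub> u)"
    "q \<otimes>\<^bsub>B\<^esub> t = [neg1_pow (j * (i - 1))] \<cdot>\<^bsub>B\<^esub> (t \<otimes>\<^bsub>B\<^esub> q)"
    "u' \<otimes>\<^bsub>B\<^esub> t = [neg1_pow (j * (i - 1))] \<cdot>\<^bsub>B\<^esub> (t \<otimes>\<^bsub>B\<^esub> u')"
    using assms by (auto intro!: graded_comm)
  show ?thesis
    by (cases "even i"; cases "even j")
       (simp_all add: comm M.add_pow_neg1_pow ring_normalize)
qed

lemma (in contraction) mu3_harr_class_subset: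
  assumes "contraction K A d h'"
  shows "harr_class K (cohomology A d) 3 (-1) (mu3 A d h)
    \<subseteq> harr_class K (cohomology A d) 3 (-1) (mu3 A d h')"
proof -
  interpret P: contraction K A d h' by fact
  let ?H = "cohomology A d"
  let ?T = "twist (cohomology A d) 1"
  define t where "t X = h' (\<iota> X)" for X
  define G where "G X Y = ((cup X Y \<ominus>\<^bsub>A\<^esub> t X \<otimes>\<^bsub>A\<^esub> \<iota> Y) \<ominus>\<^bsub>A\<^esub> P.\<iota> (?T X) \<otimes>\<^bsub>A\<^esub> t Y)
        \<oplus>\<^bsub>A\<^esub> t (X \<otimes>\<^bsub>?H\<^esub> Y)" for X Y
  define f where "f X Y = cohom_class A d (P.cup X Y \<ominus>\<^bsub>A\<^esub> G X Y)" for X Y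
  have t: "t X \<in> carrier A" if "X \<in> carrier ?H" for X
    using that by (simp add: t_def s_closed)
  have t_twist: "twist A 1 (t X) = \<ominus>\<^bsub>A\<^esub> t (?T X)" if "X \<in> carrier ?H" for X
    using that by (simp add: t_def s_closed s_twist P.h_twist)
  \<comment> \<open>\<open>\<iota> X\<close> is itself a representative of \<open>X\<close>, so
    projecting it by the second contraction gives the second harmonic representative.\<close>
  have \<iota>': "P.\<iota> X = \<iota> X \<ominus>\<^bsub>A\<^esub> d (t X)" if "X \<in> carrier ?H" for X
    using that P.harm_rep_cohom_class[of "\<iota> X"] P.\<pi>_of_cocycle[of "\<iota> X"]
    by (simp add: t_def s_class s_cocycle)
  have t_homog: "t X \<in> homog A (k - 1)" if "X \<in> homog ?H k" for X k
    using that by (simp add: t_def P.h_homog \<iota>_homog)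
  have t_linear: "linear_on K ?H (carrier ?H) A t"
    unfolding t_def[abs_def] by (intro linear_on_compose[OF linear_on_\<iota> P.h_linear] s_closed)
  interpret Q: cup_homotopy K A d P.\<iota> G
    by (rule change_section[OF t t_twist \<iota>' G_def])
  have diff: "P.cup X Y \<ominus>\<^bsub>A\<^esub> G X Y \<in> cocycles A d" if "X \<in> carrier ?H" "Y \<in> carrier ?H" for X Y
    using that
    by (simp add: cocycles_def d_additive(3) P.G_closed Q.G_closed P.d_G Q.d_G P.s_closed M.diff_eq_iff)
  have mu3: "mu3 A d h [X, Y, Z] = mu3 A d h' [X, Y, Z] \<oplus>\<^bsub>?H\<^esub> (((?T X \<otimes>\<^bsub>?H\<^esub> f Y Z
      \<ominus>\<^bsub>?H\<^esub> f (X \<otimes>\<^bsub>?H\<^esub> Y) Z) \<oplus>\<^bsub>?H\<^esub> f X (Y \<otimes>\<^bsub>?H\<^esub> Z)) \<ominus>\<^bsub>?H\<^esub> f X Y \<otimes>\<^bsub>?H\<^esub> Z)"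
    if XYZ: "X \<in> carrier ?H" "Y \<in> carrier ?H" "Z \<in> carrier ?H" for X Y Z
    using mu3_massey[OF XYZ] P.mu3_massey[OF XYZ] massey_change_section[OF t t_twist \<iota>' G_def XYZ]
      Q.massey_change_homotopy[OF P.cup_homotopy_axioms XYZ]
    by (simp add: f_def)
  let ?f = "\<lambda>as\<in>tuples ?H 2. f (as ! 0) (as ! 1)"
  \<comment> \<open>Linearity and degree are checked for the difference of cochains; the class map
    then carries them over to \<open>f\<close>.\<close>
  have linear: "linear_on K ?H (carrier ?H) A (\<lambda>X. P.cup X Y \<ominus>\<^bsub>A\<^esub> G X Y)"
    "linear_on K ?H (carrier ?H) A (\<lambda>X. P.cup Y X \<ominus>\<^bsub>A\<^esub> G Y X)" if "Y \<in> carrier ?H" for Y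
    using that unfolding G_def
    by (intro linear_on_diff linear_on_add linear_on_mult_right linear_on_mult_left linear_on_cup
        P.linear_on_cup P.linear_on_\<iota> linear_on_\<iota> t_linear
        linear_on_compose[OF coh.linear_on_twist P.linear_on_\<iota>]
        linear_on_compose[OF coh.linear_on_mult_right[OF coh.linear_on_id] t_linear]
        linear_on_compose[OF coh.linear_on_mult_left[OF coh.linear_on_id] t_linear];
      simp add: t P.s_closed s_closed)+
  have homog: "P.cup X Y \<ominus>\<^bsub>A\<^esub> G X Y \<in> homog A (i + j - 1)"
    if "X \<in> homog ?H i" "Y \<in> homog ?H j" for X Y i j
  proof -
    have "t X \<otimes>\<^bsub>A\<^esub> \<iota> Y \<in> homog A (i - 1 + j)"
      using that by (intro mult_homog t_homog \<iota>_homog)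
    moreover have "P.\<iota> (?T X) \<otimes>\<^bsub>A\<^esub> t Y \<in> homog A (i + (j - 1))"
      using that by (intro mult_homog t_homog P.\<iota>_homog coh.twist_homog)
    ultimately show ?thesis
      using that unfolding G_def
      by (intro homog_diff homog_add P.cup_homog cup_homog t_homog coh.mult_homog)
         (simp_all add: algebra_simps)
  qed
  have CHoch: "?f \<in> CHoch K ?H 2 (-1)"
  proof (rule coh.CHoch_2I)
    show "linear_on K ?H (carrier ?H) ?H (\<lambda>X. f X Y)" "linear_on K ?H (carrier ?H) ?H (f Y)"
      if "Y \<in> carrier ?H" for Y
      using that diff unfolding f_def[abs_def]
      by (intro linear_on_compose[OF linear(1) linear_on_cohom_class]
          linear_on_compose[OF linear(2) linear_on_cohom_class]; simp)+
    show "f X Y \<in> homog ?H (i + j + - 1)" if "X \<in> homog ?H i" "Y \<in> homog ?H j" for X Y i j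
      using homog[OF that] diff that[THEN coh.homog_closed] by (simp add: f_def homog_cohomology)
  qed
  have CHarr: "?f \<in> CHarr K ?H 2 (-1)"
  proof (rule coh.CHarr_2I[OF CHoch])
    fix i j X Y assume XY: "X \<in> homog ?H i" "Y \<in> homog ?H j"
    note XY' [simp] = XY[THEN coh.homog_closed]
    have tX: "t X \<in> homog A (i - 1)" "d (t X) \<in> homog A i" "t Y \<in> homog A (j - 1)" "d (t Y) \<in> homog A j"
      using t_homog[OF XY(1)] t_homog[OF XY(2)] d_homog[of "t X" "i - 1"] d_homog[of "t Y" "j - 1"]
      by simp_all
    \<comment> \<open>On products \<open>t\<close> is graded symmetric because the cohomology is
      graded commutative; this is the role of \<open>v\<close> in
      \<open>shuffle_defect\<close>.\<close>
    have tYX: "t (Y \<otimes>\<^bsub>?H\<^esub> X) = [neg1_pow (i * j)] \<cdot>\<^bsub>A\<^esub> t (X \<otimes>\<^bsub>?H\<^esub> Y)"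
      using coh.graded_comm[OF XY(2,1)] linear_on_additive(2)[OF t_linear coh.M.abelian_group_axioms M.abelian_group_axioms]
      by (simp add: M.add_pow_neg1_pow coh.M.add_pow_neg1_pow t mult.commute)
    have tw: "P.\<iota> (?T X) = [neg1_pow i] \<cdot>\<^bsub>A\<^esub> (\<iota> X \<ominus>\<^bsub>A\<^esub> d (t X))"
      "P.\<iota> (?T Y) = [neg1_pow j] \<cdot>\<^bsub>A\<^esub> (\<iota> Y \<ominus>\<^bsub>A\<^esub> d (t Y))"
      using XY by (simp_all add: P.s_twist twist_of_homog[OF P.\<iota>_homog] flip: \<iota>')
    have defect: "(P.cup X Y \<ominus>\<^bsub>A\<^esub> G X Y) \<ominus>\<^bsub>A\<^esub> [neg1_pow (i * j)] \<cdot>\<^bsub>A\<^esub> (P.cup Y X \<ominus>\<^bsub>A\<^esub> G Y X)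
      = t X \<otimes>\<^bsub>A\<^esub> d (t Y) \<ominus>\<^bsub>A\<^esub> [neg1_pow i] \<cdot>\<^bsub>A\<^esub> (d (t X) \<otimes>\<^bsub>A\<^esub> t Y)"
      unfolding G_def tw tYX cup_commute[OF XY] P.cup_commute[OF XY]
      by (rule shuffle_defect) (use tX XY in \<open>simp_all add: \<iota>_homog G_closed P.G_closed t\<close>)
    also have "\<dots> = d (\<ominus>\<^bsub>A\<^esub> ([neg1_pow i] \<cdot>\<^bsub>A\<^esub> (t X \<otimes>\<^bsub>A\<^esub> t Y)))"
      using t by (simp add: leibniz[OF tX(1)] M.add_pow_neg1_pow d_additive ring_normalize)
    finally have exact: "(P.cup X Y \<ominus>\<^bsub>A\<^esub> G X Y) \<ominus>\<^bsub>A\<^esub> [neg1_pow (i * j)] \<cdot>\<^bsub>A\<^esub> (P.cup Y X \<ominus>\<^bsub>A\<^esub> G Y X)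
      = d (\<ominus>\<^bsub>A\<^esub> ([neg1_pow i] \<cdot>\<^bsub>A\<^esub> (t X \<otimes>\<^bsub>A\<^esub> t Y)))" .
    have "f X Y \<ominus>\<^bsub>?H\<^esub> [neg1_pow (i * j)] \<cdot>\<^bsub>?H\<^esub> f Y X = cohom_class A d
      ((P.cup X Y \<ominus>\<^bsub>A\<^esub> G X Y) \<ominus>\<^bsub>A\<^esub> [neg1_pow (i * j)] \<cdot>\<^bsub>A\<^esub> (P.cup Y X \<ominus>\<^bsub>A\<^esub> G Y X))"
      using diff[of X Y] diff[of Y X]
      by (simp add: f_def coh.M.add_pow_neg1_pow M.add_pow_neg1_pow cohom_class_diff
          cohom_class_uminus cocycles_uminus cocycles_closed)
    also have "\<dots> = cohom_class A d \<zero>\<^bsub>A\<^esub>"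
      unfolding exact
      by (rule cohom_class_eqI[of "\<ominus>\<^bsub>A\<^esub> ([neg1_pow i] \<cdot>\<^bsub>A\<^esub> (t X \<otimes>\<^bsub>A\<^esub> t Y))"]) (simp_all add: t)
    finally show "?f [X, Y] \<ominus>\<^bsub>?H\<^esub> [neg1_pow (i * j)] \<cdot>\<^bsub>?H\<^esub> ?f [Y, X] = \<zero>\<^bsub>?H\<^esub>"
      by (simp add: cohomology_zero)
  qed
  have f: "?f \<in> tuples ?H 2 \<rightarrow> carrier ?H"
    using CHoch by (auto simp: CHoch_def)
  show ?thesis
  proof (rule coh.harr_class_3_subset[OF CHarr])
    fix as assume as: "as \<in> tuples ?H 3"
    show "mu3 A d h' as \<in> carrier ?H"
      using P.mu3_CHoch as by (auto simp: CHoch_def)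
    from as show "mu3 A d h as = mu3 A d h' as \<oplus>\<^bsub>?H\<^esub> d_Hoch ?H 2 (-1) ?f as"
    proof (cases rule: tuples_3_cases)
      case (1 X Y Z)
      then show ?thesis
        using mu3[of X Y Z] coh.twist_uminus_exponent[of 1 X] coh.d_Hoch_2[OF f 1(2-4), of "-1"]
        by simp
    qed
  qed
qed

lemma contraction_of_hodge_homotopy:
  assumes "poincare_dgca K A d n fc" "hodge_homotopy K A d n fc h"
  shows "contraction K A d h"
proof (intro contraction.intro contraction_axioms.intro)
  show "dgca K A d" by (rule poincare_dgca.axioms(1)[OF assms(1)])
qed (use assms(2) in \<open>auto simp: hodge_homotopy_def\<close>)

theorem lemma3p1:
  fixes K :: "('k, 'm) ring_scheme"
    and A :: "('k, 'a, 'n) graded_algebra_scheme"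
    and d :: "'a \<Rightarrow> 'a"
    and n :: nat
    and fc :: "'a set \<Rightarrow> 'k"
  assumes "poincare_dgca K A d n fc"
    and "\<exists>dm. hodge_homotopy K A d n fc dm"
  shows
    "(\<forall>dm dm'. hodge_homotopy K A d n fc dm \<and> hodge_homotopy K A d n fc dm' \<longrightarrow>
        mu3 A d dm \<in> ZHarr K (cohomology A d) 3 (-1) \<and>
        mu3 A d dm' \<in> ZHarr K (cohomology A d) 3 (-1) \<and>
        harr_class K (cohomology A d) 3 (-1) (mu3 A d dm) =
        harr_class K (cohomology A d) 3 (-1) (mu3 A d dm')) \<and>
     (\<exists>!c. c \<in> carrier (HHarr K (cohomology A d) 3 (-1)) \<and>
        (\<forall>dm. hodge_homotopy K A d n fc dm \<longrightarrow>
           harr_class K (cohomology A d) 3 (-1) (mu3 A d dm) = c))"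
proof -
  let ?H = "cohomology A d"
  note contraction = contraction_of_hodge_homotopy[OF assms(1)]
  have Z: "mu3 A d dm \<in> ZHarr K ?H 3 (-1)" if "hodge_homotopy K A d n fc dm" for dm
    by (rule contraction.mu3_ZHarr[OF contraction[OF that]])
  \<comment> \<open>The inclusion is applied twice, with the two contractions exchanged.\<close>
  have eq: "harr_class K ?H 3 (-1) (mu3 A d dm) = harr_class K ?H 3 (-1) (mu3 A d dm')"
    if "hodge_homotopy K A d n fc dm" "hodge_homotopy K A d n fc dm'" for dm dm'
    using that contraction contraction.mu3_harr_class_subset by (intro equalityI) blast+
  have "harr_class K ?H 3 (-1) (mu3 A d dm) \<in> carrier (HHarr K ?H 3 (-1))"
    if "hodge_homotopy K A d n fc dm" for dm
    using Z[OF that]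
    by (auto simp: HHarr_def FactGroup_def RCOSETS_def harr_class_def ZHarr_group_def)
  \<comment> \<open>Uniqueness rests on the existence of a Hodge homotopy: if there were none, every
    class would satisfy the condition vacuously.\<close>
  with assms(2) Z eq show ?thesis by blast
qed

end
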